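(* Let $K$ be an infinite field and let $n\ge 1$ be an integer. There do not exist polynomials $p\in K\langle x_1,\dots,x_m\rangle$ (for any $m$) that are $4$-central for $M_n(K)$.
   Context: $K\langle x_1,\dots,x_m\rangle$ is the free associative algebra in noncommuting variables, and polynomials are evaluated on $M_n(K)$. A polynomial is central for $M_n(K)$ if it takes on only scalar values on $M_n(K)$ but does not vanish identically. A polynomial $p$ is $\nu$-central for $M_n(K)$ if $p^\nu$ is central, with $\nu\ge 1$ minimal such. *)

theory Defs
  imports "Jordan_Normal_Form.Matrix" "HOL-Library.Poly_Mapping"
begin

text \<open>Words in the letters \<open>x\<^sub>0, x\<^sub>1, \<dots>\<close> form the free monoid, written additively because the
  convolution product on \<^typ>\<open>'k \<Rightarrow>\<^sub>0 'a\<close> is indexed by an additive (here noncommutative) monoid of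
  exponents.\<close>

datatype ncword = NCWord (letters: "nat list")

instantiation ncword :: monoid_add
begin

definition "0 = NCWord []"
definition "u + v = NCWord (letters u @ letters v)"

instance
  by standard (auto simp: zero_ncword_def plus_ncword_def)

end

type_synonym 'a ncpoly = "ncword \<Rightarrow>\<^sub>0 'a"

text \<open>\<open>K\<langle>x\<^sub>1, \<dots>, x\<^sub>m\<rangle>\<close>, with the variables numbered from \<open>0\<close> to \<open>m - 1\<close>.\<close>

definition free_algebra :: "nat \<Rightarrow> 'a::field ncpoly set" where
  "free_algebra m = {p. \<forall>w \<in> Poly_Mapping.keys p. set (letters w) \<subseteq> {..<m}}"

definition eval_word :: "nat \<Rightarrow> (nat \<Rightarrow> 'a::field mat) \<Rightarrow> ncword \<Rightarrow> 'a mat" where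
  "eval_word n A w = foldr (\<lambda>i B. A i * B) (letters w) (1\<^sub>m n)"

text \<open>The value \<open>p(A\<^sub>0, A\<^sub>1, \<dots>) = \<Sum>\<^sub>w p\<^sub>w A\<^sub>w\<close>; the sum is taken entrywise, since \<^typ>\<open>'a mat\<close> is not
  an additive monoid as a type.\<close>

definition eval_ncpoly :: "nat \<Rightarrow> (nat \<Rightarrow> 'a::field mat) \<Rightarrow> 'a ncpoly \<Rightarrow> 'a mat" where
  "eval_ncpoly n A p = mat n n (\<lambda>ij.
     \<Sum>w \<in> Poly_Mapping.keys p. Poly_Mapping.lookup p w * eval_word n A w $$ ij)"

definition is_central :: "nat \<Rightarrow> nat \<Rightarrow> 'a::field ncpoly \<Rightarrow> bool" where
  "is_central m n p \<longleftrightarrow>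
     (\<forall>A. (\<forall>i<m. A i \<in> carrier_mat n n) \<longrightarrow> (\<exists>c. eval_ncpoly n A p = c \<cdot>\<^sub>m 1\<^sub>m n)) \<and>
     (\<exists>A. (\<forall>i<m. A i \<in> carrier_mat n n) \<and> eval_ncpoly n A p \<noteq> 0\<^sub>m n n)"

definition is_nu_central :: "nat \<Rightarrow> nat \<Rightarrow> nat \<Rightarrow> 'a::field ncpoly \<Rightarrow> bool" where
  "is_nu_central \<nu> m n p \<longleftrightarrow>
     \<nu> \<ge> 1 \<and> is_central m n (p ^ \<nu>) \<and> (\<forall>k. 1 \<le> k \<and> k < \<nu> \<longrightarrow> \<not> is_central m n (p ^ k))"

end

theory Submission
  imports Defs "HOL-Computational_Algebra.Polynomial" "HOL-Number_Theory.Cong" "Jordan_Normal_Form.Determinant"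
begin

text \<open>
Let \<open>R\<close> be the polynomial ring in the entries of generic \<open>n \<times> n\<close> matrices and \<open>Y = p(X\<^sub>1, \<dots>)\<close> the value of
\<open>p\<close> at these matrices. Suppose \<open>Y\<^sup>4 = c\<close> is scalar and nonzero; one has to see that \<open>Y\<^sup>2\<close> is scalar.

Write \<open>n = 2\<^sup>a r\<close> with \<open>r\<close> odd and index rows and columns by the group \<open>G = \<int>/r \<times> (\<int>/2)\<^sup>a\<close>, which acts on \<open>R\<close> by
translating both indices of a variable \<open>x\<^sub>h\<^sub>,\<^sub>k\<close>. Then \<open>Y\<close> is \<open>G\<close>-equivariant, and reading \<open>x\<^sub>h\<^sub>,\<^sub>k\<close> as an edge from
\<open>h\<close> to \<open>k\<close>, every monomial of \<open>Y\<^sub>h\<^sub>,\<^sub>k\<close> has boundary \<open>[k] - [h]\<close>. Counting variables by the difference \<open>k - h\<close> gives a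
\<open>G\<close>-invariant grading in which a homogeneous component of such a matrix is a monomial matrix attached to one
\<open>g \<in> G\<close> and one polynomial \<open>f\<close>. This is a generic abelian crossed product. The leading component \<open>s\<close> of \<open>Y\<close> has
\<open>s\<^sup>4\<close> scalar, so \<open>4g = 0\<close>, hence \<open>2g = 0\<close>, and \<open>f \<cdot> g(f)\<close> is invariant up to sign. If \<open>4\<close> divides \<open>n\<close>, unique
factorization in \<open>R\<close> shows that this forces a mod \<open>2\<close> invariant of the boundary of \<open>f\<close> to vanish, so \<open>g = 0\<close>.

In characteristic other than \<open>2\<close> it follows that the leading component \<open>z\<close> of \<open>Y\<^sup>2\<close> is scalar. If \<open>C = Y\<^sup>2 X - X Y\<^sup>2\<close>
were nonzero, the leading component of \<open>Y\<^sup>2 C + C Y\<^sup>2 = Y\<^sup>4 X - X Y\<^sup>4 = 0\<close> would be \<open>2z\<close> times that of \<open>C\<close>. In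
characteristic \<open>2\<close> and for \<open>n\<close> odd or divisible by \<open>4\<close>, \<open>s\<close> itself is scalar; since \<open>(Y - s)\<^sup>4 = Y\<^sup>4 - s\<^sup>4\<close>, one
descends to the conclusion that \<open>Y\<close> is scalar. In characteristic \<open>2\<close> with \<open>n = 2r\<close>, determinants give
\<open>det(Y)\<^sup>2 = c\<^sup>r\<close>, so a nonzero scalar multiple of \<open>Y\<^sup>2\<close> differs from the scalar \<open>det Y\<close> by a matrix of square zero,
which vanishes by comparing leading components.
\<close>

subsection \<open>Unique factorization over subdomains\<close>

text \<open>Rings are carried as subsets of one type because the induction over variables changes
  the ring at every step. Divisibility and primality are therefore relative to \<open>V\<close>,
  with the cofactor required to lie in \<open>V\<close>.\<close>

definition subring_dvd :: "'r::comm_ring_1 set \<Rightarrow> 'r \<Rightarrow> 'r \<Rightarrow> bool" where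
  "subring_dvd V q a \<longleftrightarrow> (\<exists>c\<in>V. a = q * c)"

definition subring_prime :: "'r::comm_ring_1 set \<Rightarrow> 'r \<Rightarrow> bool" where
  "subring_prime V q \<longleftrightarrow> q \<in> V \<and> q \<noteq> 0 \<and> \<not> subring_dvd V q 1 \<and>
     (\<forall>a\<in>V. \<forall>b\<in>V. subring_dvd V q (a * b) \<longrightarrow> subring_dvd V q a \<or> subring_dvd V q b)"

text \<open>Factoriality of \<open>V\<close> takes the form that every nonzero element is a unit
  times a product of prime elements.\<close>

inductive prime_product :: "'r::comm_ring_1 set \<Rightarrow> 'r \<Rightarrow> bool" for V where
  unit: "u \<in> V \<Longrightarrow> subring_dvd V u 1 \<Longrightarrow> prime_product V u"
| prime: "subring_prime V q \<Longrightarrow> prime_product V f \<Longrightarrow> prime_product V (q * f)"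

definition polys_over :: "'r::comm_ring_1 set \<Rightarrow> 'r poly set" where
  "polys_over V = {p. \<forall>i. coeff p i \<in> V}"

locale subdomain =
  fixes V :: "'r::idom set"
  assumes zero_mem: "0 \<in> V" and one_mem: "1 \<in> V"
    and add_mem: "a \<in> V \<Longrightarrow> b \<in> V \<Longrightarrow> a + b \<in> V"
    and uminus_mem: "a \<in> V \<Longrightarrow> - a \<in> V"
    and mult_mem: "a \<in> V \<Longrightarrow> b \<in> V \<Longrightarrow> a * b \<in> V"
begin

lemma diff_mem: "a \<in> V \<Longrightarrow> b \<in> V \<Longrightarrow> a - b \<in> V"
  using add_mem uminus_mem by fastforce

lemma power_mem: "a \<in> V \<Longrightarrow> a ^ k \<in> V"
  by (induction k) (auto intro: one_mem mult_mem)

lemma sum_mem: "(\<And>x. x \<in> I \<Longrightarrow> g x \<in> V) \<Longrightarrow> sum g I \<in> V"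
  by (induction I rule: infinite_finite_induct) (auto intro: zero_mem add_mem)

lemma dvd_add: "subring_dvd V q a \<Longrightarrow> subring_dvd V q b \<Longrightarrow> subring_dvd V q (a + b)"
  unfolding subring_dvd_def by (metis add_mem distrib_left)

lemma dvd_diff: "subring_dvd V q a \<Longrightarrow> subring_dvd V q b \<Longrightarrow> subring_dvd V q (a - b)"
  unfolding subring_dvd_def by (metis diff_mem right_diff_distrib)

lemma dvd_zero: "subring_dvd V q 0"
  unfolding subring_dvd_def using zero_mem by force

lemma dvd_sum: "(\<And>x. x \<in> I \<Longrightarrow> subring_dvd V q (g x)) \<Longrightarrow> subring_dvd V q (sum g I)"
  by (induction I rule: infinite_finite_induct) (auto intro: dvd_zero dvd_add)

lemma dvd_mult: "subring_dvd V q a \<Longrightarrow> b \<in> V \<Longrightarrow> subring_dvd V q (a * b)"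
  unfolding subring_dvd_def by (metis mult.assoc mult_mem)

lemma dvd_mult2: "subring_dvd V q a \<Longrightarrow> b \<in> V \<Longrightarrow> subring_dvd V q (b * a)"
  using dvd_mult by (simp add: mult.commute)

lemma dvd_trans: "subring_dvd V a b \<Longrightarrow> subring_dvd V b c \<Longrightarrow> subring_dvd V a c"
  unfolding subring_dvd_def by (metis mult.assoc mult_mem)

lemma dvd_refl: "subring_dvd V a a"
  unfolding subring_dvd_def using one_mem by force

lemma prime_product_mem: "prime_product V f \<Longrightarrow> f \<in> V"
  by (induction rule: prime_product.induct) (auto simp: subring_prime_def intro: mult_mem)

lemma prime_product_mult:
  assumes "prime_product V f" "prime_product V g"
  shows "prime_product V (f * g)"
  using assms(1)
proof (induction rule: prime_product.induct)
  case (unit u)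
  then obtain c where c: "c \<in> V" "1 = u * c" by (auto simp: subring_dvd_def)
  from assms(2) show ?case
  proof (cases rule: prime_product.cases)
    case unit
    then obtain d where d: "d \<in> V" "1 = g * d" by (auto simp: subring_dvd_def)
    have "1 = (u * g) * (c * d)" using c d by (metis mult.assoc mult.left_commute mult_1)
    with unit c d \<open>u \<in> V\<close> show ?thesis by (auto intro!: prime_product.unit mult_mem simp: subring_dvd_def)
  next
    case (prime q f)
    have "prime_product V (q * (u * f)) "
    proof -
      \<comment> \<open>The unit \<open>u\<close> travels past the primes of the second factor until
        it meets the unit that ends the product.\<close>
      have "prime_product V (u * f)" using prime(3)
      proof (induction rule: prime_product.induct)
        case (unit w)
        then obtain d where d: "d \<in> V" "1 = w * d" by (auto simp: subring_dvd_def)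
        have "1 = (u * w) * (c * d)" using c d by (metis mult.assoc mult.left_commute mult_1)
        with unit c d \<open>u \<in> V\<close> show ?case by (auto intro!: prime_product.unit mult_mem simp: subring_dvd_def)
      next
        case (prime q f)
        then show ?case by (metis prime_product.prime mult.left_commute)
      qed
      then show ?thesis using prime by (auto intro: prime_product.prime)
    qed
    then show ?thesis using prime by (simp add: mult.left_commute)
  qed
next
  case (prime q f)
  then show ?case by (simp add: mult.assoc prime_product.prime)
qed

text \<open>Write \<open>q = \<pi> * c\<close>. The prime \<open>q\<close> divides \<pi> or
  \<open>c\<close>; in the second case cancelling \<open>q\<close> would make \<pi> a unit.\<close>

lemma prime_dvd_prime:
  assumes "subring_prime V q" "subring_prime V \<pi>" "subring_dvd V \<pi> q"
  shows "subring_dvd V q \<pi>"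
proof -
  obtain c where c: "c \<in> V" "q = \<pi> * c" using assms(3) by (auto simp: subring_dvd_def)
  have "subring_dvd V q (\<pi> * c)" using c dvd_refl by simp
  then consider "subring_dvd V q \<pi>" | "subring_dvd V q c"
    using assms c unfolding subring_prime_def by blast
  then show ?thesis
  proof cases
    case 2
    then obtain d where d: "d \<in> V" "c = q * d" by (auto simp: subring_dvd_def)
    then have "q * 1 = q * (\<pi> * d)" using c by (metis mult.left_commute mult.right_neutral)
    then have "1 = \<pi> * d" using assms(1) by (simp add: subring_prime_def)
    then show ?thesis using assms(2) d by (auto simp: subring_prime_def subring_dvd_def)
  qed
qed

section \<open>Polynomials over a subdomain and their constant primes\<close>

lemma const_mem: "c \<in> V \<Longrightarrow> [:c:] \<in> polys_over V"
  by (auto simp: polys_over_def coeff_pCons zero_mem split: nat.split)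

lemma subdomain_polys_over: "subdomain (polys_over V)"
proof
  show "0 \<in> polys_over V" "1 \<in> polys_over V"
    using zero_mem one_mem by (auto simp: polys_over_def coeff_pCons one_pCons split: nat.split)
qed (auto simp: polys_over_def coeff_mult intro!: add_mem uminus_mem sum_mem mult_mem)

interpretation P: subdomain "polys_over V"
  by (rule subdomain_polys_over)

lemma smult_mem: "c \<in> V \<Longrightarrow> p \<in> polys_over V \<Longrightarrow> smult c p \<in> polys_over V"
  by (auto simp: polys_over_def intro: mult_mem)

lemma const_dvd_iff:
  assumes "\<pi> \<noteq> 0"
  shows "subring_dvd (polys_over V) [:\<pi>:] p \<longleftrightarrow> (\<forall>i. subring_dvd V \<pi> (coeff p i))"
proof
  assume "subring_dvd (polys_over V) [:\<pi>:] p"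
  then obtain y where "y \<in> polys_over V" "p = [:\<pi>:] * y" by (auto simp: subring_dvd_def)
  then show "\<forall>i. subring_dvd V \<pi> (coeff p i)"
    by (auto simp: subring_dvd_def polys_over_def)
next
  assume *: "\<forall>i. subring_dvd V \<pi> (coeff p i)"
  then have "[:\<pi>:] dvd p" unfolding const_poly_dvd_iff subring_dvd_def by (metis dvd_triv_left)
  then obtain y where y: "p = [:\<pi>:] * y" by auto
  have "coeff y i \<in> V" for i
  proof -
    obtain c where "c \<in> V" "coeff p i = \<pi> * c" using * by (auto simp: subring_dvd_def)
    then show ?thesis using y assms by simp
  qed
  then show "subring_dvd (polys_over V) [:\<pi>:] p" using y by (auto simp: subring_dvd_def polys_over_def)
qed

text \<open>Gauss's argument: if \<pi> divides neither factor, take in each the lowest coefficient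
  not divisible by \<pi>, at \<open>i\<close> and \<open>j\<close>. In the coefficient of the
  product at \<open>i + j\<close> all other terms are divisible by \<pi>, so \<pi> would divide the
  product of these two.\<close>

lemma const_prime:
  assumes "subring_prime V \<pi>"
  shows "subring_prime (polys_over V) [:\<pi>:]"
proof -
  have \<pi>: "\<pi> \<in> V" "\<pi> \<noteq> 0" "\<not> subring_dvd V \<pi> 1" using assms by (auto simp: subring_prime_def)
  have "\<not> subring_dvd (polys_over V) [:\<pi>:] 1"
    using \<pi> by (auto simp: const_dvd_iff dest!: spec[of _ 0])
  moreover have "subring_dvd (polys_over V) [:\<pi>:] a \<or> subring_dvd (polys_over V) [:\<pi>:] b"
    if ab: "a \<in> polys_over V" "b \<in> polys_over V" "subring_dvd (polys_over V) [:\<pi>:] (a * b)" for a b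
  proof (rule ccontr)
    assume "\<not> ?thesis"
    then have ex: "\<exists>i. \<not> subring_dvd V \<pi> (coeff a i)" "\<exists>i. \<not> subring_dvd V \<pi> (coeff b i)"
      using \<pi> by (auto simp: const_dvd_iff)
    define i where "i = (LEAST i. \<not> subring_dvd V \<pi> (coeff a i))"
    define j where "j = (LEAST i. \<not> subring_dvd V \<pi> (coeff b i))"
    have i: "\<not> subring_dvd V \<pi> (coeff a i)" "\<And>k. k < i \<Longrightarrow> subring_dvd V \<pi> (coeff a k)"
      unfolding i_def using LeastI_ex[OF ex(1)] not_less_Least by auto
    have j: "\<not> subring_dvd V \<pi> (coeff b j)" "\<And>k. k < j \<Longrightarrow> subring_dvd V \<pi> (coeff b k)"
      unfolding j_def using LeastI_ex[OF ex(2)] not_less_Least by auto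
    have mem: "coeff a k \<in> V" "coeff b k \<in> V" for k using ab by (auto simp: polys_over_def)
    have "coeff (a * b) (i + j) = (\<Sum>k\<le>i + j. coeff a k * coeff b (i + j - k))"
      by (simp add: coeff_mult)
    also have "\<dots> = coeff a i * coeff b j + (\<Sum>k\<in>{..i + j} - {i}. coeff a k * coeff b (i + j - k))"
      by (subst sum.remove[of _ i]) auto
    finally have eq: "coeff a i * coeff b j =
      coeff (a * b) (i + j) - (\<Sum>k\<in>{..i + j} - {i}. coeff a k * coeff b (i + j - k))" by simp
    have "subring_dvd V \<pi> (coeff a k * coeff b (i + j - k))" if "k \<in> {..i + j} - {i}" for k
    proof (cases "k < i")
      case True
      then show ?thesis using i mem by (auto intro: dvd_mult)
    next
      case False
      then have "i + j - k < j" using that by auto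
      then show ?thesis using j mem by (auto intro: dvd_mult2)
    qed
    then have "subring_dvd V \<pi> (coeff a i * coeff b j)"
      unfolding eq using ab \<pi> by (intro dvd_diff dvd_sum) (auto simp: const_dvd_iff)
    then show False using assms i j mem unfolding subring_prime_def by blast
  qed
  ultimately show ?thesis using \<pi> by (auto simp: subring_prime_def const_mem)
qed

lemma const_prime_product:
  "prime_product V c \<Longrightarrow> prime_product (polys_over V) [:c:]"
proof (induction rule: prime_product.induct)
  case (unit u)
  then obtain c where "c \<in> V" "1 = u * c" by (auto simp: subring_dvd_def)
  then have "subring_dvd (polys_over V) [:u:] 1"
    by (auto simp: subring_dvd_def one_pCons intro!: bexI[of _ "[:c:]"] const_mem)
  then show ?case using unit by (auto intro: prime_product.unit const_mem)
next
  case (prime q f)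
  have "[:q * f:] = [:q:] * [:f:]" by simp
  then show ?case using prime by (metis prime_product.prime const_prime)
qed

text \<open>Each prime factor of \<open>s\<close> stays prime as a constant, so it divides
  \<open>r\<close> or \<open>q\<close> and can be cancelled there. The constants taken out are
  collected in \<open>s1\<close> and \<open>s2\<close>, and a factorization of \<open>f\<close>
  itself remains.\<close>

lemma split_const_multiple:
  assumes "prime_product V s" "smult s f = r * q"
    "f \<in> polys_over V" "r \<in> polys_over V" "q \<in> polys_over V"
  shows "\<exists>r1\<in>polys_over V. \<exists>q1\<in>polys_over V. \<exists>s1\<in>V. \<exists>s2\<in>V.
    f = r1 * q1 \<and> r = smult s1 r1 \<and> q = smult s2 q1"
  using assms
proof (induction arbitrary: r q rule: prime_product.induct)
  case (unit u)
  then obtain c where c: "c \<in> V" "1 = u * c" by (auto simp: subring_dvd_def)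
  have "f = smult c (smult u f)" using c by (simp add: mult.commute)
  then have "f = smult c r * q" using unit by simp
  moreover have "r = smult u (smult c r)" using c by simp
  moreover have "q = smult 1 q" by simp
  moreover have "smult c r \<in> polys_over V" using unit c by (intro smult_mem)
  ultimately show ?case using unit(1,5) one_mem unit.prems by (intro bexI[of _ "smult c r"] bexI[of _ q] bexI[of _ u] bexI[of _ 1] conjI)
next
  case (prime \<pi> s)
  have \<pi>: "\<pi> \<noteq> 0" "\<pi> \<in> V" using prime by (auto simp: subring_prime_def)
  have s: "s \<in> V" using prime prime_product_mem by simp
  have "subring_dvd (polys_over V) [:\<pi>:] (r * q)"
    using prime(4) prime(5) s by (auto simp: subring_dvd_def intro!: bexI[of _ "smult s f"] smult_mem simp flip: prime(4))
  then consider "subring_dvd (polys_over V) [:\<pi>:] r" | "subring_dvd (polys_over V) [:\<pi>:] q"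
    using const_prime[OF prime(1)] prime unfolding subring_prime_def by blast
  then show ?case
  proof cases
    case 1
    then obtain r' where r': "r' \<in> polys_over V" "r = smult \<pi> r'" by (auto simp: subring_dvd_def)
    have "smult \<pi> (smult s f) = smult \<pi> (r' * q)" using prime(4) r' by simp
    then have "smult s f = r' * q" using \<pi> by (metis smult_cancel)
    from prime.IH[OF this prime(5) r'(1) prime(7)] obtain r1 q1 s1 s2 where
      *: "r1 \<in> polys_over V" "q1 \<in> polys_over V" "s1 \<in> V" "s2 \<in> V"
      "f = r1 * q1" "r' = smult s1 r1" "q = smult s2 q1" by blast
    then have "r = smult (\<pi> * s1) r1" using r' by simp
    then show ?thesis using * \<pi> mult_mem by blast
  next
    case 2
    then obtain r' where r': "r' \<in> polys_over V" "q = smult \<pi> r'" by (auto simp: subring_dvd_def)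
    have "smult \<pi> (smult s f) = smult \<pi> (r * r')" using prime(4) r' by simp
    then have "smult s f = r * r'" using \<pi> by (metis smult_cancel)
    from prime.IH[OF this prime(5) prime(6) r'(1)] obtain r1 q1 s1 s2 where
      *: "r1 \<in> polys_over V" "q1 \<in> polys_over V" "s1 \<in> V" "s2 \<in> V"
      "f = r1 * q1" "r = smult s1 r1" "r' = smult s2 q1" by blast
    then have "q = smult (\<pi> * s2) q1" using r' by simp
    then show ?thesis using * \<pi> mult_mem by blast
  qed
qed

section \<open>Primitive polynomials and extraction of constant factors\<close>

definition primitive_over :: "'r poly \<Rightarrow> bool" where
  "primitive_over f \<longleftrightarrow> (\<forall>\<pi>. subring_prime V \<pi> \<longrightarrow> \<not> subring_dvd (polys_over V) [:\<pi>:] f)"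

text \<open>A constant prime dividing \<open>f * y\<close> but not the primitive \<open>f\<close>
  divides \<open>y\<close>, so the primes of \<open>s\<close> can be cancelled one at a
  time.\<close>

lemma cancel_const:
  assumes "prime_product V s" "subring_dvd (polys_over V) f (smult s a)" "primitive_over f"
    "f \<in> polys_over V" "a \<in> polys_over V"
  shows "subring_dvd (polys_over V) f a"
  using assms
proof (induction rule: prime_product.induct)
  case (unit u)
  then obtain c where c: "c \<in> V" "1 = u * c" by (auto simp: subring_dvd_def)
  obtain y where "y \<in> polys_over V" "smult u a = f * y" using unit by (auto simp: subring_dvd_def)
  then have "a = f * smult c y" using c
    by (metis mult.commute mult_smult_right smult_1_left smult_smult)
  then show ?case using c \<open>y \<in> _\<close> unfolding subring_dvd_def by (blast intro: smult_mem)
next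
  case (prime \<pi> s)
  have \<pi>: "\<pi> \<noteq> 0" "\<pi> \<in> V" using prime by (auto simp: subring_prime_def)
  have s: "s \<in> V" using prime prime_product_mem by simp
  obtain y where y: "y \<in> polys_over V" "smult (\<pi> * s) a = f * y"
    using prime by (auto simp: subring_dvd_def)
  have "subring_dvd (polys_over V) [:\<pi>:] (f * y)"
    unfolding subring_dvd_def using y prime s by (auto intro!: bexI[of _ "smult s a"] smult_mem simp flip: y(2))
  then have "subring_dvd (polys_over V) [:\<pi>:] y"
    using const_prime[OF prime(1)] prime y unfolding subring_prime_def primitive_over_def by blast
  then obtain y' where y': "y' \<in> polys_over V" "y = smult \<pi> y'" by (auto simp: subring_dvd_def)
  have "smult \<pi> (smult s a) = smult \<pi> (f * y')" using y y' by simp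
  then have "smult s a = f * y'" using \<pi> by (metis smult_cancel)
  then show ?case using prime y' by (auto simp: subring_dvd_def)
qed

text \<open>\<open>l\<close> holds the primes of the leading coefficient still to be tried,
  \<open>d\<close> those rejected because they do not divide \<open>f\<close>. A constant prime
  dividing \<open>f\<close> divides the leading coefficient, so once \<open>l\<close> is a unit it
  would divide \<open>d\<close>, which is excluded.\<close>

lemma primitive_part_aux:
  assumes "prime_product V l" "lead_coeff f * c = d * l" "f \<in> polys_over V" "c \<in> V" "d \<in> V"
    "\<And>\<pi>. subring_prime V \<pi> \<Longrightarrow> subring_dvd V \<pi> d \<Longrightarrow> \<not> subring_dvd (polys_over V) [:\<pi>:] f"
  shows "\<exists>s f0. prime_product V s \<and> f0 \<in> polys_over V \<and> f = smult s f0 \<and> primitive_over f0"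
  using assms
proof (induction arbitrary: f d rule: prime_product.induct)
  case (unit u)
  then obtain e where e: "e \<in> V" "1 = u * e" by (auto simp: subring_dvd_def)
  have "primitive_over f" unfolding primitive_over_def
  proof (intro allI impI notI)
    fix \<pi> assume \<pi>: "subring_prime V \<pi>" and dv: "subring_dvd (polys_over V) [:\<pi>:] f"
    then have "subring_dvd V \<pi> (lead_coeff f)" by (auto simp: const_dvd_iff subring_prime_def)
    then have "subring_dvd V \<pi> (lead_coeff f * c * e)"
      by (rule dvd_mult[OF dvd_mult[OF _ unit(5)] e(1)])
    moreover have "lead_coeff f * c * e = d * (u * e)" using unit(3) by (simp only: mult.assoc)
    ultimately have "subring_dvd V \<pi> d" using e(2) by simp
    then show False using unit(7)[OF \<pi>] dv by simp
  qed
  moreover have "prime_product V 1" using one_mem dvd_refl by (auto intro: prime_product.unit)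
  ultimately show ?case using unit by (metis smult_1_left)
next
  case (prime q l)
  have q: "q \<noteq> 0" "q \<in> V" using prime by (auto simp: subring_prime_def)
  show ?case
  proof (cases "subring_dvd (polys_over V) [:q:] f")
    case True
    then obtain f' where f': "f' \<in> polys_over V" "f = smult q f'" by (auto simp: subring_dvd_def)
    have "q * (lead_coeff f' * c) = q * (d * l)" using prime(4) q(1) unfolding f'(2)
      by (simp add: degree_smult_eq mult_ac)
    then have "lead_coeff f' * c = d * l" using q by simp
    moreover have "\<not> subring_dvd (polys_over V) [:\<pi>:] f'" if "subring_prime V \<pi>" "subring_dvd V \<pi> d" for \<pi>
    proof
      assume "subring_dvd (polys_over V) [:\<pi>:] f'"
      then have "subring_dvd (polys_over V) [:\<pi>:] f"
        using P.dvd_mult2[of "[:\<pi>:]" f' "[:q:]"] f' q const_mem by simp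
      then show False using prime(8) that by blast
    qed
    ultimately obtain s f0 where "prime_product V s" "f0 \<in> polys_over V" "f' = smult s f0" "primitive_over f0"
      using prime.IH[of f' d] f' prime by blast
    then show ?thesis using f' prime(1) by (metis prime_product.prime smult_smult)
  next
    case False
    have "\<not> subring_dvd (polys_over V) [:\<pi>:] f" if \<pi>: "subring_prime V \<pi>" "subring_dvd V \<pi> (d * q)" for \<pi>
    proof
      assume dv: "subring_dvd (polys_over V) [:\<pi>:] f"
      have "subring_dvd V \<pi> d \<or> subring_dvd V \<pi> q" using \<pi> q prime(7) by (auto simp: subring_prime_def)
      then have "subring_dvd V \<pi> q" using prime(8) \<pi> dv by blast
      then have "subring_dvd V q \<pi>" using prime_dvd_prime prime(1) \<pi> by blast
      then obtain e where "e \<in> V" "\<pi> = q * e" by (auto simp: subring_dvd_def)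
      then have "subring_dvd (polys_over V) [:q:] [:\<pi>:]"
        by (auto simp: subring_dvd_def const_mem intro!: bexI[of _ "[:e:]"])
      then show False using False dv P.dvd_trans by blast
    qed
    moreover have "lead_coeff f * c = d * q * l" using prime by (simp add: mult.assoc)
    ultimately show ?thesis using prime.IH[of f "d * q"] prime q mult_mem by blast
  qed
qed

lemma primitive_part:
  assumes "\<And>v. v \<in> V \<Longrightarrow> v \<noteq> 0 \<Longrightarrow> prime_product V v" "f \<in> polys_over V" "f \<noteq> 0"
  shows "\<exists>s f0. prime_product V s \<and> f0 \<in> polys_over V \<and> f = smult s f0 \<and> primitive_over f0"
proof (rule primitive_part_aux)
  show "prime_product V (lead_coeff f)" using assms by (auto simp: polys_over_def)
  show "lead_coeff f * 1 = 1 * lead_coeff f" by simp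
qed (use assms one_mem in \<open>auto simp: subring_prime_def\<close>)

section \<open>Pseudo-division and factoriality of the polynomial ring\<close>

lemma pseudo_division:
  assumes "x \<in> polys_over V" "r \<in> polys_over V" "r \<noteq> 0"
  shows "\<exists>k. \<exists>q\<in>polys_over V. \<exists>y\<in>polys_over V.
    smult (lead_coeff r ^ k) x = r * q + y \<and> (y = 0 \<or> degree y < degree r)"
  using assms(1)
\<comment> \<open>The measure places the zero polynomial below the nonzero constants, which
  \<open>degree\<close> does not tell apart from it.\<close>
proof (induction "if x = 0 then 0 else Suc (degree x)" arbitrary: x rule: less_induct)
  case less
  show ?case
  proof (cases "x = 0 \<or> degree x < degree r")
    case True
    then show ?thesis using less P.zero_mem by (intro exI[of _ 0] bexI[of _ 0] bexI[of _ x]) auto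
  next
    case False
    \<comment> \<open>Multiplying \<open>x\<close> by the leading coefficient of \<open>r\<close>
      replaces a division in \<open>V\<close>: the leading terms of the scaled \<open>x\<close> and
      of \<open>r * t\<close> cancel.\<close>
    define t where "t = monom (lead_coeff x) (degree x - degree r)"
    define x' where "x' = smult (lead_coeff r) x - r * t"
    have lV: "lead_coeff r \<in> V" "lead_coeff x \<in> V" using less assms by (auto simp: polys_over_def)
    have tV: "t \<in> polys_over V" using lV zero_mem by (auto simp: t_def polys_over_def)
    have x'V: "x' \<in> polys_over V" unfolding x'_def
      using less assms lV tV by (intro P.diff_mem smult_mem P.mult_mem)
    have dt: "degree t = degree x - degree r" "t \<noteq> 0" using False by (auto simp: t_def degree_monom_eq)
    have d1: "degree (r * t) = degree x" using False dt assms by (simp add: degree_mult_eq)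
    have l1: "lead_coeff (r * t) = lead_coeff r * lead_coeff x"
      using dt by (simp add: lead_coeff_mult t_def degree_monom_eq)
    have c0: "coeff x' (degree x) = 0" using l1 d1 by (simp add: x'_def)
    have "degree x' \<le> degree x" unfolding x'_def using d1 by (intro degree_diff_le) auto
    then have "x' = 0 \<or> degree x' < degree x" using c0
      by (metis le_neq_implies_less leading_coeff_0_iff)
    then have "(if x' = 0 then 0 else Suc (degree x')) < (if x = 0 then 0 else Suc (degree x))"
      using False by auto
    from less(1)[OF this x'V] obtain k q y where *: "q \<in> polys_over V" "y \<in> polys_over V"
      "smult (lead_coeff r ^ k) x' = r * q + y" "y = 0 \<or> degree y < degree r" by blast
    have "smult (lead_coeff r ^ Suc k) x = smult (lead_coeff r ^ k) (x' + r * t)"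
      unfolding x'_def by (simp only: diff_add_cancel smult_smult power_Suc2)
    also have "\<dots> = r * (q + smult (lead_coeff r ^ k) t) + y"
      unfolding smult_add_right *(3) by (simp only: mult_smult_right distrib_left add_ac)
    finally show ?thesis using *(1,2,4) tV lV
      by (blast intro: P.add_mem smult_mem power_mem)
  qed
qed

text \<open>In the ideal generated by \<open>a\<close> and \<open>f\<close> take \<open>r\<close> of
  least degree. Pseudo-division makes \<open>f\<close> and \<open>a\<close> multiples of
  \<open>r\<close> up to constants. By irreducibility either \<open>f\<close> agrees with
  \<open>r\<close> up to constants, and then divides \<open>a\<close>, or \<open>r\<close> is
  constant and a Bezout identity shows that \<open>f\<close> divides \<open>b\<close>.\<close>

lemma primitive_prime:
  assumes ufd: "\<And>v. v \<in> V \<Longrightarrow> v \<noteq> 0 \<Longrightarrow> prime_product V v"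
    and f: "f \<in> polys_over V" "primitive_over f" "degree f > 0"
    and irr: "\<And>a b. a \<in> polys_over V \<Longrightarrow> b \<in> polys_over V \<Longrightarrow> f = a * b \<Longrightarrow> degree a = 0 \<or> degree b = 0"
  shows "subring_prime (polys_over V) f"
proof -
  have f0: "f \<noteq> 0" using f by auto
  have "\<not> subring_dvd (polys_over V) f 1"
  proof
    assume "subring_dvd (polys_over V) f 1"
    then obtain c where "f * c = 1" by (auto simp: subring_dvd_def)
    then show False using f(3) f0 by (metis add_is_0 degree_1 degree_mult_eq mult_zero_right not_gr0 zero_neq_one)
  qed
  moreover have "subring_dvd (polys_over V) f a \<or> subring_dvd (polys_over V) f b"
    if ab: "a \<in> polys_over V" "b \<in> polys_over V" "subring_dvd (polys_over V) f (a * b)" for a b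
  proof -
    define I where "I = {u * a + v * f | u v. u \<in> polys_over V \<and> v \<in> polys_over V}"
    have fI: "f \<in> I" unfolding I_def
      by (rule CollectI, intro exI[of _ 0] exI[of _ 1]) (auto intro: P.zero_mem P.one_mem)
    have aI: "a \<in> I" unfolding I_def
      by (rule CollectI, intro exI[of _ 1] exI[of _ 0]) (auto intro: P.zero_mem P.one_mem)
    obtain r where r: "r \<in> I" "r \<noteq> 0" and rmin: "\<And>y. y \<in> I \<Longrightarrow> y \<noteq> 0 \<Longrightarrow> degree r \<le> degree y"
      using ex_has_least_nat[of "\<lambda>r. r \<in> I \<and> r \<noteq> 0" f degree] fI f0 by auto
    obtain u v where uv: "u \<in> polys_over V" "v \<in> polys_over V" "r = u * a + v * f"
      using r by (auto simp: I_def)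
    have rV: "r \<in> polys_over V" using uv ab f by (auto intro!: P.add_mem P.mult_mem)
    have div: "\<exists>s q. prime_product V s \<and> q \<in> polys_over V \<and> smult s x = r * q"
      if xI: "x \<in> I" for x
    proof -
      obtain u' v' where uv': "u' \<in> polys_over V" "v' \<in> polys_over V" "x = u' * a + v' * f"
        using xI by (auto simp: I_def)
      have "x \<in> polys_over V" using uv' ab f by (auto intro!: P.add_mem P.mult_mem)
      then obtain k q y where *: "q \<in> polys_over V" "y \<in> polys_over V"
        "smult (lead_coeff r ^ k) x = r * q + y" "y = 0 \<or> degree y < degree r"
        using pseudo_division rV r by blast
      have lk: "lead_coeff r ^ k \<in> V" using rV by (auto simp: polys_over_def intro: power_mem)
      have "y = smult (lead_coeff r ^ k) (u' * a + v' * f) - (u * a + v * f) * q"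
        using * uv uv' by (simp add: algebra_simps)
      also have "\<dots> = (smult (lead_coeff r ^ k) u' - u * q) * a + (smult (lead_coeff r ^ k) v' - v * q) * f"
        by (simp add: algebra_simps smult_add_right)
      finally have "y \<in> I" unfolding I_def
        by (intro CollectI exI conjI)
          (auto intro!: P.diff_mem smult_mem P.mult_mem uv uv' *(1) lk)
      then have "y = 0" using * rmin by fastforce
      moreover have "prime_product V (lead_coeff r ^ k)" using ufd lk r by simp
      ultimately show ?thesis using * by auto
    qed
    obtain s q where sq: "prime_product V s" "q \<in> polys_over V" "smult s f = r * q" using div fI by blast
    from split_const_multiple[OF sq(1,3) f(1) rV sq(2)] obtain r1 q1 s1 s2 where
      *: "r1 \<in> polys_over V" "q1 \<in> polys_over V" "s1 \<in> V" "s2 \<in> V"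
      "f = r1 * q1" "r = smult s1 r1" "q = smult s2 q1" by blast
    from irr[OF *(1,2,5)] show ?thesis
    proof
      assume "degree q1 = 0"
      then obtain c where c: "q1 = [:c:]" by (metis degree_eq_zeroE)
      have cV: "c \<in> V" using *(2) c by (auto simp: polys_over_def coeff_pCons dest: spec[of _ 0])
      have "c \<noteq> 0" using c * f0 by auto
      then have "prime_product V c" using ufd cV by simp
      \<comment> \<open>A prime factor of \<open>c\<close> would divide the primitive
        \<open>f\<close>, so \<open>c\<close> is a unit.\<close>
      then have "subring_dvd V c 1"
      proof cases
        case (prime \<pi> c')
        then have "f = [:\<pi>:] * smult c' r1" using * c by (simp add: mult.commute)
        then have "subring_dvd (polys_over V) [:\<pi>:] f"
          unfolding subring_dvd_def by (rule bexI) (rule smult_mem[OF prime_product_mem[OF prime(3)] *(1)])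
        then show ?thesis using f(2) prime by (auto simp: primitive_over_def)
      qed
      then obtain c' where c': "c' \<in> V" "1 = c * c'" by (auto simp: subring_dvd_def)
      then have "r1 = f * [:c':]" using * c by (simp add: mult.commute)
      then have r': "r = f * smult s1 [:c':]" using *(6)
        by (metis mult_smult_right)
      obtain s' q' where sq': "prime_product V s'" "q' \<in> polys_over V" "smult s' a = r * q'" using div aI by blast
      then have "smult s' a = f * (smult s1 [:c':] * q')" using r' by (simp add: mult.assoc)
      then have "subring_dvd (polys_over V) f (smult s' a)"
        unfolding subring_dvd_def
        by (rule bexI) (rule P.mult_mem[OF smult_mem[OF *(3) const_mem[OF c'(1)]] sq'(2)])
      then show ?thesis using cancel_const sq' f ab by blast
    next
      assume "degree r1 = 0"
      then obtain e where e: "r = [:e:]" using * by (metis degree_eq_zeroE smult_pCons smult_0_right)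
      have eV: "e \<in> V" using rV e by (auto simp: polys_over_def coeff_pCons dest: spec[of _ 0])
      have pe: "prime_product V e" using ufd eV e r by auto
      obtain y where y: "y \<in> polys_over V" "a * b = f * y" using ab by (auto simp: subring_dvd_def)
      have "smult e b = r * b" using e by simp
      \<comment> \<open>The Bezout identity multiplied by \<open>b\<close>: both summands are
        multiples of \<open>f\<close>, the first because \<open>f\<close> divides
        \<open>a * b\<close>.\<close>
      also have "\<dots> = u * (a * b) + v * f * b" using uv by (simp add: algebra_simps)
      also have "\<dots> = f * (u * y + v * b)" using y by (simp add: algebra_simps)
      finally have "subring_dvd (polys_over V) f (smult e b)"
        unfolding subring_dvd_def
        by (rule bexI) (rule P.add_mem[OF P.mult_mem[OF uv(1) y(1)] P.mult_mem[OF uv(2) ab(2)]])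
      then show ?thesis using cancel_const pe f ab by blast
    qed
  qed
  ultimately show ?thesis using f f0 by (auto simp: subring_prime_def)
qed

text \<open>Induction on the degree after removing the constant factor \<open>s\<close>: a primitive
  polynomial splits into two of smaller degree, or is constant, or is prime by
  \<open>primitive_prime\<close>.\<close>

theorem Gauss_factorial:
  assumes ufd: "\<And>v. v \<in> V \<Longrightarrow> v \<noteq> 0 \<Longrightarrow> prime_product V v"
    and "f \<in> polys_over V" "f \<noteq> 0"
  shows "prime_product (polys_over V) f"
  using assms(2,3)
proof (induction "degree f" arbitrary: f rule: less_induct)
  case less
  obtain s f0 where s: "prime_product V s" "f0 \<in> polys_over V" "f = smult s f0" "primitive_over f0"
    using primitive_part ufd less by blast
  have ss: "prime_product (polys_over V) [:s:]" using s const_prime_product by blast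
  have sne: "s \<noteq> 0" using s less by auto
  have "prime_product (polys_over V) f0"
  proof (cases "\<exists>a\<in>polys_over V. \<exists>b\<in>polys_over V. f0 = a * b \<and> degree a \<noteq> 0 \<and> degree b \<noteq> 0")
    case True
    then obtain a b where ab: "a \<in> polys_over V" "b \<in> polys_over V" "f0 = a * b" "degree a \<noteq> 0" "degree b \<noteq> 0"
      by blast
    have "a \<noteq> 0" "b \<noteq> 0" using ab by auto
    then have "degree f = degree a + degree b" using ab s sne by (simp add: degree_mult_eq)
    then show ?thesis using ab less \<open>a \<noteq> 0\<close> \<open>b \<noteq> 0\<close> P.prime_product_mult by simp
  next
    case False
    show ?thesis
    proof (cases "degree f0 = 0")
      case True
      then obtain c where c: "f0 = [:c:]" by (metis degree_eq_zeroE)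
      then have "c \<in> V" "c \<noteq> 0" using s less by (auto simp: polys_over_def coeff_pCons dest: spec[of _ 0])
      then show ?thesis using c ufd const_prime_product by simp
    next
      case nz: False
      have "subring_prime (polys_over V) f0"
        using primitive_prime[OF ufd s(2) s(4)] nz False by blast
      then have "prime_product (polys_over V) (f0 * 1)"
        using P.one_mem P.dvd_refl by (intro prime_product.prime prime_product.unit) auto
      then show ?thesis by simp
    qed
  qed
  then have "prime_product (polys_over V) ([:s:] * f0)" using ss P.prime_product_mult by blast
  then show ?case using s by simp
qed

end

subsection \<open>Multivariate polynomials\<close>

lemma poly_mapping_sum_singles:
  "(\<Sum>m\<in>Poly_Mapping.keys f. Poly_Mapping.single m (Poly_Mapping.lookup f m)) = f"
proof (rule poly_mapping_eqI)
  fix k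
  have "(\<Sum>m\<in>Poly_Mapping.keys f. (Poly_Mapping.lookup f m when m = k)) = Poly_Mapping.lookup f k"
    by (auto simp: when_def in_keys_iff)
  then show "Poly_Mapping.lookup (\<Sum>m\<in>Poly_Mapping.keys f. Poly_Mapping.single m (Poly_Mapping.lookup f m)) k
    = Poly_Mapping.lookup f k"
    by (simp add: lookup_sum lookup_single)
qed

text \<open>Reduces multiplicativity of an additive map to products of monomials; it serves both for
  evaluation and for the group action.\<close>

lemma additive_multiplicative_of_singles:
  fixes T :: "('m::monoid_add \<Rightarrow>\<^sub>0 'a::ring_1) \<Rightarrow> 'r::ring_1"
  assumes add: "\<And>f g. T (f + g) = T f + T g"
    and single: "\<And>m m' c d. T (Poly_Mapping.single m c * Poly_Mapping.single m' d) =
      T (Poly_Mapping.single m c) * T (Poly_Mapping.single m' d)"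
  shows "T (f * g) = T f * T g"
proof -
  have zero: "T 0 = 0" using add[of 0 0] by simp
  have sum: "T (sum h I) = (\<Sum>i\<in>I. T (h i))" for h :: "'i \<Rightarrow> _" and I
    by (induction I rule: infinite_finite_induct) (auto simp: zero add)
  let ?s = "\<lambda>f m. Poly_Mapping.single m (Poly_Mapping.lookup f m)"
  have "T ((\<Sum>m\<in>Poly_Mapping.keys f. ?s f m) * (\<Sum>m\<in>Poly_Mapping.keys g. ?s g m)) =
    T (\<Sum>m\<in>Poly_Mapping.keys f. ?s f m) * T (\<Sum>m\<in>Poly_Mapping.keys g. ?s g m)"
    by (simp only: sum_product sum single)
  then show ?thesis by (simp only: poly_mapping_sum_singles)
qed

type_synonym 'a mpoly = "(nat \<Rightarrow>\<^sub>0 nat) \<Rightarrow>\<^sub>0 'a"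

definition Var :: "nat \<Rightarrow> 'a::comm_ring_1 mpoly" where
  "Var v = Poly_Mapping.single (Poly_Mapping.single v 1) 1"

text \<open>One type holds the polynomials in all variables; these subsets are the smaller
  polynomial rings to which the theory of subdomains applies.\<close>

definition mpolys_in :: "nat set \<Rightarrow> 'a::comm_ring_1 mpoly set" where
  "mpolys_in A = {f. \<forall>m\<in>Poly_Mapping.keys f. Poly_Mapping.keys m \<subseteq> A}"

lemma keys_plus_nat: "Poly_Mapping.keys (m + m') = Poly_Mapping.keys m \<union> Poly_Mapping.keys (m' :: nat \<Rightarrow>\<^sub>0 nat)"
  by (auto simp: in_keys_iff lookup_add)

lemma subdomain_mpolys_in: "subdomain (mpolys_in A :: 'a::idom mpoly set)"
proof
  show "0 \<in> mpolys_in A" "1 \<in> mpolys_in A" by (auto simp: mpolys_in_def)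
  fix f g :: "'a mpoly" assume fg: "f \<in> mpolys_in A" "g \<in> mpolys_in A"
  show "f + g \<in> mpolys_in A" using fg keys_add[of f g] by (auto simp: mpolys_in_def)
  show "- f \<in> mpolys_in A" using fg by (auto simp: mpolys_in_def in_keys_iff)
  show "f * g \<in> mpolys_in A" using fg keys_mult[of f g] unfolding mpolys_in_def
    by (force simp: keys_plus_nat)
qed

lemma mpolys_in_mono: "A \<subseteq> B \<Longrightarrow> mpolys_in A \<subseteq> mpolys_in B"
  by (auto simp: mpolys_in_def)

definition vars :: "'a::comm_ring_1 mpoly \<Rightarrow> nat set" where
  "vars f = (\<Union>m\<in>Poly_Mapping.keys f. Poly_Mapping.keys m)"

lemma finite_vars: "finite (vars f)"
  by (auto simp: vars_def)

lemma vars_mpolys_in: "vars f \<subseteq> A \<Longrightarrow> f \<in> mpolys_in A"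
  by (auto simp: vars_def mpolys_in_def)

lemma mpolys_in_empty:
  assumes "f \<in> mpolys_in {}"
  shows "f = Poly_Mapping.single 0 (Poly_Mapping.lookup f 0)"
proof (rule poly_mapping_eqI)
  fix m
  show "Poly_Mapping.lookup f m = Poly_Mapping.lookup (Poly_Mapping.single 0 (Poly_Mapping.lookup f 0)) m"
  proof (cases "m = 0")
    case False
    then have "m \<notin> Poly_Mapping.keys f" using assms by (auto simp: mpolys_in_def)
    then show ?thesis using False by (simp add: lookup_single in_keys_iff)
  qed simp
qed

lemma single_zero_dvd_one: "(c::'a::field) \<noteq> 0 \<Longrightarrow>
  Poly_Mapping.single 0 c * Poly_Mapping.single 0 (inverse c) = (1 :: 'a mpoly)"
  by (simp add: mult_single)

section \<open>Adjoining one variable\<close>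

definition insert_var :: "nat \<Rightarrow> 'a::comm_ring_1 mpoly poly \<Rightarrow> 'a mpoly" where
  "insert_var x p = poly p (Var x)"

lemma lookup_single_times:
  fixes g :: "'m::cancel_comm_monoid_add \<Rightarrow>\<^sub>0 'a::comm_ring_1"
  shows "Poly_Mapping.lookup (Poly_Mapping.single t c * g) (t + m) = c * Poly_Mapping.lookup g m"
proof -
  have "Poly_Mapping.lookup (Poly_Mapping.single t c * g) (t + m) =
    Poly_Mapping.lookup (Poly_Mapping.single t c * (\<Sum>k\<in>Poly_Mapping.keys g. Poly_Mapping.single k (Poly_Mapping.lookup g k))) (t + m)"
    by (simp only: poly_mapping_sum_singles)
  also have "\<dots> = (\<Sum>k\<in>Poly_Mapping.keys g. c * Poly_Mapping.lookup g k when k = m)"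
    by (simp add: sum_distrib_left mult_single lookup_sum lookup_single)
  also have "\<dots> = c * Poly_Mapping.lookup g m"
    by (auto simp: when_def in_keys_iff)
  finally show ?thesis .
qed

text \<open>Neither the coefficients of \<open>p\<close> nor \<open>m\<close> involve
  \<open>x\<close>, so the exponent of \<open>x\<close> tells from which coefficient of
  \<open>p\<close> a monomial comes. This makes substitution of \<open>Var x\<close> for the
  indeterminate injective.\<close>

lemma lookup_insert_var:
  assumes "x \<notin> A" "p \<in> polys_over (mpolys_in A)" "x \<notin> Poly_Mapping.keys m"
  shows "Poly_Mapping.lookup (insert_var x p) (Poly_Mapping.single x i + m) = Poly_Mapping.lookup (coeff p i) m"
  using assms(2)
proof (induction p arbitrary: i)
  case 0
  then show ?case by (simp add: insert_var_def)
next
  case (pCons a p)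
  have a: "a \<in> mpolys_in A" "p \<in> polys_over (mpolys_in A)"
    using pCons(3) by (auto simp: polys_over_def dest: spec[of _ 0] spec[of _ "Suc _"])
  have e: "insert_var x (pCons a p) = a + Var x * insert_var x p" by (simp add: insert_var_def)
  show ?case
  proof (cases i)
    case 0
    have "m \<notin> Poly_Mapping.keys (Var x * insert_var x p)"
    proof
      assume "m \<in> Poly_Mapping.keys (Var x * insert_var x p)"
      then obtain k where "m = Poly_Mapping.single x 1 + k"
        using keys_mult[of "Var x" "insert_var x p"] by (auto simp: Var_def)
      then show False using assms(3) by (simp add: keys_plus_nat)
    qed
    then show ?thesis using 0 by (simp add: e lookup_add in_keys_iff)
  next
    case (Suc j)
    have idx: "Poly_Mapping.single x i + m = Poly_Mapping.single x 1 + (Poly_Mapping.single x j + m)"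
      using Suc by (simp add: add.assoc[symmetric] flip: single_add)
    have "Poly_Mapping.single x i + m \<notin> Poly_Mapping.keys a"
      using a assms(1) Suc by (auto simp: mpolys_in_def keys_plus_nat dest!: bspec)
    then have "Poly_Mapping.lookup (insert_var x (pCons a p)) (Poly_Mapping.single x i + m) =
      Poly_Mapping.lookup (Var x * insert_var x p) (Poly_Mapping.single x i + m)"
      by (simp add: e lookup_add in_keys_iff)
    also have "\<dots> = Poly_Mapping.lookup (coeff p j) m"
      unfolding idx Var_def lookup_single_times using pCons(2) a by simp
    finally show ?thesis by (simp add: Suc)
  qed
qed

lemma insert_var_eq_0:
  assumes "x \<notin> A" "p \<in> polys_over (mpolys_in A)" "insert_var x p = 0"
  shows "p = 0"
proof (rule poly_eqI)
  fix i
  show "coeff p i = coeff 0 i"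
  proof (rule poly_mapping_eqI)
    fix m
    show "Poly_Mapping.lookup (coeff p i) m = Poly_Mapping.lookup (coeff 0 i) m"
    proof (cases "x \<in> Poly_Mapping.keys m")
      case True
      then have "m \<notin> Poly_Mapping.keys (coeff p i)" using assms by (auto simp: polys_over_def mpolys_in_def)
      then show ?thesis by (simp add: in_keys_iff)
    next
      case False
      then show ?thesis using lookup_insert_var[OF assms(1,2) False, of i] assms by simp
    qed
  qed
qed

lemma insert_var_mem:
  fixes p :: "'a::idom mpoly poly"
  assumes "p \<in> polys_over (mpolys_in A)"
  shows "insert_var x p \<in> mpolys_in (insert x A)"
  using assms
proof (induction p)
  case 0
  interpret subdomain "mpolys_in (insert x A) :: 'a mpoly set" by (rule subdomain_mpolys_in)
  show ?case by (simp add: insert_var_def zero_mem)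
next
  case (pCons a p)
  interpret subdomain "mpolys_in (insert x A) :: 'a mpoly set" by (rule subdomain_mpolys_in)
  have a: "a \<in> mpolys_in A" "p \<in> polys_over (mpolys_in A)"
    using pCons(3) by (auto simp: polys_over_def dest: spec[of _ 0] spec[of _ "Suc _"])
  have "a \<in> mpolys_in (insert x A)" using a mpolys_in_mono[of A "insert x A"] by blast
  moreover have "Var x \<in> mpolys_in (insert x A)" by (auto simp: Var_def mpolys_in_def)
  ultimately show ?case using pCons(2) a by (auto simp: insert_var_def intro!: add_mem mult_mem)
qed

lemma Var_power: "Var x ^ i = Poly_Mapping.single (Poly_Mapping.single x i) 1"
  by (induction i) (simp_all add: Var_def mult_single single_add[symmetric])

lemma insert_var_surj:
  fixes f :: "'a::idom mpoly"
  assumes "f \<in> mpolys_in (insert x A)"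
  shows "\<exists>p\<in>polys_over (mpolys_in A). f = insert_var x p"
proof -
  interpret subdomain "mpolys_in A :: 'a mpoly set" by (rule subdomain_mpolys_in)
  interpret P: subdomain "polys_over (mpolys_in A) :: 'a mpoly poly set" by (rule subdomain_polys_over)
  \<comment> \<open>\<open>r\<close> erases \<open>x\<close> from a monomial; the erased exponent
    becomes the degree in the indeterminate.\<close>
  define r where "r m = Poly_Mapping.update x 0 m" for m :: "nat \<Rightarrow>\<^sub>0 nat"
  define p where "p = (\<Sum>m\<in>Poly_Mapping.keys f.
    monom (Poly_Mapping.single (r m) (Poly_Mapping.lookup f m)) (Poly_Mapping.lookup m x))"
  have rm: "r m + Poly_Mapping.single x (Poly_Mapping.lookup m x) = m" for m
    by (rule poly_mapping_eqI) (auto simp: r_def lookup_add lookup_update lookup_single)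
  have "insert_var x p = (\<Sum>m\<in>Poly_Mapping.keys f. Poly_Mapping.single m (Poly_Mapping.lookup f m))"
    unfolding insert_var_def p_def poly_sum poly_monom Var_power mult_single rm by simp
  then have "f = insert_var x p" by (simp add: poly_mapping_sum_singles)
  moreover have "p \<in> polys_over (mpolys_in A)"
    unfolding p_def
  proof (rule P.sum_mem)
    fix m assume "m \<in> Poly_Mapping.keys f"
    then have "Poly_Mapping.keys (r m) \<subseteq> A"
      using assms by (auto simp: r_def mpolys_in_def keys_update split: if_splits)
    then show "monom (Poly_Mapping.single (r m) (Poly_Mapping.lookup f m)) (Poly_Mapping.lookup m x)
      \<in> polys_over (mpolys_in A)"
      using zero_mem by (auto simp: polys_over_def mpolys_in_def)
  qed
  ultimately show ?thesis by blast
qed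

lemma insert_var_hom:
  "insert_var x (p * q) = insert_var x p * insert_var x q"
  "insert_var x (p - q) = insert_var x p - insert_var x q"
  "insert_var x 1 = 1"
  by (simp_all add: insert_var_def)

context
  fixes x :: nat and A :: "nat set"
  assumes xA: "x \<notin> A"
begin

lemma insert_var_inj:
  fixes p q :: "'a::idom mpoly poly"
  assumes "p \<in> polys_over (mpolys_in A)" "q \<in> polys_over (mpolys_in A)" "insert_var x p = insert_var x q"
  shows "p = q"
proof -
  interpret V: subdomain "mpolys_in A :: 'a mpoly set" by (rule subdomain_mpolys_in)
  interpret P: subdomain "polys_over (mpolys_in A) :: 'a mpoly poly set" by (rule V.subdomain_polys_over)
  have "p - q = 0" by (rule insert_var_eq_0[OF xA]) (use assms P.diff_mem in \<open>auto simp: insert_var_hom\<close>)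
  then show ?thesis by simp
qed

lemma insert_var_dvd_iff:
  fixes p q :: "'a::idom mpoly poly"
  assumes "p \<in> polys_over (mpolys_in A)" "q \<in> polys_over (mpolys_in A)"
  shows "subring_dvd (mpolys_in (insert x A)) (insert_var x p) (insert_var x q) \<longleftrightarrow>
    subring_dvd (polys_over (mpolys_in A)) p q"
proof
  interpret V: subdomain "mpolys_in A :: 'a mpoly set" by (rule subdomain_mpolys_in)
  interpret P: subdomain "polys_over (mpolys_in A) :: 'a mpoly poly set" by (rule V.subdomain_polys_over)
  assume "subring_dvd (mpolys_in (insert x A)) (insert_var x p) (insert_var x q)"
  then obtain c where c: "c \<in> mpolys_in (insert x A)" "insert_var x q = insert_var x p * c"
    by (auto simp: subring_dvd_def)
  then obtain c' where c': "c' \<in> polys_over (mpolys_in A)" "c = insert_var x c'" using insert_var_surj by blast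
  then have "q = p * c'" using c assms by (intro insert_var_inj P.mult_mem) (auto simp: insert_var_hom)
  then show "subring_dvd (polys_over (mpolys_in A)) p q" using c' by (auto simp: subring_dvd_def)
next
  assume "subring_dvd (polys_over (mpolys_in A)) p q"
  then show "subring_dvd (mpolys_in (insert x A)) (insert_var x p) (insert_var x q)"
    by (auto simp: subring_dvd_def insert_var_hom intro: insert_var_mem)
qed

lemma insert_var_prime:
  fixes q :: "'a::idom mpoly poly"
  assumes "subring_prime (polys_over (mpolys_in A)) q"
  shows "subring_prime (mpolys_in (insert x A)) (insert_var x q)"
proof -
  interpret V: subdomain "mpolys_in A :: 'a mpoly set" by (rule subdomain_mpolys_in)
  interpret P: subdomain "polys_over (mpolys_in A) :: 'a mpoly poly set" by (rule V.subdomain_polys_over)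
  have q: "q \<in> polys_over (mpolys_in A)" "q \<noteq> 0" "\<not> subring_dvd (polys_over (mpolys_in A)) q 1"
    using assms by (auto simp: subring_prime_def)
  have "insert_var x q \<noteq> 0" using q insert_var_eq_0[OF xA] by blast
  moreover have "\<not> subring_dvd (mpolys_in (insert x A)) (insert_var x q) 1"
    using q insert_var_dvd_iff[of q 1] P.one_mem by (simp add: insert_var_hom)
  moreover have "subring_dvd (mpolys_in (insert x A)) (insert_var x q) a \<or>
      subring_dvd (mpolys_in (insert x A)) (insert_var x q) b"
    if ab: "a \<in> mpolys_in (insert x A)" "b \<in> mpolys_in (insert x A)"
      "subring_dvd (mpolys_in (insert x A)) (insert_var x q) (a * b)" for a b
  proof -
    obtain a' b' where *: "a' \<in> polys_over (mpolys_in A)" "a = insert_var x a'"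
      "b' \<in> polys_over (mpolys_in A)" "b = insert_var x b'" using ab insert_var_surj by meson
    then have "subring_dvd (polys_over (mpolys_in A)) q (a' * b')"
      using ab q P.mult_mem by (simp add: insert_var_dvd_iff flip: insert_var_hom)
    then have "subring_dvd (polys_over (mpolys_in A)) q a' \<or> subring_dvd (polys_over (mpolys_in A)) q b'"
      using assms * by (auto simp: subring_prime_def)
    then show ?thesis using * q by (simp add: insert_var_dvd_iff)
  qed
  ultimately show ?thesis using q insert_var_mem by (auto simp: subring_prime_def)
qed

lemma insert_var_prime_product:
  fixes q :: "'a::idom mpoly poly"
  assumes "prime_product (polys_over (mpolys_in A)) q"
  shows "prime_product (mpolys_in (insert x A)) (insert_var x q)"
  using assms
proof (induction rule: prime_product.induct)
  case (unit u)
  interpret V: subdomain "mpolys_in A :: 'a mpoly set" by (rule subdomain_mpolys_in)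
  interpret P: subdomain "polys_over (mpolys_in A) :: 'a mpoly poly set" by (rule V.subdomain_polys_over)
  show ?case using unit insert_var_dvd_iff[of u 1] P.one_mem insert_var_mem
    by (intro prime_product.unit) (auto simp: insert_var_hom)
next
  case (prime q f)
  then show ?case unfolding insert_var_hom by (intro prime_product.prime insert_var_prime)
qed

text \<open>A prime of the smaller ring stays prime as a constant polynomial, and
  \<open>insert_var\<close> maps constants to themselves.\<close>

lemma prime_insert_var:
  fixes q :: "'a::idom mpoly"
  assumes "subring_prime (mpolys_in A) q"
  shows "subring_prime (mpolys_in (insert x A)) q"
proof -
  interpret V: subdomain "mpolys_in A :: 'a mpoly set" by (rule subdomain_mpolys_in)
  show ?thesis using insert_var_prime[OF V.const_prime[OF assms]] by (simp add: insert_var_def)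
qed

end

text \<open>Gauss's theorem, one variable at a time; the induction starts at the constants, where
  every nonzero element is a unit because \<open>'a\<close> is a field.\<close>

lemma mpolys_in_factorial:
  fixes f :: "'a::field mpoly"
  assumes "finite A" "f \<in> mpolys_in A" "f \<noteq> 0"
  shows "prime_product (mpolys_in A) f"
  using assms
proof (induction A arbitrary: f rule: finite_induct)
  case empty
  then have f: "f = Poly_Mapping.single 0 (Poly_Mapping.lookup f 0)" by (rule_tac mpolys_in_empty)
  then have "Poly_Mapping.lookup f 0 \<noteq> 0" using empty by (metis single_zero)
  then have "1 = f * Poly_Mapping.single 0 (inverse (Poly_Mapping.lookup f 0))"
    using single_zero_dvd_one f by metis
  moreover have "Poly_Mapping.single 0 c \<in> mpolys_in {}" for c :: 'a by (auto simp: mpolys_in_def)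
  ultimately show ?case using empty by (intro prime_product.unit) (auto simp: subring_dvd_def)
next
  case (insert x A)
  interpret V: subdomain "mpolys_in A :: 'a mpoly set" by (rule subdomain_mpolys_in)
  obtain p where p: "p \<in> polys_over (mpolys_in A)" "f = insert_var x p" using insert insert_var_surj by blast
  then have "p \<noteq> 0" using insert by (auto simp: insert_var_def)
  then have "prime_product (polys_over (mpolys_in A)) p" using V.Gauss_factorial insert p by blast
  then show ?case using insert_var_prime_product insert p by blast
qed

lemma prime_mpolys_in_union:
  assumes "finite B" "subring_prime (mpolys_in A) (q :: 'a::idom mpoly)"
  shows "subring_prime (mpolys_in (B \<union> A)) q"
  using assms
proof (induction B rule: finite_induct)
  case (insert x B)
  then show ?case by (cases "x \<in> B \<union> A") (auto simp: insert_absorb prime_insert_var)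
qed simp

text \<open>A divisibility involves only finitely many variables. A prime factor found in the
  variables of \<open>f\<close> stays prime when those of \<open>a\<close>, \<open>b\<close> and the
  cofactor are adjoined, so it is prime in the full ring.\<close>

theorem mpoly_prime_factor:
  fixes f :: "'a::field mpoly"
  assumes "f \<noteq> 0" "\<not> f dvd 1"
  shows "\<exists>q. prime_elem q \<and> q dvd f"
proof -
  have "prime_product (mpolys_in (vars f)) f"
    using assms by (intro mpolys_in_factorial finite_vars vars_mpolys_in) auto
  then show ?thesis
  proof cases
    case unit
    then show ?thesis using assms by (auto simp: subring_dvd_def dvd_def)
  next
    case (prime q f')
    have lift: "subring_prime (mpolys_in (B \<union> vars f)) q" if "finite B" for B
      using prime_mpolys_in_union prime that by blast
    have "prime_elem q"
    proof (rule prime_elemI)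
      show "q \<noteq> 0" using prime by (auto simp: subring_prime_def)
      show "\<not> q dvd 1"
      proof
        assume "q dvd 1"
        then obtain c where "1 = q * c" by auto
        moreover have "c \<in> mpolys_in (vars c \<union> vars f)" by (rule vars_mpolys_in) auto
        ultimately show False using lift[of "vars c"] finite_vars
          by (auto simp: subring_prime_def subring_dvd_def)
      qed
      fix a b assume "q dvd a * b"
      then obtain c where c: "a * b = q * c" by auto
      define B where "B = vars a \<union> vars b \<union> vars c \<union> vars f"
      have mem: "a \<in> mpolys_in B" "b \<in> mpolys_in B" "c \<in> mpolys_in B"
        by (auto intro!: vars_mpolys_in simp: B_def)
      have "subring_prime (mpolys_in B) q"
        using lift[of "vars a \<union> vars b \<union> vars c"] finite_vars by (auto simp: B_def)
      then have "subring_dvd (mpolys_in B) q a \<or> subring_dvd (mpolys_in B) q b"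
        using c mem unfolding subring_prime_def subring_dvd_def by metis
      then show "q dvd a \<or> q dvd b" by (auto simp: subring_dvd_def)
    qed
    then show ?thesis using prime by auto
  qed
qed

subsection \<open>Leading forms\<close>

definition restrict_keys :: "('m \<Rightarrow> bool) \<Rightarrow> ('m \<Rightarrow>\<^sub>0 'a) \<Rightarrow> ('m \<Rightarrow>\<^sub>0 'a::zero)" where
  "restrict_keys P f = Poly_Mapping.mapp (\<lambda>m c. if P m then c else 0) f"

lemma lookup_restrict_keys: "Poly_Mapping.lookup (restrict_keys P f) m = (if P m then Poly_Mapping.lookup f m else 0)"
  by (auto simp: restrict_keys_def lookup_mapp when_def in_keys_iff)

lemma keys_restrict_keys: "Poly_Mapping.keys (restrict_keys P f) = {m \<in> Poly_Mapping.keys f. P m}"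
  by (auto simp: in_keys_iff lookup_restrict_keys split: if_splits)

lemma restrict_keys_add: "restrict_keys P (f + g) = restrict_keys P f + restrict_keys P g"
  by (rule poly_mapping_eqI) (simp add: lookup_restrict_keys lookup_add)

lemma restrict_keys_zero [simp]: "restrict_keys P 0 = 0"
  by (rule poly_mapping_eqI) (simp add: lookup_restrict_keys)

lemma restrict_keys_sum: "restrict_keys P (sum h I) = (\<Sum>i\<in>I. restrict_keys P (h i))"
  by (induction I rule: infinite_finite_induct) (simp_all add: restrict_keys_add)

lemma restrict_keys_id: "(\<And>m. m \<in> Poly_Mapping.keys f \<Longrightarrow> P m) \<Longrightarrow> restrict_keys P f = f"
  by (rule poly_mapping_eqI) (auto simp: lookup_restrict_keys in_keys_iff)

lemma restrict_keys_eq_0: "(\<And>m. m \<in> Poly_Mapping.keys f \<Longrightarrow> \<not> P m) \<Longrightarrow> restrict_keys P f = 0"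
  by (rule poly_mapping_eqI) (auto simp: lookup_restrict_keys in_keys_iff)

lemma restrict_keys_nonzero: "m \<in> Poly_Mapping.keys f \<Longrightarrow> P m \<Longrightarrow> restrict_keys P f \<noteq> 0"
  by (metis in_keys_iff lookup_restrict_keys lookup_zero)

text \<open>Terms of weight below \<open>u\<close> or \<open>v\<close> only reach weights strictly
  below \<open>u + v\<close>. If a bound is not attained, both sides vanish.\<close>

lemma restrict_keys_top_mult:
  fixes f g :: "'m::comm_monoid_add \<Rightarrow>\<^sub>0 'a::comm_ring_1" and w :: "'m \<Rightarrow> 'w::linordered_cancel_ab_semigroup_add"
  assumes w: "\<And>m m'. w (m + m') = w m + w m'"
    and f: "\<And>m. m \<in> Poly_Mapping.keys f \<Longrightarrow> w m \<le> u" and g: "\<And>m. m \<in> Poly_Mapping.keys g \<Longrightarrow> w m \<le> v"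
  shows "restrict_keys (\<lambda>m. w m = u + v) (f * g) =
    restrict_keys (\<lambda>m. w m = u) f * restrict_keys (\<lambda>m. w m = v) g"
proof -
  define f1 where "f1 = restrict_keys (\<lambda>m. w m = u) f"
  define f2 where "f2 = restrict_keys (\<lambda>m. w m \<noteq> u) f"
  define g1 where "g1 = restrict_keys (\<lambda>m. w m = v) g"
  define g2 where "g2 = restrict_keys (\<lambda>m. w m \<noteq> v) g"
  have fe: "f = f1 + f2" and ge: "g = g1 + g2"
    by (auto intro!: poly_mapping_eqI simp: f1_def f2_def g1_def g2_def lookup_add lookup_restrict_keys)
  have k: "w m = u" if "m \<in> Poly_Mapping.keys f1" for m using that by (simp add: f1_def keys_restrict_keys)
  have k2: "w m < u" if "m \<in> Poly_Mapping.keys f2" for m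
    using that f[of m] by (auto simp: f2_def keys_restrict_keys)
  have l: "w m = v" if "m \<in> Poly_Mapping.keys g1" for m using that by (simp add: g1_def keys_restrict_keys)
  have l2: "w m < v" if "m \<in> Poly_Mapping.keys g2" for m
    using that g[of m] by (auto simp: g2_def keys_restrict_keys)
  have "f * g = f1 * g + f2 * g" by (simp only: fe distrib_right)
  also have "f1 * g = f1 * g1 + f1 * g2" by (simp only: ge distrib_left)
  finally have "f * g = f1 * g1 + (f1 * g2 + f2 * g)" by (simp only: add.assoc)
  moreover have "restrict_keys (\<lambda>m. w m = u + v) (f1 * g1) = f1 * g1"
    using keys_mult[of f1 g1] k l by (intro restrict_keys_id) (auto simp: w)
  moreover have "restrict_keys (\<lambda>m. w m = u + v) (f1 * g2) = 0"
    using keys_mult[of f1 g2] k l2 by (intro restrict_keys_eq_0) (fastforce simp: w)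
  moreover have "restrict_keys (\<lambda>m. w m = u + v) (f2 * g) = 0"
  proof (rule restrict_keys_eq_0)
    fix m assume "m \<in> Poly_Mapping.keys (f2 * g)"
    then obtain a b where "m = a + b" "a \<in> Poly_Mapping.keys f2" "b \<in> Poly_Mapping.keys g"
      using keys_mult[of f2 g] by blast
    then have "w m < u + v" using k2 g by (auto simp: w intro: add_less_le_mono)
    then show "w m \<noteq> u + v" by simp
  qed
  ultimately show ?thesis by (simp add: restrict_keys_add f1_def[symmetric] g1_def[symmetric])
qed

text \<open>Leading forms are nonzero and there are no zero divisors, so their product is a nonzero
  form whose weight is the sum of the maxima.\<close>

lemma Max_weight_mult:
  fixes f g :: "'a::idom mpoly" and w :: "(nat \<Rightarrow>\<^sub>0 nat) \<Rightarrow> 'w::linordered_cancel_ab_semigroup_add"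
  assumes w: "\<And>m m'. w (m + m') = w m + w m'" and "f \<noteq> 0" "g \<noteq> 0"
  shows "Max (w ` Poly_Mapping.keys (f * g)) = Max (w ` Poly_Mapping.keys f) + Max (w ` Poly_Mapping.keys g)"
proof -
  let ?u = "Max (w ` Poly_Mapping.keys f)" and ?v = "Max (w ` Poly_Mapping.keys g)"
  have u: "w m \<le> ?u" if "m \<in> Poly_Mapping.keys f" for m using that by simp
  have v: "w m \<le> ?v" if "m \<in> Poly_Mapping.keys g" for m using that by simp
  have ne: "Poly_Mapping.keys h \<noteq> {}" if "h \<noteq> 0" for h :: "'a mpoly" using that by simp
  have "?u \<in> w ` Poly_Mapping.keys f" using ne assms by (intro Max_in) auto
  then obtain a where "a \<in> Poly_Mapping.keys f" "?u = w a" by (rule imageE) 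
  then have f1: "restrict_keys (\<lambda>m. w m = ?u) f \<noteq> 0" by (intro restrict_keys_nonzero[of a]) auto
  have "?v \<in> w ` Poly_Mapping.keys g" using ne assms by (intro Max_in) auto
  then obtain b where "b \<in> Poly_Mapping.keys g" "?v = w b" by (rule imageE)
  then have g1: "restrict_keys (\<lambda>m. w m = ?v) g \<noteq> 0" by (intro restrict_keys_nonzero[of b]) auto
  have "restrict_keys (\<lambda>m. w m = ?u + ?v) (f * g) \<noteq> 0"
    using f1 g1 by (simp add: restrict_keys_top_mult[OF w u v])
  then obtain m where m: "m \<in> Poly_Mapping.keys (f * g)" "w m = ?u + ?v"
    using restrict_keys_eq_0[of "f * g" "\<lambda>m. w m = ?u + ?v"] by blast
  show ?thesis
  proof (rule Max_eqI)
    show "?u + ?v \<in> w ` Poly_Mapping.keys (f * g)" using m by (metis imageI)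
    fix y assume "y \<in> w ` Poly_Mapping.keys (f * g)"
    then obtain a b where "y = w a + w b" "a \<in> Poly_Mapping.keys f" "b \<in> Poly_Mapping.keys g"
      using keys_mult[of f g] w by fastforce
    then show "y \<le> ?u + ?v" using u v by (auto intro: add_mono)
  qed simp
qed

text \<open>By \<open>Max_weight_mult\<close> for \<open>w\<close> and for its negative, the largest
  and the smallest weights both add under multiplication. If they coincide for the product, they
  coincide for each factor.\<close>

lemma homogeneous_factor:
  fixes a b :: "'a::idom mpoly" and w :: "(nat \<Rightarrow>\<^sub>0 nat) \<Rightarrow> int"
  assumes w: "\<And>m m'. w (m + m') = w m + w m'" and ne: "a * b \<noteq> 0"
    and hom: "\<And>m m'. m \<in> Poly_Mapping.keys (a * b) \<Longrightarrow> m' \<in> Poly_Mapping.keys (a * b) \<Longrightarrow> w m = w m'"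
    and m: "m \<in> Poly_Mapping.keys a" "m' \<in> Poly_Mapping.keys a"
  shows "w m = w m'"
proof -
  have ab: "a \<noteq> 0" "b \<noteq> 0" using ne by auto
  obtain k where k: "k \<in> Poly_Mapping.keys (a * b)" using ne by (metis all_not_in_conv keys_eq_empty)
  obtain l where l: "l \<in> Poly_Mapping.keys b" using ab by (metis all_not_in_conv keys_eq_empty)
  have "w ` Poly_Mapping.keys (a * b) = {w k}" using hom k by blast
  then have 1: "w k = Max (w ` Poly_Mapping.keys a) + Max (w ` Poly_Mapping.keys b)"
    using Max_weight_mult[OF w ab] by simp
  have "(\<lambda>m. - w m) ` Poly_Mapping.keys (a * b) = uminus ` (w ` Poly_Mapping.keys (a * b))"
    by (simp only: image_image)
  also have "\<dots> = {- w k}" unfolding \<open>w ` _ = _\<close> by simp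
  finally have "(\<lambda>m. - w m) ` Poly_Mapping.keys (a * b) = {- w k}" .
  then have 2: "- w k = Max ((\<lambda>m. - w m) ` Poly_Mapping.keys a) + Max ((\<lambda>m. - w m) ` Poly_Mapping.keys b)"
    using Max_weight_mult[OF _ ab, of "\<lambda>m. - w m"] w by simp
  have le: "w i \<le> Max (w ` Poly_Mapping.keys f)" "- w i \<le> Max ((\<lambda>m. - w m) ` Poly_Mapping.keys f)"
    if "i \<in> Poly_Mapping.keys f" for i and f :: "'a mpoly" using that by auto
  show ?thesis using 1 2 le[OF m(1)] le[OF m(2)] le[OF l] by linarith
qed

lemma keys_times_not_empty:
  fixes f g :: "'a::idom mpoly"
  assumes "f \<noteq> 0" "g \<noteq> 0"
  obtains a b where "a \<in> Poly_Mapping.keys f" "b \<in> Poly_Mapping.keys g" "a + b \<in> Poly_Mapping.keys (f * g)"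
proof -
  have "f * g \<noteq> 0" using assms by simp
  then obtain m where "m \<in> Poly_Mapping.keys (f * g)" by (metis all_not_in_conv keys_eq_empty)
  then show ?thesis using keys_mult[of f g] that by blast
qed

section \<open>Total degree and units\<close>

definition tdeg :: "'a::zero mpoly \<Rightarrow> nat" where
  "tdeg f = Max ((\<lambda>m. \<Sum>v\<in>Poly_Mapping.keys m. Poly_Mapping.lookup m v) ` Poly_Mapping.keys f)"

lemma sum_keys_superset:
  assumes "finite A" "Poly_Mapping.keys m \<subseteq> A" "\<And>v. h v 0 = 0"
  shows "(\<Sum>v\<in>Poly_Mapping.keys m. h v (Poly_Mapping.lookup m v)) = (\<Sum>v\<in>A. h v (Poly_Mapping.lookup m v))"
  using assms by (intro sum.mono_neutral_left) (auto simp: in_keys_iff)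

text \<open>The common source of additivity for the total degree, the boundary \<open>bd\<close> and
  the weight \<open>wt\<close>: all sums are extended to the union of the supports, where the added
  exponents are zero.\<close>

lemma sum_keys_add:
  fixes m m' :: "nat \<Rightarrow>\<^sub>0 nat" and h :: "nat \<Rightarrow> nat \<Rightarrow> 'b::comm_monoid_add"
  assumes "\<And>v. h v 0 = 0" "\<And>v i j. h v (i + j) = h v i + h v j"
  shows "(\<Sum>v\<in>Poly_Mapping.keys (m + m'). h v (Poly_Mapping.lookup (m + m') v)) =
    (\<Sum>v\<in>Poly_Mapping.keys m. h v (Poly_Mapping.lookup m v)) + (\<Sum>v\<in>Poly_Mapping.keys m'. h v (Poly_Mapping.lookup m' v))"
proof -
  let ?A = "Poly_Mapping.keys m \<union> Poly_Mapping.keys m'"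
  have "(\<Sum>v\<in>Poly_Mapping.keys m. h v (Poly_Mapping.lookup m v)) = (\<Sum>v\<in>?A. h v (Poly_Mapping.lookup m v))"
    "(\<Sum>v\<in>Poly_Mapping.keys m'. h v (Poly_Mapping.lookup m' v)) = (\<Sum>v\<in>?A. h v (Poly_Mapping.lookup m' v))"
    using assms by (auto intro!: sum_keys_superset)
  then show ?thesis by (simp add: keys_plus_nat lookup_add assms sum.distrib)
qed

lemma tdeg_mult:
  fixes f g :: "'a::idom mpoly"
  assumes "f \<noteq> 0" "g \<noteq> 0"
  shows "tdeg (f * g) = tdeg f + tdeg g"
  unfolding tdeg_def
  by (rule Max_weight_mult[OF _ assms]) (rule sum_keys_add[of "\<lambda>_ i. i"], auto)

lemma tdeg_0_const:
  assumes "tdeg f = 0" "m \<in> Poly_Mapping.keys f"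
  shows "m = 0"
proof -
  have "(\<Sum>v\<in>Poly_Mapping.keys m. Poly_Mapping.lookup m v) \<le> tdeg f"
    unfolding tdeg_def using assms by (intro Max_ge) auto
  then show ?thesis using assms by (auto simp: in_keys_iff intro!: poly_mapping_eqI)
qed

lemma tdeg_pos:
  fixes f :: "'a::field mpoly"
  assumes "f \<noteq> 0" "\<not> f dvd 1"
  shows "tdeg f > 0"
proof (rule ccontr)
  assume "\<not> ?thesis"
  then have "f \<in> mpolys_in {}" using tdeg_0_const[of f] by (fastforce simp: mpolys_in_def)
  then have f: "f = Poly_Mapping.single 0 (Poly_Mapping.lookup f 0)" by (rule mpolys_in_empty)
  then have "Poly_Mapping.lookup f 0 \<noteq> 0" using assms by (metis single_zero)
  then have "f * Poly_Mapping.single 0 (inverse (Poly_Mapping.lookup f 0)) = 1"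
    using single_zero_dvd_one f by metis
  then show False using assms by (metis dvd_triv_left)
qed

text \<open>The total degrees of a unit and its inverse add up to zero, so units are
  constants.\<close>

lemma unit_keys:
  fixes f :: "'a::idom mpoly"
  assumes "f dvd 1" "m \<in> Poly_Mapping.keys f"
  shows "m = 0"
proof -
  obtain g where g: "1 = f * g" using assms by auto
  then have "f \<noteq> 0" "g \<noteq> 0" by auto
  then have "tdeg f + tdeg g = tdeg (1 :: 'a mpoly)" using g tdeg_mult by metis
  also have "\<dots> = 0" by (simp add: tdeg_def)
  finally show ?thesis using tdeg_0_const[of f m] assms by simp
qed

subsection \<open>Evaluation\<close>

definition eval_mpoly :: "(nat \<Rightarrow> 'a) \<Rightarrow> 'a::comm_ring_1 mpoly \<Rightarrow> 'a" where
  "eval_mpoly x f = (\<Sum>m\<in>Poly_Mapping.keys f. Poly_Mapping.lookup f m * (\<Prod>v\<in>Poly_Mapping.keys m. x v ^ Poly_Mapping.lookup m v))"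

lemma eval_mpoly_add: "eval_mpoly x (f + g) = eval_mpoly x f + eval_mpoly x g"
  unfolding eval_mpoly_def by (rule setsum_keys_plus_distrib) (simp_all add: algebra_simps)

lemma eval_mpoly_single: "eval_mpoly x (Poly_Mapping.single m c) = c * (\<Prod>v\<in>Poly_Mapping.keys m. x v ^ Poly_Mapping.lookup m v)"
  by (simp add: eval_mpoly_def)

lemma eval_mpoly_mult: "eval_mpoly x (f * g) = eval_mpoly x f * eval_mpoly x g"
proof (rule additive_multiplicative_of_singles)
  fix m m' :: "nat \<Rightarrow>\<^sub>0 nat" and c d
  let ?A = "Poly_Mapping.keys m \<union> Poly_Mapping.keys m'"
  have p: "(\<Prod>v\<in>Poly_Mapping.keys k. x v ^ Poly_Mapping.lookup k v) = (\<Prod>v\<in>?A. x v ^ Poly_Mapping.lookup k v)"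
    if "Poly_Mapping.keys k \<subseteq> ?A" for k
    using that by (intro prod.mono_neutral_left) (auto simp: in_keys_iff)
  show "eval_mpoly x (Poly_Mapping.single m c * Poly_Mapping.single m' d) =
    eval_mpoly x (Poly_Mapping.single m c) * eval_mpoly x (Poly_Mapping.single m' d)"
    unfolding mult_single eval_mpoly_single
    by (subst (1 2 3) p) (auto simp: keys_plus_nat lookup_add power_add prod.distrib)
qed (rule eval_mpoly_add)

lemma eval_mpoly_zero [simp]: "eval_mpoly x 0 = 0"
  by (simp add: eval_mpoly_def)

lemma eval_mpoly_one [simp]: "eval_mpoly x 1 = 1"
  by (simp add: eval_mpoly_def)

lemma eval_mpoly_uminus: "eval_mpoly x (- f) = - eval_mpoly x f"
  using eval_mpoly_add[of x f "- f"] by (simp add: eq_neg_iff_add_eq_0 add.commute)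

lemma eval_mpoly_diff: "eval_mpoly x (f - g) = eval_mpoly x f - eval_mpoly x g"
  using eval_mpoly_add[of x f "- g"] by (simp add: eval_mpoly_uminus)

lemma eval_mpoly_sum: "eval_mpoly x (sum h I) = (\<Sum>i\<in>I. eval_mpoly x (h i))"
  by (induction I rule: infinite_finite_induct) (simp_all add: eval_mpoly_add)

lemma eval_mpoly_Var [simp]: "eval_mpoly x (Var v) = x v"
  by (simp add: Var_def eval_mpoly_single)

lemma eval_mpoly_const [simp]: "eval_mpoly x (Poly_Mapping.single 0 c) = c"
  by (simp add: eval_mpoly_single)

lemma eval_mpoly_cong:
  assumes "f \<in> mpolys_in A" "\<And>v. v \<in> A \<Longrightarrow> x v = y v"
  shows "eval_mpoly x f = eval_mpoly y f"
  unfolding eval_mpoly_def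
  by (intro sum.cong refl arg_cong[where f = "(*) _"] prod.cong arg_cong[where f = "\<lambda>a. a ^ _"])
    (use assms in \<open>auto simp: mpolys_in_def\<close>)

text \<open>Induction on the variables: at a point where the leading coefficient in \<open>x\<close>
  does not vanish there remains a nonzero polynomial in one variable, and its finitely many roots do
  not exhaust an infinite field.\<close>

lemma eval_mpoly_nonzero:
  fixes f :: "'a::field mpoly"
  assumes inf: "infinite (UNIV :: 'a set)" and "f \<noteq> 0"
  shows "\<exists>x. eval_mpoly x f \<noteq> 0"
proof -
  have "\<exists>x. eval_mpoly x f \<noteq> 0" if "finite A" "f \<in> mpolys_in A" "f \<noteq> 0" for A and f :: "'a mpoly"
    using that
  proof (induction A arbitrary: f rule: finite_induct)
    case empty
    then have f: "f = Poly_Mapping.single 0 (Poly_Mapping.lookup f 0)" by (rule_tac mpolys_in_empty)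
    then have "Poly_Mapping.lookup f 0 \<noteq> 0" using empty by (metis single_zero)
    then show ?case using f by (metis eval_mpoly_const)
  next
    case (insert x A)
    obtain p where p: "p \<in> polys_over (mpolys_in A)" "f = insert_var x p" using insert insert_var_surj by blast
    then have "p \<noteq> 0" using insert by (auto simp: insert_var_def)
    then obtain y where y: "eval_mpoly y (lead_coeff p) \<noteq> 0"
      using insert.IH[of "lead_coeff p"] p by (auto simp: polys_over_def)
    define P where "P = map_poly (eval_mpoly y) p"
    have "coeff P (degree p) \<noteq> 0" using y by (simp add: P_def coeff_map_poly)
    then have "P \<noteq> 0" by auto
    then have "finite {t. poly P t = 0}" by (rule poly_roots_finite)
    then obtain t where t: "poly P t \<noteq> 0" using inf by (metis (mono_tags) UNIV_eq_I mem_Collect_eq)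
    have "eval_mpoly (y(x := t)) (insert_var x q) = poly (map_poly (eval_mpoly y) q) t"
      if "q \<in> polys_over (mpolys_in A)" for q using that
    proof (induction q)
      case 0
      then show ?case by (simp add: insert_var_def)
    next
      case (pCons a q)
      have a: "a \<in> mpolys_in A" "q \<in> polys_over (mpolys_in A)"
        using pCons(3) by (auto simp: polys_over_def dest: spec[of _ 0] spec[of _ "Suc _"])
      have e: "eval_mpoly (y(x := t)) a = eval_mpoly y a"
        using a(1) insert(2) by (intro eval_mpoly_cong) auto
      have "eval_mpoly (y(x := t)) (insert_var x (pCons a q)) =
        eval_mpoly (y(x := t)) a + t * eval_mpoly (y(x := t)) (insert_var x q)"
        by (simp add: insert_var_def eval_mpoly_add eval_mpoly_mult del: fun_upd_apply)
          (simp add: fun_upd_apply)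
      then show ?case using pCons(2) a by (simp add: e map_poly_pCons del: fun_upd_apply)
    qed
    then show ?case using t p P_def by metis
  qed
  then show ?thesis using assms finite_vars vars_mpolys_in by blast
qed

subsection \<open>An abelian group acting on the variables\<close>

lemma lookup_map_key: "inj f \<Longrightarrow> Poly_Mapping.lookup (Poly_Mapping.map_key f p) x = Poly_Mapping.lookup p (f x)"
  by (simp add: map_key.rep_eq)

text \<open>\<sigma> pairs terms of equal value; the order of \<open>nat\<close> selects one index
  from each pair.\<close>

lemma even_sum_involution:
  fixes F :: "nat \<Rightarrow> int"
  assumes "finite X" "\<And>x. x \<in> X \<Longrightarrow> \<sigma> x \<in> X \<and> \<sigma> (\<sigma> x) = x \<and> \<sigma> x \<noteq> x \<and> F (\<sigma> x) = F x"
  shows "even (\<Sum>x\<in>X. F x)"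
proof -
  let ?L = "{x \<in> X. x < \<sigma> x}" and ?G = "{x \<in> X. \<sigma> x < x}"
  have "(\<Sum>x\<in>X. F x) = (\<Sum>x\<in>?L \<union> ?G. F x)"
    using assms(2) by (intro sum.cong) (auto simp: neq_iff)
  also have "\<dots> = (\<Sum>x\<in>?L. F x) + (\<Sum>x\<in>?G. F x)"
    using assms(1) by (intro sum.union_disjoint) auto
  also have "(\<Sum>x\<in>?G. F x) = (\<Sum>x\<in>?L. F x)"
    by (rule sum.reindex_bij_witness[of _ \<sigma> \<sigma>]) (use assms(2) in auto)
  finally show ?thesis by simp
qed

text \<open>The group is carried by \<open>{..<n}\<close> with neutral element \<open>0\<close>, so
  its elements serve at once as matrix indices and as translations of them.\<close>

locale abelian_index =
  fixes n :: nat and op :: "nat \<Rightarrow> nat \<Rightarrow> nat" (infixl "+\<^sub>G" 65) and neg :: "nat \<Rightarrow> nat"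
  assumes n_pos: "n > 0"
    and op_less: "x < n \<Longrightarrow> y < n \<Longrightarrow> x +\<^sub>G y < n" and neg_less: "x < n \<Longrightarrow> neg x < n"
    and op_assoc: "x < n \<Longrightarrow> y < n \<Longrightarrow> z < n \<Longrightarrow> x +\<^sub>G y +\<^sub>G z = x +\<^sub>G (y +\<^sub>G z)"
    and op_comm: "x < n \<Longrightarrow> y < n \<Longrightarrow> x +\<^sub>G y = y +\<^sub>G x"
    and op_zero: "x < n \<Longrightarrow> 0 +\<^sub>G x = x"
    and op_neg: "x < n \<Longrightarrow> neg x +\<^sub>G x = 0"
begin

lemma op_zero_right: "x < n \<Longrightarrow> x +\<^sub>G 0 = x"
  using op_comm n_pos op_zero by metis

lemma op_neg_right: "x < n \<Longrightarrow> x +\<^sub>G neg x = 0"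
  using op_comm neg_less op_neg by metis

lemma neg_op_cancel: "x < n \<Longrightarrow> y < n \<Longrightarrow> neg x +\<^sub>G (x +\<^sub>G y) = y"
  by (metis op_assoc neg_less op_neg op_zero)

lemma op_neg_cancel: "x < n \<Longrightarrow> y < n \<Longrightarrow> x +\<^sub>G (neg x +\<^sub>G y) = y"
  by (metis op_assoc neg_less op_neg_right op_zero)

lemma op_left_cancel: "x < n \<Longrightarrow> y < n \<Longrightarrow> z < n \<Longrightarrow> x +\<^sub>G y = x +\<^sub>G z \<longleftrightarrow> y = z"
  by (metis neg_op_cancel)

lemma neg_op:
  assumes "a < n" "b < n"
  shows "neg (a +\<^sub>G b) = neg b +\<^sub>G neg a"
proof -
  have "(neg b +\<^sub>G neg a) +\<^sub>G (a +\<^sub>G b) = neg b +\<^sub>G (neg a +\<^sub>G (a +\<^sub>G b))"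
    using assms by (simp add: op_assoc op_less neg_less)
  also have "\<dots> = neg (a +\<^sub>G b) +\<^sub>G (a +\<^sub>G b)" using assms by (simp add: neg_op_cancel op_neg op_less)
  finally have "(a +\<^sub>G b) +\<^sub>G (neg b +\<^sub>G neg a) = (a +\<^sub>G b) +\<^sub>G neg (a +\<^sub>G b)"
    using assms by (simp add: op_comm[of "a +\<^sub>G b"] op_less neg_less)
  then show ?thesis using assms by (simp add: op_left_cancel op_less neg_less)
qed

lemma bij_op: "a < n \<Longrightarrow> bij_betw (\<lambda>x. a +\<^sub>G x) {..<n} {..<n}"
  by (rule bij_betw_byWitness[where f' = "\<lambda>x. neg a +\<^sub>G x"])
    (auto simp: neg_op_cancel op_neg_cancel op_less neg_less)

lemma sum_op: "a < n \<Longrightarrow> (\<Sum>x<n. F (a +\<^sub>G x)) = (\<Sum>x<n. F x)"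
  by (rule sum.reindex_bij_betw[OF bij_op])

text \<open>The variable \<open>x\<^sub>i\<^sub>,\<^sub>h\<^sub>,\<^sub>k\<close> with \<open>h, k < n\<close> is numbered \<open>(i n + h) n + k\<close>.\<close>

definition enc :: "nat \<Rightarrow> nat \<Rightarrow> nat \<Rightarrow> nat" where "enc i h k = (i * n + h) * n + k"
definition block :: "nat \<Rightarrow> nat" where "block v = v div n div n"
definition src :: "nat \<Rightarrow> nat" where "src v = (v div n) mod n"
definition tgt :: "nat \<Rightarrow> nat" where "tgt v = v mod n"

lemma enc_simps: "h < n \<Longrightarrow> k < n \<Longrightarrow> block (enc i h k) = i"
  "h < n \<Longrightarrow> k < n \<Longrightarrow> src (enc i h k) = h" "h < n \<Longrightarrow> k < n \<Longrightarrow> tgt (enc i h k) = k"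
  using n_pos by (auto simp: enc_def block_def src_def tgt_def)

lemma src_less: "src v < n" and tgt_less: "tgt v < n"
  using n_pos by (auto simp: src_def tgt_def)

lemma enc_src_tgt: "enc (block v) (src v) (tgt v) = v"
  by (simp add: enc_def block_def src_def tgt_def)

section \<open>Translations acting on variables, monomials and polynomials\<close>

definition shift :: "nat \<Rightarrow> nat \<Rightarrow> nat" where
  "shift a v = enc (block v) (a +\<^sub>G src v) (a +\<^sub>G tgt v)"

lemma src_shift: "a < n \<Longrightarrow> src (shift a v) = a +\<^sub>G src v"
  and tgt_shift: "a < n \<Longrightarrow> tgt (shift a v) = a +\<^sub>G tgt v"
  by (simp_all add: shift_def enc_simps op_less src_less tgt_less)

lemma shift_shift: "a < n \<Longrightarrow> b < n \<Longrightarrow> shift a (shift b v) = shift (a +\<^sub>G b) v"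
  by (simp add: shift_def enc_simps op_less src_less tgt_less op_assoc)

lemma shift_zero: "shift 0 v = v"
  by (simp add: shift_def op_zero src_less tgt_less enc_src_tgt)

lemma shift_neg: "a < n \<Longrightarrow> shift a (shift (neg a) v) = v" "a < n \<Longrightarrow> shift (neg a) (shift a v) = v"
  by (simp_all add: shift_shift neg_less op_neg op_neg_right shift_zero)

lemma inj_shift: "a < n \<Longrightarrow> inj (shift a)"
  by (rule inj_on_inverseI[of _ "shift (neg a)"]) (simp add: shift_neg)

text \<open>\<open>map_key\<close> composes with its argument; taking the shift by
  \<open>neg a\<close> turns this into a pushforward, which moves each variable \<open>v\<close> to
  \<open>shift a v\<close>.\<close>

definition mshift :: "nat \<Rightarrow> (nat \<Rightarrow>\<^sub>0 nat) \<Rightarrow> (nat \<Rightarrow>\<^sub>0 nat)" where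
  "mshift a m = Poly_Mapping.map_key (shift (neg a)) m"

lemma lookup_mshift: "a < n \<Longrightarrow> Poly_Mapping.lookup (mshift a m) v = Poly_Mapping.lookup m (shift (neg a) v)"
  by (simp add: mshift_def lookup_map_key inj_shift neg_less)

lemma mshift_mshift: "a < n \<Longrightarrow> b < n \<Longrightarrow> mshift a (mshift b m) = mshift (a +\<^sub>G b) m"
proof (rule poly_mapping_eqI)
  fix v assume ab: "a < n" "b < n"
  show "Poly_Mapping.lookup (mshift a (mshift b m)) v = Poly_Mapping.lookup (mshift (a +\<^sub>G b) m) v"
    using ab by (simp add: lookup_mshift op_less shift_shift neg_less neg_op)
qed

lemma neg_zero: "neg 0 = 0"
  using op_neg[OF n_pos] op_zero_right neg_less n_pos by metis

lemma mshift_zero: "mshift 0 m = m"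
  by (rule poly_mapping_eqI) (simp add: lookup_mshift n_pos neg_zero shift_zero)

lemma mshift_neg: "a < n \<Longrightarrow> mshift a (mshift (neg a) m) = m" "a < n \<Longrightarrow> mshift (neg a) (mshift a m) = m"
  by (simp_all add: mshift_mshift neg_less op_neg op_neg_right mshift_zero)

lemma inj_mshift: "a < n \<Longrightarrow> inj (mshift a)"
  by (rule inj_on_inverseI[of _ "mshift (neg a)"]) (simp add: mshift_neg)

lemma mshift_add: "a < n \<Longrightarrow> mshift a (m + m') = mshift a m + mshift a m'"
  by (rule poly_mapping_eqI) (simp add: lookup_mshift lookup_add)

lemma keys_mshift: "a < n \<Longrightarrow> Poly_Mapping.keys (mshift a m) = shift a ` Poly_Mapping.keys m"
proof (intro Set.set_eqI iffI)
  fix v assume "a < n" "v \<in> Poly_Mapping.keys (mshift a m)"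
  then have "shift (neg a) v \<in> Poly_Mapping.keys m" by (simp add: in_keys_iff lookup_mshift)
  then have "shift a (shift (neg a) v) \<in> shift a ` Poly_Mapping.keys m" by (rule imageI)
  then show "v \<in> shift a ` Poly_Mapping.keys m" using \<open>a < n\<close> by (simp add: shift_neg)
qed (auto simp: in_keys_iff lookup_mshift shift_neg)

lemma sum_mshift:
  assumes "a < n"
  shows "(\<Sum>v\<in>Poly_Mapping.keys (mshift a m). h v (Poly_Mapping.lookup (mshift a m) v)) =
    (\<Sum>v\<in>Poly_Mapping.keys m. h (shift a v) (Poly_Mapping.lookup m v))"
  unfolding keys_mshift[OF assms]
  by (subst sum.reindex) (auto simp: lookup_mshift assms shift_neg intro: inj_on_subset[OF inj_shift])

definition act :: "nat \<Rightarrow> 'a::comm_ring_1 mpoly \<Rightarrow> 'a mpoly" where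
  "act a f = Poly_Mapping.map_key (mshift (neg a)) f"

lemma lookup_act: "a < n \<Longrightarrow> Poly_Mapping.lookup (act a f) m = Poly_Mapping.lookup f (mshift (neg a) m)"
  by (simp add: act_def lookup_map_key inj_mshift neg_less)

lemma act_single: "a < n \<Longrightarrow> act a (Poly_Mapping.single m c) = Poly_Mapping.single (mshift a m) c"
  by (rule poly_mapping_eqI) (auto simp: lookup_act lookup_single when_def mshift_neg)

lemma act_add: "a < n \<Longrightarrow> act a (f + g) = act a f + act a g"
  by (rule poly_mapping_eqI) (simp add: lookup_act lookup_add)

lemma act_zero [simp]: "a < n \<Longrightarrow> act a 0 = 0"
  by (rule poly_mapping_eqI) (simp add: lookup_act)

lemma act_uminus: "a < n \<Longrightarrow> act a (- f) = - act a f"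
  by (rule poly_mapping_eqI) (simp add: lookup_act)

lemma act_diff: "a < n \<Longrightarrow> act a (f - g) = act a f - act a g"
  using act_add[of a f "- g"] by (simp add: act_uminus)

lemma act_sum: "a < n \<Longrightarrow> act a (sum h I) = (\<Sum>i\<in>I. act a (h i))"
  by (induction I rule: infinite_finite_induct) (simp_all add: act_add)

lemma act_mult: "a < n \<Longrightarrow> act a (f * g) = act a f * act a g"
  by (rule additive_multiplicative_of_singles)
    (simp_all add: act_add act_single mult_single mshift_add)

lemma act_one [simp]: "a < n \<Longrightarrow> act a 1 = 1"
  using act_single[of a 0 1] by (simp add: mshift_def inj_shift neg_less)

lemma act_power: "a < n \<Longrightarrow> act a (f ^ k) = act a f ^ k"
  by (induction k) (simp_all add: act_mult)

lemma act_act: "a < n \<Longrightarrow> b < n \<Longrightarrow> act a (act b f) = act (a +\<^sub>G b) f"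
proof (rule poly_mapping_eqI)
  fix m assume ab: "a < n" "b < n"
  show "Poly_Mapping.lookup (act a (act b f)) m = Poly_Mapping.lookup (act (a +\<^sub>G b) f) m"
    using ab by (simp add: lookup_act op_less mshift_mshift neg_less neg_op)
qed

lemma act_0: "act 0 f = f"
  by (rule poly_mapping_eqI) (simp add: lookup_act n_pos neg_zero mshift_zero)

lemma act_neg: "a < n \<Longrightarrow> act a (act (neg a) f) = f" "a < n \<Longrightarrow> act (neg a) (act a f) = f"
  by (simp_all add: act_act neg_less op_neg op_neg_right act_0)

lemma act_eq_0_iff [simp]: "a < n \<Longrightarrow> act a f = 0 \<longleftrightarrow> f = 0"
  by (metis act_neg(2) act_zero neg_less)

lemma keys_act: "a < n \<Longrightarrow> Poly_Mapping.keys (act a f) = mshift a ` Poly_Mapping.keys f"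
proof (intro Set.set_eqI iffI)
  fix m assume "a < n" "m \<in> Poly_Mapping.keys (act a f)"
  then have "mshift (neg a) m \<in> Poly_Mapping.keys f" by (simp add: in_keys_iff lookup_act)
  then have "mshift a (mshift (neg a) m) \<in> mshift a ` Poly_Mapping.keys f" by (rule imageI)
  then show "m \<in> mshift a ` Poly_Mapping.keys f" using \<open>a < n\<close> by (simp add: mshift_neg)
qed (auto simp: in_keys_iff lookup_act mshift_neg)

lemma act_Var: "a < n \<Longrightarrow> act a (Var v) = Var (shift a v)"
proof -
  assume a: "a < n"
  have "mshift a (Poly_Mapping.single v (Suc 0)) = Poly_Mapping.single (shift a v) (Suc 0)"
    by (rule poly_mapping_eqI) (use a in \<open>auto simp: lookup_mshift lookup_single when_def shift_neg\<close>)
  then show ?thesis by (simp add: Var_def act_single a)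
qed

lemma act_const: "a < n \<Longrightarrow> act a (Poly_Mapping.single 0 c) = Poly_Mapping.single 0 c"
  by (simp add: act_single mshift_def inj_shift neg_less)

lemma act_dvd: "a < n \<Longrightarrow> f dvd g \<Longrightarrow> act a f dvd act a g"
  by (auto simp: dvd_def act_mult)

lemma act_dvd_iff: "a < n \<Longrightarrow> act a f dvd act a g \<longleftrightarrow> f dvd g"
  by (metis act_dvd act_neg(2) neg_less)

lemma act_prime:
  fixes q :: "'a::field mpoly"
  assumes "a < n" "prime_elem q"
  shows "prime_elem (act a q)"
proof (rule prime_elemI)
  show "act a q \<noteq> 0" using assms by auto
  show "\<not> act a q dvd 1" using assms act_dvd_iff[of a q 1] by (auto simp: prime_elem_def)
  fix f g assume "act a q dvd f * g"
  then have "q dvd act (neg a) f * act (neg a) g"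
    using assms act_dvd[of "neg a" "act a q" "f * g"] by (simp add: neg_less act_neg act_mult)
  then have "q dvd act (neg a) f \<or> q dvd act (neg a) g" using assms by (simp add: prime_elem_dvd_mult_iff)
  then show "act a q dvd f \<or> act a q dvd g"
    using assms act_dvd[of a q] by (metis act_neg(1))
qed

text \<open>A monomial is read as a multigraph on the index set, \<open>x\<^sub>i\<^sub>,\<^sub>h\<^sub>,\<^sub>k\<close> being an edge from \<open>h\<close> to \<open>k\<close>;
  \<open>bd\<close> is its boundary and \<open>wt\<close> counts edges by the group element \<open>k - h\<close>.\<close>

definition bd :: "(nat \<Rightarrow>\<^sub>0 nat) \<Rightarrow> nat \<Rightarrow> int" where
  "bd m x = (\<Sum>v\<in>Poly_Mapping.keys m. int (Poly_Mapping.lookup m v) * (of_bool (tgt v = x) - of_bool (src v = x)))"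

lemma bd_add: "bd (m + m') x = bd m x + bd m' x"
  unfolding bd_def
  by (rule sum_keys_add[of "\<lambda>v i. int i * (of_bool (tgt v = x) - of_bool (src v = x))"])
    (simp_all add: distrib_right)

lemma bd_mshift: "a < n \<Longrightarrow> x < n \<Longrightarrow> bd (mshift a m) (a +\<^sub>G x) = bd m x"
  unfolding bd_def
  by (subst sum_mshift[of a "\<lambda>v i. int i * (of_bool (tgt v = a +\<^sub>G x) - of_bool (src v = a +\<^sub>G x))"])
    (simp_all add: src_shift tgt_shift src_less tgt_less op_left_cancel)

lemma sum_of_bool: "t < n \<Longrightarrow> (\<Sum>x<n. c x * of_bool (t = x)) = (c t :: int)"
  by (simp add: of_bool_def if_distrib[of "(*) _"] cong: if_cong)

lemma sum_bd:
  fixes c :: "nat \<Rightarrow> int"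
  shows "(\<Sum>x<n. c x * bd m x) = (\<Sum>v\<in>Poly_Mapping.keys m. int (Poly_Mapping.lookup m v) * (c (tgt v) - c (src v)))"
proof -
  have "(\<Sum>x<n. c x * bd m x) = (\<Sum>v\<in>Poly_Mapping.keys m. \<Sum>x<n.
      int (Poly_Mapping.lookup m v) * (c x * of_bool (tgt v = x) - c x * of_bool (src v = x)))"
    unfolding bd_def sum_distrib_left by (subst sum.swap) (simp add: algebra_simps)
  also have "\<dots> = (\<Sum>v\<in>Poly_Mapping.keys m. int (Poly_Mapping.lookup m v) * (c (tgt v) - c (src v)))"
    by (simp add: sum_distrib_left[symmetric] sum_subtractf sum_of_bool src_less tgt_less)
  finally show ?thesis .
qed

section \<open>Weights and characters\<close>

definition type :: "nat \<Rightarrow> nat" where "type v = neg (src v) +\<^sub>G tgt v"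

definition wt :: "(nat \<Rightarrow>\<^sub>0 nat) \<Rightarrow> (nat \<Rightarrow>\<^sub>0 nat)" where
  "wt m = (\<Sum>v\<in>Poly_Mapping.keys m. Poly_Mapping.single (type v) (Poly_Mapping.lookup m v))"

lemma wt_add: "wt (m + m') = wt m + wt m'"
  unfolding wt_def by (rule sum_keys_add) (simp_all add: single_add)

lemma type_shift: "a < n \<Longrightarrow> type (shift a v) = type v"
proof -
  assume a: "a < n"
  have s: "src v < n" "tgt v < n" by (simp_all add: src_less tgt_less)
  have "(a +\<^sub>G src v) +\<^sub>G type v = a +\<^sub>G tgt v"
    unfolding type_def using a s by (simp add: op_assoc op_less neg_less op_neg_cancel)
  then have "neg (a +\<^sub>G src v) +\<^sub>G (a +\<^sub>G tgt v) = type v"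
    using a s neg_op_cancel[of "a +\<^sub>G src v" "type v"] by (simp add: op_less type_def neg_less)
  then show ?thesis by (simp add: type_def[of "shift a v"] src_shift tgt_shift a)
qed

lemma wt_mshift: "a < n \<Longrightarrow> wt (mshift a m) = wt m"
  unfolding wt_def
  by (subst sum_mshift[of a "\<lambda>v i. Poly_Mapping.single (type v) i"]) (simp_all add: type_shift)

text \<open>A character with values in the integers modulo \<open>N\<close>, represented by integer
  lifts so that it can be summed against boundaries.\<close>

definition is_char :: "(nat \<Rightarrow> int) \<Rightarrow> int \<Rightarrow> bool" where
  "is_char c N \<longleftrightarrow> (\<forall>x<n. \<forall>y<n. [c (x +\<^sub>G y) = c x + c y] (mod N))"

text \<open>For an edge of type \<open>t\<close> the difference of \<open>c\<close> at its end
  points is congruent to \<open>c t\<close>. Modulo \<open>N\<close>, the pairing of a boundary with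
  a character thus depends on the weight alone.\<close>

lemma sum_bd_wt:
  assumes "is_char c N"
  shows "[(\<Sum>x<n. c x * bd m x) = (\<Sum>t\<in>Poly_Mapping.keys (wt m). int (Poly_Mapping.lookup (wt m) t) * c t)] (mod N)"
proof -
  let ?L = "\<lambda>w. \<Sum>t\<in>Poly_Mapping.keys w. int (Poly_Mapping.lookup w t) * c t"
  have L0: "?L 0 = 0" by simp
  have Ladd: "?L (u + w) = ?L u + ?L w" for u w
    by (rule sum_keys_add[of "\<lambda>t i. int i * c t"]) (simp_all add: distrib_right)
  have Lsum: "?L (sum h I) = (\<Sum>i\<in>I. ?L (h i))" for h :: "nat \<Rightarrow> nat \<Rightarrow>\<^sub>0 nat" and I
  proof (induction I rule: infinite_finite_induct)
    case (insert x F)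
    then show ?case by (simp only: sum.insert Ladd simp_thms)
  qed simp_all
  have "?L (wt m) = (\<Sum>v\<in>Poly_Mapping.keys m. int (Poly_Mapping.lookup m v) * c (type v))"
    unfolding wt_def Lsum by (rule sum.cong) auto
  moreover have "[(\<Sum>v\<in>Poly_Mapping.keys m. int (Poly_Mapping.lookup m v) * (c (tgt v) - c (src v))) =
    (\<Sum>v\<in>Poly_Mapping.keys m. int (Poly_Mapping.lookup m v) * c (type v))] (mod N)"
  proof (rule cong_sum)
    fix v
    have "[c (src v +\<^sub>G type v) = c (src v) + c (type v)] (mod N)"
      using assms by (auto simp: is_char_def src_less tgt_less type_def op_less neg_less)
    then have "[c (tgt v) = c (src v) + c (type v)] (mod N)"
      by (simp add: type_def op_neg_cancel src_less tgt_less)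
    then have "[c (tgt v) - c (src v) = c (type v)] (mod N)"
      using cong_diff[of "c (tgt v)" "c (src v) + c (type v)" N "c (src v)" "c (src v)"] by simp
    then show "[int (Poly_Mapping.lookup m v) * (c (tgt v) - c (src v)) =
      int (Poly_Mapping.lookup m v) * c (type v)] (mod N)" by (rule cong_mult[OF cong_refl])
  qed
  ultimately show ?thesis by (simp add: sum_bd)
qed

definition from_to :: "nat \<Rightarrow> nat \<Rightarrow> nat \<Rightarrow> int" where
  "from_to h k x = of_bool (k = x) - of_bool (h = x)"

lemma sum_from_to: "h < n \<Longrightarrow> k < n \<Longrightarrow> (\<Sum>x<n. c x * from_to h k x) = c k - (c h :: int)"
  by (simp add: from_to_def right_diff_distrib sum_subtractf sum_of_bool)

section \<open>Boundaries of homogeneous polynomials\<close>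

definition homogeneous :: "'a::zero mpoly \<Rightarrow> bool" where
  "homogeneous f \<longleftrightarrow> (\<forall>m\<in>Poly_Mapping.keys f. \<forall>m'\<in>Poly_Mapping.keys f. bd m = bd m')"

text \<open>The boundary of an arbitrarily chosen monomial; for a nonzero homogeneous polynomial
  \<open>bdp_eq\<close> shows that the choice is immaterial.\<close>

definition bdp :: "'a::zero mpoly \<Rightarrow> nat \<Rightarrow> int" where
  "bdp f = bd (SOME m. m \<in> Poly_Mapping.keys f)"

lemma bdp_eq: "homogeneous f \<Longrightarrow> m \<in> Poly_Mapping.keys f \<Longrightarrow> bdp f = bd m"
  unfolding bdp_def homogeneous_def by (metis someI)

lemma homogeneous_factors:
  fixes f g :: "'a::idom mpoly"
  assumes "homogeneous (f * g)" "f * g \<noteq> 0"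
  shows "homogeneous f"
  unfolding homogeneous_def
proof (intro ballI ext)
  fix m m' x assume "m \<in> Poly_Mapping.keys f" "m' \<in> Poly_Mapping.keys f"
  then show "bd m x = bd m' x"
    using homogeneous_factor[of "\<lambda>m. bd m x", OF bd_add assms(2)] assms(1)
    unfolding homogeneous_def by metis
qed

lemma bd_outside: "x \<ge> n \<Longrightarrow> bd m x = 0"
  unfolding bd_def
proof (rule sum.neutral, rule ballI)
  fix v assume "n \<le> x"
  then have "tgt v \<noteq> x" "src v \<noteq> x" using tgt_less[of v] src_less[of v] by auto
  then show "int (Poly_Mapping.lookup m v) * (of_bool (tgt v = x) - of_bool (src v = x)) = 0" by simp
qed

lemma homogeneous_act:
  assumes "a < n" "homogeneous f"
  shows "homogeneous (act a f)"
  unfolding homogeneous_def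
proof (intro ballI ext)
  fix m m' y assume "m \<in> Poly_Mapping.keys (act a f)" "m' \<in> Poly_Mapping.keys (act a f)"
  then obtain k k' where k: "k \<in> Poly_Mapping.keys f" "m = mshift a k" "k' \<in> Poly_Mapping.keys f" "m' = mshift a k'"
    using assms by (auto simp: keys_act)
  show "bd m y = bd m' y"
  proof (cases "y < n")
    case True
    have "bd (mshift a l) y = bd l (neg a +\<^sub>G y)" for l
      using bd_mshift[of a "neg a +\<^sub>G y" l] True assms by (simp add: op_less neg_less op_neg_cancel)
    moreover have "bd k = bd k'" using k assms unfolding homogeneous_def by blast
    ultimately show ?thesis using k by simp
  qed (simp add: bd_outside)
qed

text \<open>An edge contributes \<open>1\<close> at its target and \<open>-1\<close> at its
  source.\<close>

lemma sum_bdp: "(\<Sum>x<n. bdp f x) = 0"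
proof -
  have "(\<Sum>x<n. bd m x) = 0" for m
    using sum_bd[of "\<lambda>_. 1" m] by (simp only: mult_1 diff_self mult_zero_right sum.neutral_const)
  then show ?thesis by (simp only: bdp_def)
qed

lemma bdp_mult:
  fixes f g :: "'a::idom mpoly"
  assumes "homogeneous (f * g)" "f * g \<noteq> 0"
  shows "bdp (f * g) x = bdp f x + bdp g x"
proof -
  have "homogeneous f" "homogeneous g"
    using assms homogeneous_factors[of f g] homogeneous_factors[of g f] by (simp_all add: mult.commute)
  moreover obtain a b where "a \<in> Poly_Mapping.keys f" "b \<in> Poly_Mapping.keys g" "a + b \<in> Poly_Mapping.keys (f * g)"
    using keys_times_not_empty assms by (metis mult_zero_left mult_zero_right)
  ultimately show ?thesis using assms bdp_eq by (metis bd_add)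
qed

lemma bdp_act:
  assumes "a < n" "x < n" "homogeneous f" "f \<noteq> 0"
  shows "bdp (act a f) (a +\<^sub>G x) = bdp f x"
proof -
  obtain m where m: "m \<in> Poly_Mapping.keys f" using assms by (metis all_not_in_conv keys_eq_empty)
  then have "mshift a m \<in> Poly_Mapping.keys (act a f)" using assms by (simp add: keys_act)
  then show ?thesis using assms m bdp_eq bd_mshift homogeneous_act by metis
qed

text \<open>The two polynomials differ by a unit, which is constant and so has boundary
  zero.\<close>

lemma bdp_associated:
  fixes f g :: "'a::idom mpoly"
  assumes "homogeneous f" "f \<noteq> 0" "f dvd g" "g dvd f"
  shows "bdp g x = bdp f x"
proof -
  obtain u where u: "f = g * u" using assms by auto
  obtain w where w: "g = f * w" using assms by auto
  have "f * (w * u) = f * 1" using u w by (metis mult.assoc mult.right_neutral)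
  then have "w * u = 1" using assms(2) mult_left_cancel by blast
  then have "u dvd 1" by (metis dvd_triv_right)
  then have k: "m = 0" if "m \<in> Poly_Mapping.keys u" for m using unit_keys that by blast
  have "u \<noteq> 0" using u assms by auto
  then obtain m where m: "m \<in> Poly_Mapping.keys u" by (metis all_not_in_conv keys_eq_empty)
  have "homogeneous u" using k by (metis homogeneous_def)
  then have "bdp u x = 0" using bdp_eq[OF _ m] k[OF m] by (simp add: bd_def)
  then show ?thesis using bdp_mult[of g u x] assms u by simp
qed

text \<open>The nondegeneracy of the twisted construction, where unique factorization enters: a prime factor
  \<open>q\<close> of \<open>f\<close> is either stable under \<open>h\<close> or under \<open>g +\<^sub>G h\<close> up to units, or it comes with a second factor
  from the orbit of \<open>q\<close>; each time the contribution to the sum is even.\<close>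

lemma even_boundary:
  fixes f :: "'a::field mpoly" and c :: "nat \<Rightarrow> int"
  assumes gh: "g < n" "h < n" "g +\<^sub>G g = 0" "h +\<^sub>G h = 0" "h \<noteq> 0"
    and cg: "\<And>x. x < n \<Longrightarrow> c (g +\<^sub>G x) = 1 - c x" and ch: "\<And>x. x < n \<Longrightarrow> c (h +\<^sub>G x) = c x"
    and "homogeneous f" "f \<noteq> 0" "f * act g f dvd act h (f * act g f)"
  shows "even (\<Sum>x<n. c x * bdp f x)"
  using assms(8-)
proof (induction "tdeg f" arbitrary: f rule: less_induct)
  case less
  define S where "S f = (\<Sum>x<n. c x * bdp f x)" for f :: "'a mpoly"
  have S_mult: "S (a * b) = S a + S b" if "homogeneous (a * b)" "a * b \<noteq> 0" for a b
    using that by (simp add: S_def bdp_mult distrib_left sum.distrib)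
  have S_h: "S (act h a) = S a" if "homogeneous a" "a \<noteq> 0" for a
  proof -
    have "S (act h a) = (\<Sum>x<n. c (h +\<^sub>G x) * bdp (act h a) (h +\<^sub>G x))"
      unfolding S_def by (rule sum_op[OF gh(2), symmetric])
    also have "\<dots> = S a" unfolding S_def using that gh by (intro sum.cong) (auto simp: ch bdp_act homogeneous_act)
    finally show ?thesis .
  qed
  \<comment> \<open>Translation by \<open>g\<close> replaces \<open>c\<close> by
    \<open>1 - c\<close>, and the term from \<open>1\<close> drops out because the total boundary is
    zero.\<close>
  have S_g: "S (act g a) = - S a" if "homogeneous a" "a \<noteq> 0" for a
  proof -
    have "S (act g a) = (\<Sum>x<n. c (g +\<^sub>G x) * bdp (act g a) (g +\<^sub>G x))"
      unfolding S_def by (rule sum_op[OF gh(1), symmetric])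
    also have "\<dots> = (\<Sum>x<n. bdp a x - c x * bdp a x)"
      using that gh by (intro sum.cong) (auto simp: cg bdp_act homogeneous_act left_diff_distrib)
    also have "\<dots> = - S a" by (simp add: sum_subtractf S_def sum_bdp that)
    finally show ?thesis .
  qed
  have S_assoc: "S b = S a" if "homogeneous a" "a \<noteq> 0" "a dvd b" "b dvd a" for a b
    unfolding S_def by (intro sum.cong refl) (simp add: bdp_associated[OF that])
  have comm: "act g (act h a) = act h (act g a)" for a :: "'a mpoly"
    using gh by (simp add: act_act op_comm)
  have gg: "act g (act g a) = a" and hh: "act h (act h a) = a" for a :: "'a mpoly"
    using gh by (simp_all add: act_act act_0)
  show ?case
  proof (cases "f dvd 1")
    case True
    obtain m where m: "m \<in> Poly_Mapping.keys f" using less by (metis all_not_in_conv keys_eq_empty)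
    then have "bdp f = bd 0" using bdp_eq[OF less(2) m] unit_keys[OF True m] by simp
    then show ?thesis by (simp add: bd_def)
  next
    case False
    then obtain q where q: "prime_elem q" "q dvd f" using mpoly_prime_factor less(3) by blast
    then obtain f1 where f1: "f = q * f1" by auto
    have hq: "homogeneous q" "q \<noteq> 0" using less f1 homogeneous_factors by auto
    \<comment> \<open>The piece \<open>Q * act g Q\<close> is stable under \<open>h\<close> up to a
      unit and can be cancelled from the hypothesis, which then holds for the remaining factor
      \<open>f'\<close> of smaller degree.\<close>
    have split: ?thesis if Q: "f = Q * f'" "q dvd Q" "act h (Q * act g Q) dvd Q * act g Q" "even (S Q)" for Q f'
    proof -
      let ?E = "Q * act g Q" and ?F = "f' * act g f'"
      have ne: "Q \<noteq> 0" "f' \<noteq> 0" using Q less by auto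
      have "\<not> Q dvd 1" using Q q by (metis dvd_trans not_prime_elem_one prime_elem_def)
      then have "tdeg Q > 0" using ne tdeg_pos by blast
      then have d: "tdeg f' < tdeg f" unfolding Q(1) tdeg_mult[OF ne] by simp
      have hf': "homogeneous f'" using less(2,3) Q homogeneous_factors[of f' Q] by (simp add: mult.commute)
      have "f * act g f = ?E * ?F" using Q gh by (simp add: act_mult mult_ac)
      then have "?E * ?F dvd act h ?E * act h ?F" using less(4) gh by (simp add: act_mult)
      also have "\<dots> dvd ?E * act h ?F" using Q by (intro mult_dvd_mono) auto
      finally obtain y where "?E * act h ?F = ?E * ?F * y" by (rule dvdE)
      then have "?E * act h ?F = ?E * (?F * y)" by (simp only: mult.assoc)
      moreover have "?E \<noteq> 0" using ne gh by simp
      ultimately have "act h ?F = ?F * y" using mult_left_cancel by blast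
      then have "?F dvd act h ?F" by (rule dvdI)
      then have "even (S f')" using less(1)[OF d hf' ne(2)] by (simp add: S_def)
      then show ?thesis using S_mult[of Q f'] Q less(2,3) by (simp add: S_def)
    qed
    consider "act h q dvd q" | "act h (act g q) dvd q" | "\<not> act h q dvd q" "\<not> act h (act g q) dvd q" by blast
    then show ?thesis
    proof cases
      case 1
      then have 2: "q dvd act h q" using act_dvd[OF gh(2) 1] hh by simp
      \<comment> \<open>Up to a unit \<open>q\<close> is fixed by \<open>h\<close>, so its boundary
        is invariant under translation by \<open>h\<close>. This translation has no fixed points,
        and the terms pair off.\<close>
      have "even (S q)" unfolding S_def
      proof (rule even_sum_involution[where \<sigma> = "\<lambda>x. h +\<^sub>G x"])
        fix x assume "x \<in> {..<n}"
        then have x: "x < n" by simp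
        have "h +\<^sub>G x \<noteq> x" using gh x by (metis op_comm op_left_cancel op_zero_right n_pos)
        moreover have "h +\<^sub>G (h +\<^sub>G x) = x" using gh x by (metis op_assoc op_zero)
        moreover have "bdp q (h +\<^sub>G x) = bdp q x"
          using bdp_associated[OF hq 2 1] bdp_act[OF gh(2) x hq] by simp
        ultimately show "h +\<^sub>G x \<in> {..<n} \<and> h +\<^sub>G (h +\<^sub>G x) = x \<and> h +\<^sub>G x \<noteq> x \<and>
            c (h +\<^sub>G x) * bdp q (h +\<^sub>G x) = c x * bdp q x"
          using gh x op_less ch by simp
      qed simp
      moreover have "act h (q * act g q) dvd q * act g q"
        using 1 act_dvd[OF gh(1) 1] by (simp add: act_mult gh comm mult_dvd_mono)
      ultimately show ?thesis using split[OF f1] by simp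
    next
      case 2
      have 1: "q dvd act h (act g q)"
        using act_dvd[OF gh(1) act_dvd[OF gh(2) 2]] by (simp add: comm hh gg)
      \<comment> \<open>The boundary sum equals its own negative, so it is zero.\<close>
      have "S q = S (act h (act g q))" using S_assoc[OF hq 1 2] by simp
      also have "\<dots> = - S q" using hq gh by (simp add: S_h S_g homogeneous_act)
      finally have "even (S q)" by simp
      moreover have "act h q dvd act g q" using act_dvd[OF gh(1) 2] by (simp add: comm gg)
      then have "act h (q * act g q) dvd q * act g q"
        using 2 mult_dvd_mono[of "act h q" "act g q" "act h (act g q)" q] by (simp add: act_mult gh mult.commute)
      ultimately show ?thesis using split[OF f1] by simp
    next
      case 3
      have "q dvd act h (f * act g f)" using q less(4) by (meson dvd_trans dvd_mult2)
      then have "act h q dvd f * act g f" using act_dvd[OF gh(2)] hh by metis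
      then have "act h q dvd f \<or> act h q dvd act g f"
        using act_prime[OF gh(2) q(1)] by (simp add: prime_elem_dvd_mult_iff)
      then have "act h q dvd f \<or> act h (act g q) dvd f"
        using act_dvd[OF gh(1), of "act h q" "act g f"] by (auto simp: comm gg)
      \<comment> \<open>The second factor \<open>r\<close> from the orbit of \<open>q\<close> is not
        divisible into \<open>q\<close>, so \<open>q * r\<close> divides \<open>f\<close>. The
        boundary sums of \<open>q\<close> and \<open>r\<close> agree up to sign, which makes their
        total even.\<close>
      then obtain r where r: "r = act h q \<or> r = act h (act g q)" "r dvd f" by blast
      have "prime_elem r" using r act_prime gh q by auto
      moreover have "\<not> r dvd q" using r 3 by auto
      ultimately have "r dvd f1" using r f1 by (simp add: prime_elem_dvd_mult_iff)
      then obtain f' where "f1 = r * f'" by auto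
      then have f': "f = (q * r) * f'" using f1 by (simp add: mult.assoc)
      have "act h ((q * r) * act g (q * r)) dvd (q * r) * act g (q * r)"
        using r(1) by (auto simp: act_mult gh comm hh gg mult_ac)
      moreover have "S r = S q \<or> S r = - S q"
        using r(1) hq gh by (auto simp: S_h S_g homogeneous_act)
      then have "even (S (q * r))"
        using S_mult[of q r] homogeneous_factors[of "q * r" f'] less(2,3) f' by auto
      ultimately show ?thesis using split[OF f'] by simp
    qed
  qed
qed

end

subsection \<open>Equivariant matrices\<close>

lemma mpoly_double_eq_0:
  fixes f :: "'a::idom mpoly"
  assumes "(2::'a) \<noteq> 0" "f + f = 0"
  shows "f = 0"
proof (rule poly_mapping_eqI)
  fix m
  have "2 * Poly_Mapping.lookup f m = Poly_Mapping.lookup (f + f) m" by (simp only: lookup_add mult_2)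
  then show "Poly_Mapping.lookup f m = Poly_Mapping.lookup 0 m" using assms by simp
qed

lemma mpoly_char_2:
  fixes f :: "'a::idom mpoly"
  assumes "(2::'a) = 0"
  shows "f + f = 0" "- f = f"
proof -
  show "f + f = 0"
  proof (rule poly_mapping_eqI)
    fix m
    have "Poly_Mapping.lookup (f + f) m = 2 * Poly_Mapping.lookup f m" by (simp only: lookup_add mult_2)
    then show "Poly_Mapping.lookup (f + f) m = Poly_Mapping.lookup 0 m" using assms by simp
  qed
  then show "- f = f" by (simp add: neg_eq_iff_add_eq_0)
qed

context abelian_index
begin

text \<open>Matrices are functions on all of \<open>nat\<close>, and products vanish outside the
  index range; identities such as associativity then hold as equalities of functions.\<close>

definition mm :: "(nat \<Rightarrow> nat \<Rightarrow> 'r::comm_ring_1) \<Rightarrow> (nat \<Rightarrow> nat \<Rightarrow> 'r) \<Rightarrow> nat \<Rightarrow> nat \<Rightarrow> 'r" where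
  "mm A B h k = (if h < n \<and> k < n then \<Sum>l<n. A h l * B l k else 0)"

definition scalm :: "'r::comm_ring_1 \<Rightarrow> nat \<Rightarrow> nat \<Rightarrow> 'r" where
  "scalm c h k = (if h = k \<and> h < n then c else 0)"

lemma mm_assoc: "mm (mm A B) C = mm A (mm B C)"
proof (intro ext)
  fix h k
  have "(\<Sum>l<n. (\<Sum>i<n. A h i * B i l) * C l k) = (\<Sum>i<n. A h i * (\<Sum>l<n. B i l * C l k))"
    unfolding sum_distrib_left sum_distrib_right mult.assoc by (rule sum.swap)
  then show "mm (mm A B) C h k = mm A (mm B C) h k"
    by (simp add: mm_def cong: sum.cong_simp)
qed

lemma mm_diff_left: "mm (\<lambda>h k. A h k - B h k) C = (\<lambda>h k. mm A C h k - mm B C h k)"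
  by (intro ext) (simp add: mm_def left_diff_distrib sum_subtractf)

lemma mm_diff_right: "mm C (\<lambda>h k. A h k - B h k) = (\<lambda>h k. mm C A h k - mm C B h k)"
  by (intro ext) (simp add: mm_def right_diff_distrib sum_subtractf)

lemma mm_cong: "(\<And>h k. h < n \<Longrightarrow> k < n \<Longrightarrow> A h k = A' h k) \<Longrightarrow> (\<And>h k. h < n \<Longrightarrow> k < n \<Longrightarrow> B h k = B' h k)
  \<Longrightarrow> mm A B = mm A' B'"
  by (intro ext) (auto simp: mm_def)

lemma mm_scalm_left: "h < n \<Longrightarrow> k < n \<Longrightarrow> mm (scalm c) A h k = c * A h k"
  by (simp add: mm_def scalm_def if_distrib[of "\<lambda>x. x * _"] cong: if_cong)

lemma mm_scalm_right: "h < n \<Longrightarrow> k < n \<Longrightarrow> mm A (scalm c) h k = c * A h k"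
  by (simp add: mm_def scalm_def if_distrib[of "\<lambda>x. _ * x"] mult.commute cong: if_cong conj_cong)

lemma mm_scalm_comm: "mm (scalm c) A = mm A (scalm c)"
proof (intro ext)
  fix h k
  show "mm (scalm c) A h k = mm A (scalm c) h k"
    by (cases "h < n \<and> k < n") (auto simp: mm_scalm_left mm_scalm_right, auto simp: mm_def)
qed

text \<open>The scalar matrix commutes with \<open>A\<close>, so the mixed terms add up to twice one
  matrix and vanish in characteristic 2.\<close>

lemma mm_square_diff_scalm:
  fixes A :: "nat \<Rightarrow> nat \<Rightarrow> 'a::idom mpoly"
  assumes ch: "(2::'a) = 0"
  shows "mm (\<lambda>h k. A h k - scalm b h k) (\<lambda>h k. A h k - scalm b h k) = (\<lambda>h k. mm A A h k - scalm (b * b) h k)"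
proof (intro ext)
  fix h k
  show "mm (\<lambda>h k. A h k - scalm b h k) (\<lambda>h k. A h k - scalm b h k) h k = mm A A h k - scalm (b * b) h k"
  proof (cases "h < n \<and> k < n")
    case True
    then have "mm (\<lambda>h k. A h k - scalm b h k) (\<lambda>h k. A h k - scalm b h k) h k =
      mm A A h k - (b * A h k + b * A h k) + b * scalm b h k"
      unfolding mm_diff_left mm_diff_right by (simp add: mm_scalm_left mm_scalm_right)
    also have "\<dots> = mm A A h k - (- (scalm (b * b) h k))"
      unfolding mpoly_char_2(1)[OF ch] by (simp add: scalm_def)
    finally show ?thesis unfolding mpoly_char_2(2)[OF ch] .
  qed (auto simp: mm_def scalm_def)
qed

text \<open>The element \<open>f u_g\<close> of the crossed product: row \<open>0\<close> carries
  \<open>f\<close> in column \<open>g\<close>, and the other rows are translates of it.\<close>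

definition mono_mat :: "nat \<Rightarrow> 'a::comm_ring_1 mpoly \<Rightarrow> nat \<Rightarrow> nat \<Rightarrow> 'a mpoly" where
  "mono_mat g f h k = (if h < n \<and> k = h +\<^sub>G g then act h f else 0)"

text \<open>The crossed product rule: moving \<open>u_g\<close> past \<open>f'\<close> replaces
  \<open>f'\<close> by its translate under \<open>g\<close>.\<close>

lemma mm_mono:
  assumes "g < n" "g' < n"
  shows "mm (mono_mat g f) (mono_mat g' f') = mono_mat (g +\<^sub>G g') (f * act g f')"
proof (intro ext)
  fix h k
  show "mm (mono_mat g f) (mono_mat g' f') h k = mono_mat (g +\<^sub>G g') (f * act g f') h k"
  proof (cases "h < n \<and> k < n")
    case True
    have "mm (mono_mat g f) (mono_mat g' f') h k = (\<Sum>l<n. mono_mat g f h l * mono_mat g' f' l k)"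
      using True by (simp add: mm_def)
    also have "\<dots> = (\<Sum>l<n. if l = h +\<^sub>G g then act h f * mono_mat g' f' l k else 0)"
      by (rule sum.cong) (use True in \<open>auto simp: mono_mat_def[of g]\<close>)
    also have "\<dots> = act h f * mono_mat g' f' (h +\<^sub>G g) k"
      unfolding sum.delta[OF finite_lessThan] using True assms by (simp add: op_less)
    also have "\<dots> = mono_mat (g +\<^sub>G g') (f * act g f') h k"
      using True assms by (auto simp: mono_mat_def op_less op_assoc act_mult act_act)
    finally show ?thesis .
  next
    case False
    then show ?thesis using assms by (auto simp: mm_def mono_mat_def op_less)
  qed
qed

text \<open>Two properties of a generic matrix that persist under sums and products. For products,
  the boundaries from \<open>h\<close> to \<open>l\<close> and from \<open>l\<close> to
  \<open>k\<close> add up to the one from \<open>h\<close> to \<open>k\<close>.\<close>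

definition twisted :: "(nat \<Rightarrow> nat \<Rightarrow> 'a::comm_ring_1 mpoly) \<Rightarrow> bool" where
  "twisted M \<longleftrightarrow> (\<forall>h<n. \<forall>k<n. (\<forall>a<n. act a (M h k) = M (a +\<^sub>G h) (a +\<^sub>G k)) \<and>
     (\<forall>m\<in>Poly_Mapping.keys (M h k). bd m = from_to h k))"

lemma twistedD:
  assumes "twisted M" "h < n" "k < n"
  shows "a < n \<Longrightarrow> act a (M h k) = M (a +\<^sub>G h) (a +\<^sub>G k)"
    and "m \<in> Poly_Mapping.keys (M h k) \<Longrightarrow> bd m = from_to h k"
  using assms by (auto simp: twisted_def)

lemma twisted_mm:
  assumes "twisted A" "twisted B"
  shows "twisted (mm A B)"
  unfolding twisted_def
proof (intro allI impI conjI ballI)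
  fix h k a assume hk: "h < n" "k < n" and a: "a < n"
  have "act a (mm A B h k) = (\<Sum>l<n. A (a +\<^sub>G h) (a +\<^sub>G l) * B (a +\<^sub>G l) (a +\<^sub>G k))"
    using hk a assms by (auto simp: mm_def act_sum act_mult twistedD intro!: sum.cong)
  also have "\<dots> = (\<Sum>l<n. A (a +\<^sub>G h) l * B l (a +\<^sub>G k))"
    by (rule sum_op[OF a])
  finally show "act a (mm A B h k) = mm A B (a +\<^sub>G h) (a +\<^sub>G k)" using hk a by (simp add: mm_def op_less)
next
  fix h k m assume hk: "h < n" "k < n" and m: "m \<in> Poly_Mapping.keys (mm A B h k)"
  then obtain l where l: "l < n" "m \<in> Poly_Mapping.keys (A h l * B l k)"
    using keys_sum[of "\<lambda>l. A h l * B l k" "{..<n}"] by (auto simp: mm_def)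
  then obtain a b where ab: "a \<in> Poly_Mapping.keys (A h l)" "b \<in> Poly_Mapping.keys (B l k)" "m = a + b"
    using keys_mult[of "A h l" "B l k"] by blast
  show "bd m = from_to h k"
  proof
    fix x
    have "bd m x = from_to h l x + from_to l k x"
      using ab l hk assms by (simp add: bd_add twistedD)
    then show "bd m x = from_to h k x" by (simp add: from_to_def)
  qed
qed

lemma twisted_diff:
  assumes "twisted A" "twisted B"
  shows "twisted (\<lambda>h k. A h k - B h k)"
  unfolding twisted_def
proof (intro allI impI conjI ballI)
  fix h k m assume hk: "h < n" "k < n" and m: "m \<in> Poly_Mapping.keys (A h k - B h k)"
  then have "m \<in> Poly_Mapping.keys (A h k) \<or> m \<in> Poly_Mapping.keys (B h k)"
    by (auto simp: in_keys_iff lookup_minus)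
  then show "bd m = from_to h k" using assms hk twistedD by blast
qed (use assms in \<open>auto simp: act_diff twistedD\<close>)

text \<open>Exactly the condition on \<open>c\<close> under which the scalar matrix
  \<open>scalm c\<close> is twisted.\<close>

definition invariant :: "'a::comm_ring_1 mpoly \<Rightarrow> bool" where
  "invariant c \<longleftrightarrow> (\<forall>a<n. act a c = c) \<and> (\<forall>m\<in>Poly_Mapping.keys c. bd m = (\<lambda>_. 0))"

lemma from_to_refl: "from_to h h = (\<lambda>_. 0)"
  by (auto simp: from_to_def)

lemma twisted_scalm: "invariant c \<Longrightarrow> twisted (scalm c)"
  by (auto simp: twisted_def invariant_def scalm_def from_to_refl op_less op_left_cancel)

lemma invariant_of_twisted_scalm:
  assumes "twisted (scalm c)"
  shows "invariant c"
  using twistedD[OF assms n_pos n_pos] by (auto simp: invariant_def scalm_def n_pos from_to_refl op_less op_zero_right)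

lemma invariant_power:
  fixes c :: "'a::idom mpoly"
  assumes "invariant c"
  shows "invariant (c ^ k)"
proof (induction k)
  case 0
  then show ?case by (auto simp: invariant_def bd_def fun_eq_iff)
next
  case (Suc k)
  have "bd m = (\<lambda>_. 0)" if m: "m \<in> Poly_Mapping.keys (c * c ^ k)" for m
  proof -
    obtain a b where "a \<in> Poly_Mapping.keys c" "b \<in> Poly_Mapping.keys (c ^ k)" "m = a + b"
      using m keys_mult[of c "c ^ k"] by blast
    then show ?thesis using assms Suc by (auto simp: invariant_def bd_add fun_eq_iff)
  qed
  then show ?case using assms Suc by (auto simp: invariant_def act_mult)
qed

subsection \<open>Leading parts of twisted matrices\<close>

text \<open>Weights are finitely supported functions with a linear order compatible with addition,
  so a nonzero matrix has a single top weight and parts of top weight multiply.\<close>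

definition top_part :: "(nat \<Rightarrow>\<^sub>0 nat) \<Rightarrow> (nat \<Rightarrow> nat \<Rightarrow> 'a::comm_ring_1 mpoly) \<Rightarrow> nat \<Rightarrow> nat \<Rightarrow> 'a mpoly" where
  "top_part w M h k = restrict_keys (\<lambda>m. wt m = w) (M h k)"

definition wt_le :: "(nat \<Rightarrow> nat \<Rightarrow> 'a::comm_ring_1 mpoly) \<Rightarrow> (nat \<Rightarrow>\<^sub>0 nat) \<Rightarrow> bool" where
  "wt_le M w \<longleftrightarrow> (\<forall>h<n. \<forall>k<n. \<forall>m\<in>Poly_Mapping.keys (M h k). wt m \<le> w)"

definition wts :: "(nat \<Rightarrow> nat \<Rightarrow> 'a::comm_ring_1 mpoly) \<Rightarrow> (nat \<Rightarrow>\<^sub>0 nat) set" where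
  "wts M = (\<Union>h<n. \<Union>k<n. wt ` Poly_Mapping.keys (M h k))"

lemma finite_wts: "finite (wts M)"
  by (auto simp: wts_def)

lemma top_exists:
  assumes "h < n" "k < n" "M h k \<noteq> 0"
  obtains w h' k' where "wt_le M w" "w \<in> wts M" "h' < n" "k' < n" "top_part w M h' k' \<noteq> 0"
proof -
  have "Poly_Mapping.keys (M h k) \<noteq> {}" using assms by simp
  then have ne: "wts M \<noteq> {}" using assms by (auto simp: wts_def)
  define w where "w = Max (wts M)"
  have w: "w \<in> wts M" unfolding w_def using ne finite_wts by (rule_tac Max_in)
  then obtain h' k' m where m: "h' < n" "k' < n" "m \<in> Poly_Mapping.keys (M h' k')" "w = wt m"
    by (auto simp: wts_def)
  have "wt_le M w" unfolding wt_le_def w_def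
    by (intro allI impI ballI Max_ge finite_wts) (auto simp: wts_def)
  moreover have "top_part w M h' k' \<noteq> 0"
    unfolding top_part_def using m by (intro restrict_keys_nonzero[of m]) auto
  ultimately show ?thesis using that w m by blast
qed

lemma wt_le_mm:
  assumes "wt_le A u" "wt_le B v"
  shows "wt_le (mm A B) (u + v)"
  unfolding wt_le_def
proof (intro allI impI ballI)
  fix h k m assume hk: "h < n" "k < n" and m: "m \<in> Poly_Mapping.keys (mm A B h k)"
  then obtain l where l: "l < n" "m \<in> Poly_Mapping.keys (A h l * B l k)"
    using keys_sum[of "\<lambda>l. A h l * B l k" "{..<n}"] by (auto simp: mm_def)
  then obtain a b where "a \<in> Poly_Mapping.keys (A h l)" "b \<in> Poly_Mapping.keys (B l k)" "m = a + b"
    using keys_mult[of "A h l" "B l k"] by blast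
  then show "wt m \<le> u + v" using assms hk l by (auto simp: wt_le_def wt_add intro: add_mono)
qed

lemma top_part_mm:
  assumes "wt_le A u" "wt_le B v"
  shows "top_part (u + v) (mm A B) = mm (top_part u A) (top_part v B)"
proof (intro ext)
  fix h k
  show "top_part (u + v) (mm A B) h k = mm (top_part u A) (top_part v B) h k"
    using assms by (auto simp: top_part_def mm_def restrict_keys_sum wt_le_def intro!: sum.cong
        restrict_keys_top_mult wt_add)
qed

lemma act_restrict_keys:
  assumes "a < n"
  shows "act a (restrict_keys (\<lambda>m. wt m = w) f) = restrict_keys (\<lambda>m. wt m = w) (act a f)"
  by (rule poly_mapping_eqI) (use assms in \<open>simp add: lookup_act lookup_restrict_keys wt_mshift neg_less\<close>)

lemma twisted_top_part: "twisted M \<Longrightarrow> twisted (top_part w M)"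
  by (auto simp: twisted_def top_part_def act_restrict_keys keys_restrict_keys)

lemma top_part_scalm: "top_part w (scalm c) = scalm (restrict_keys (\<lambda>m. wt m = w) c)"
  by (intro ext) (simp add: top_part_def scalm_def)

end

text \<open>Characters modulo various \<open>N\<close> tell the elements apart; this is what lets a
  weight determine a group element.\<close>

locale separated_index = abelian_index +
  assumes separated: "x < n \<Longrightarrow> y < n \<Longrightarrow> x \<noteq> y \<Longrightarrow> \<exists>c N. is_char c N \<and> \<not> [c x = c y] (mod N)"
begin

text \<open>A character pairs with the boundary to \<open>c k - c h\<close>, and by
  \<open>sum_bd_wt\<close> equal weights give congruent values. As characters separate points, the
  steps coincide.\<close>

lemma wt_determines_step:
  assumes hk: "h < n" "k < n" "h' < n" "k' < n"
    and bd: "bd m = from_to h k" "bd m' = from_to h' k'" and wt: "wt m = wt m'"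
  shows "neg h +\<^sub>G k = neg h' +\<^sub>G k'"
proof (rule ccontr)
  assume "\<not> ?thesis"
  then obtain c N where c: "is_char c N" "\<not> [c (neg h +\<^sub>G k) = c (neg h' +\<^sub>G k')] (mod N)"
    using separated hk by (meson neg_less op_less)
  have step: "[c (neg i +\<^sub>G j) = c j - c i] (mod N)" if "i < n" "j < n" for i j
  proof -
    have "[c (i +\<^sub>G (neg i +\<^sub>G j)) = c i + c (neg i +\<^sub>G j)] (mod N)"
      using c(1) that by (simp add: is_char_def neg_less op_less)
    then have "[c j = c i + c (neg i +\<^sub>G j)] (mod N)" using that by (simp add: op_neg_cancel)
    then have "[c j - c i = c i + c (neg i +\<^sub>G j) - c i] (mod N)" by (rule cong_diff) simp
    then show ?thesis by (simp add: cong_sym)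
  qed
  have "[(\<Sum>x<n. c x * bd m x) = (\<Sum>x<n. c x * bd m' x)] (mod N)"
    using cong_trans[OF sum_bd_wt[OF c(1), of m] cong_sym[OF sum_bd_wt[OF c(1), of m', folded wt]]] .
  then have "[c k - c h = c k' - c h'] (mod N)" using hk by (simp add: bd sum_from_to)
  then show False using c(2) cong_trans[OF cong_trans[OF step[OF hk(1,2)]] cong_sym[OF step[OF hk(3,4)]]] by blast
qed

text \<open>All monomials of the leading part have the same weight, so its nonzero entries share one
  step \<open>g\<close>; equivariance recovers them from the entry \<open>f\<close> in row
  \<open>0\<close>.\<close>

lemma top_part_mono:
  fixes M :: "nat \<Rightarrow> nat \<Rightarrow> 'a::idom mpoly"
  assumes tw: "twisted M" and ne: "h < n" "k < n" "top_part w M h k \<noteq> 0"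
  obtains g f where "g < n" "f \<noteq> 0" "homogeneous f" "bdp f = from_to 0 g"
    "\<And>i j. i < n \<Longrightarrow> j < n \<Longrightarrow> top_part w M i j = mono_mat g f i j"
proof -
  define g where "g = neg h +\<^sub>G k"
  define f where "f = top_part w M 0 g"
  have g: "g < n" using ne by (simp add: g_def op_less neg_less)
  have tt: "twisted (top_part w M)" using tw by (rule twisted_top_part)
  have e: "top_part w M i (i +\<^sub>G g) = act i f" if "i < n" for i
    using twistedD(1)[OF tt n_pos g that] that by (simp add: f_def op_zero_right)
  have hk: "h +\<^sub>G g = k" using ne by (simp add: g_def op_neg_cancel)
  then have f0: "f \<noteq> 0" using e[OF ne(1)] ne by auto
  obtain m where m: "m \<in> Poly_Mapping.keys (top_part w M h k)" using ne by (metis all_not_in_conv keys_eq_empty)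
  have wt: "wt m' = w" if "m' \<in> Poly_Mapping.keys (top_part w M i j)" for m' i j
    using that by (simp add: top_part_def keys_restrict_keys)
  have "top_part w M i j = mono_mat g f i j" if ij: "i < n" "j < n" for i j
  proof (cases "j = i +\<^sub>G g")
    case True
    then show ?thesis using e ij by (simp add: mono_mat_def)
  next
    case False
    have "top_part w M i j = 0"
    proof (rule ccontr)
      assume "top_part w M i j \<noteq> 0"
      then obtain m' where m': "m' \<in> Poly_Mapping.keys (top_part w M i j)" by (metis all_not_in_conv keys_eq_empty)
      have "neg i +\<^sub>G j = neg h +\<^sub>G k"
        using wt_determines_step[OF ij ne(1,2) twistedD(2)[OF tt ij m'] twistedD(2)[OF tt ne(1,2) m]] wt m m'
        by simp
      then show False using False ij by (metis g_def op_neg_cancel)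
    qed
    then show ?thesis using False by (simp add: mono_mat_def)
  qed
  moreover have hom: "homogeneous f" using twistedD(2)[OF tt n_pos g] by (simp add: homogeneous_def f_def)
  moreover have "bdp f = from_to 0 g"
  proof -
    obtain m0 where m0: "m0 \<in> Poly_Mapping.keys f" using f0 by (metis all_not_in_conv keys_eq_empty)
    then show ?thesis using bdp_eq[OF hom m0] twistedD(2)[OF tt n_pos g] by (simp add: f_def)
  qed
  ultimately show ?thesis using that g f0 by blast
qed

end

text \<open>Properties of a cyclic group of odd order times an elementary abelian 2-group: no
  element of order 4, an odd multiple of each element killed by 2, and either a second involution
  with a function \<open>c\<close> as in \<open>even_boundary\<close>, or at most one
  involution.\<close>

locale index_group = separated_index +
  assumes double_torsion: "x < n \<Longrightarrow> x +\<^sub>G x +\<^sub>G (x +\<^sub>G x) = 0 \<Longrightarrow> x +\<^sub>G x = 0"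
    and odd_multiple: "x < n \<Longrightarrow> \<exists>k. odd k \<and> (let y = ((+\<^sub>G) x ^^ k) 0 in y +\<^sub>G y = 0)"
    and involutions: "(\<forall>g<n. g \<noteq> 0 \<longrightarrow> g +\<^sub>G g = 0 \<longrightarrow> (\<exists>h<n. \<exists>c :: nat \<Rightarrow> int. h +\<^sub>G h = 0 \<and> h \<noteq> 0 \<and>
        (\<forall>x<n. c (g +\<^sub>G x) = 1 - c x) \<and> (\<forall>x<n. c (h +\<^sub>G x) = c x))) \<or>
      (\<forall>g<n. \<forall>h<n. g \<noteq> 0 \<longrightarrow> h \<noteq> 0 \<longrightarrow> g +\<^sub>G g = 0 \<longrightarrow> h +\<^sub>G h = 0 \<longrightarrow> g = h)"
begin

text \<open>For the intended group this singles out \<open>n = 2 r\<close> with \<open>r\<close>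
  odd, the case with its own argument in characteristic 2.\<close>

definition lone_involution :: bool where
  "lone_involution \<longleftrightarrow> (\<exists>g<n. g \<noteq> 0 \<and> g +\<^sub>G g = 0 \<and> (\<forall>h<n. h \<noteq> 0 \<longrightarrow> h +\<^sub>G h = 0 \<longrightarrow> h = g))"

lemma multiple_less: "x < n \<Longrightarrow> ((+\<^sub>G) x ^^ k) 0 < n"
  by (induction k) (auto simp: n_pos op_less)

lemma act_multiple:
  fixes N :: "'a::comm_ring_1 mpoly"
  assumes "x < n" "act x N = - N"
  shows "act (((+\<^sub>G) x ^^ k) 0) N = (- 1) ^ k * N"
proof (induction k)
  case (Suc k)
  have "act (((+\<^sub>G) x ^^ Suc k) 0) N = act x (act (((+\<^sub>G) x ^^ k) 0) N)"
    using assms by (simp add: act_act multiple_less)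
  also have "\<dots> = (- 1) ^ k * act x N" using Suc assms by (simp add: act_mult act_power act_uminus)
  finally show ?case using assms by simp
qed (simp add: act_0)

lemma mono_square:
  assumes "g < n"
  shows "mm (mono_mat g f) (mono_mat g f) = mono_mat (g +\<^sub>G g) (f * act g f)"
  by (rule mm_mono[OF assms assms])

section \<open>A leading component with scalar fourth power\<close>

context
  fixes f :: "'a::field mpoly" and g :: nat and c :: "'a mpoly"
  assumes g: "g < n" and f: "f \<noteq> 0" "homogeneous f" "bdp f = from_to 0 g"
    and scal: "mm (mm (mono_mat g f) (mono_mat g f)) (mm (mono_mat g f) (mono_mat g f)) = scalm c"
begin

text \<open>The fourth power is a nonzero monomial matrix attached to \<open>4 g\<close>; being
  scalar, it sits on the diagonal, so \<open>4 g = 0\<close>.\<close>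

lemma double_zero: "g +\<^sub>G g = 0"
proof -
  have "mono_mat (g +\<^sub>G g +\<^sub>G (g +\<^sub>G g)) (f * act g f * act (g +\<^sub>G g) (f * act g f)) = scalm c"
    using scal g by (simp add: mm_mono op_less)
  then have "mono_mat (g +\<^sub>G g +\<^sub>G (g +\<^sub>G g)) (f * act g f * act (g +\<^sub>G g) (f * act g f)) 0 (g +\<^sub>G g +\<^sub>G (g +\<^sub>G g)) =
    scalm c 0 (g +\<^sub>G g +\<^sub>G (g +\<^sub>G g))" by simp
  moreover have "mono_mat (g +\<^sub>G g +\<^sub>G (g +\<^sub>G g)) (f * act g f * act (g +\<^sub>G g) (f * act g f)) 0 (g +\<^sub>G g +\<^sub>G (g +\<^sub>G g)) \<noteq> 0"
    using g f by (simp add: mono_mat_def n_pos op_zero op_less act_0)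
  ultimately have "g +\<^sub>G g +\<^sub>G (g +\<^sub>G g) = 0" by (auto simp: scalm_def split: if_splits)
  then show ?thesis using double_torsion g by blast
qed

text \<open>As \<open>2 g = 0\<close>, the fourth power is diagonal with the translates of the
  square of \<open>f * act g f\<close> as entries. These all agree, and in a domain equal squares
  have equal roots up to sign.\<close>

lemma norm_sign:
  assumes "a < n"
  shows "act a (f * act g f) = f * act g f \<or> act a (f * act g f) = - (f * act g f)"
proof -
  let ?N = "f * act g f"
  have "mono_mat 0 (?N * ?N) = scalm c"
    using scal g by (simp add: mm_mono double_zero n_pos op_zero act_0)
  then have "mono_mat 0 (?N * ?N) a a = mono_mat 0 (?N * ?N) 0 0"
    using assms n_pos by (simp add: scalm_def)
  then have "act a ?N * act a ?N = ?N * ?N"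
    using assms n_pos by (simp add: mono_mat_def op_zero_right act_mult act_0)
  then show ?thesis by (simp add: square_eq_iff)
qed

text \<open>Otherwise the first alternative of \<open>involutions\<close> supplies \<open>h\<close>
  and \<open>c\<close> for \<open>even_boundary\<close>. The sum there is \<open>c g - c 0\<close>,
  which equals \<open>1 - 2 c 0\<close> and is odd.\<close>

lemma zero_or_unique:
  "g = 0 \<or> (\<forall>h<n. h \<noteq> 0 \<longrightarrow> h +\<^sub>G h = 0 \<longrightarrow> h = g)"
proof (rule ccontr)
  assume *: "\<not> ?thesis"
  then obtain h c where h: "h < n" "h +\<^sub>G h = 0" "h \<noteq> 0" and
    c: "\<forall>x<n. c (g +\<^sub>G x) = 1 - (c x :: int)" "\<forall>x<n. c (h +\<^sub>G x) = c x"
    using involutions g double_zero by metis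
  have "f * act g f dvd act h (f * act g f)" using norm_sign[OF h(1)] by auto
  then have "even (\<Sum>x<n. c x * bdp f x)"
    using even_boundary[of g h c f] g h c f double_zero by simp
  then have "even (c g - c 0)" using g f n_pos by (simp add: sum_from_to)
  moreover have "c g = 1 - c 0" using c(1) n_pos g by (metis op_zero_right)
  ultimately show False by simp
qed

text \<open>In characteristic 2 the sign in \<open>norm_sign\<close> disappears, and a polynomial
  with invariant square is itself invariant.\<close>

lemma char_2_invariant:
  assumes "(2::'a) = 0" "\<not> lone_involution"
  shows "g = 0" "a < n \<Longrightarrow> act a f = f"
proof -
  show g0: "g = 0"
  proof (rule ccontr)
    assume g0: "g \<noteq> 0"
    then have "\<forall>h<n. h \<noteq> 0 \<longrightarrow> h +\<^sub>G h = 0 \<longrightarrow> h = g" using zero_or_unique by blast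
    then show False using assms(2) g g0 double_zero unfolding lone_involution_def by blast
  qed
  assume a: "a < n"
  have "act a (f * f) = f * f"
    using norm_sign[OF a] mpoly_char_2[OF assms(1)] by (auto simp: g0 act_0)
  then have "act a f = f \<or> act a f = - f" using a by (simp add: act_mult square_eq_iff)
  then show "act a f = f" using mpoly_char_2[OF assms(1)] by auto
qed

text \<open>If the norm changed sign under \<open>a\<close>, it would do so under an odd multiple
  \<open>h\<close> of \<open>a\<close> with \<open>2 h = 0\<close>. For nonzero \<open>g\<close>
  this \<open>h\<close> is \<open>g\<close>, under which the norm is symmetric; for
  \<open>g = 0\<close> a square root of -1 gives the contradiction.\<close>

lemma norm_invariant:
  assumes "(2::'a) \<noteq> 0" "infinite (UNIV :: 'a set)" "a < n"
  shows "act a (f * act g f) = f * act g f"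
proof (rule ccontr)
  let ?N = "f * act g f"
  assume "act a ?N \<noteq> ?N"
  then have neg: "act a ?N = - ?N" using norm_sign assms by blast
  obtain k where k: "odd k" "((+\<^sub>G) a ^^ k) 0 +\<^sub>G ((+\<^sub>G) a ^^ k) 0 = 0"
    using odd_multiple[OF assms(3)] by (auto simp: Let_def)
  define h where "h = ((+\<^sub>G) a ^^ k) 0"
  have h: "h < n" "h +\<^sub>G h = 0" using k assms by (auto simp: h_def multiple_less)
  have hN: "act h ?N = - ?N" using act_multiple[OF assms(3) neg, of k] k by (simp add: h_def)
  have N0: "?N \<noteq> 0" using f g by simp
  have no: "- ?N \<noteq> ?N"
  proof
    assume "- ?N = ?N"
    then have "?N + ?N = 0" by (simp only: neg_eq_iff_add_eq_0)
    then show False using mpoly_double_eq_0 assms N0 by blast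
  qed
  have "h \<noteq> 0"
  proof
    assume "h = 0"
    then have "- ?N = ?N" using hN by (metis \<open>h = 0\<close> act_0)
    then show False using no by blast
  qed
  show False
  proof (cases "g = 0")
    case False
    then have "h = g" using zero_or_unique h \<open>h \<noteq> 0\<close> by blast
    then have "act h ?N = ?N" using g double_zero by (simp add: act_mult act_act act_0 mult.commute)
    then show False using hN no by simp
  next
    case True
    \<comment> \<open>Here \<open>(act h f)\<^sup>2 = - f\<^sup>2\<close>, so \<open>act h f\<close> is \<open>f\<close> times a square root \<open>j\<close> of \<open>-1\<close>, which evaluation at a
      point shows to lie in the field; since \<open>act h\<close> is an involution fixing \<open>j\<close>, this gives \<open>j\<^sup>2 = 1\<close>.\<close>
    have sq: "act h f * act h f = - (f * f)" using hN h True by (simp add: act_mult act_0)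
    obtain x where x: "eval_mpoly x f \<noteq> 0" using eval_mpoly_nonzero assms f by blast
    define j where "j = eval_mpoly x (act h f) / eval_mpoly x f"
    define J where "J = (Poly_Mapping.single 0 j :: 'a mpoly)"
    have "eval_mpoly x (act h f) * eval_mpoly x (act h f) = - (eval_mpoly x f * eval_mpoly x f)"
      using arg_cong[OF sq, of "eval_mpoly x"] by (simp only: eval_mpoly_mult eval_mpoly_uminus)
    then have "j * j = -1" using x by (simp add: j_def field_simps)
    then have JJ: "J * J = - 1" by (simp add: J_def mult_single single_uminus)
    have "(J * f) * (J * f) = (J * J) * (f * f)" by (simp only: mult_ac)
    then have "act h f * act h f = (J * f) * (J * f)" using sq JJ by simp
    then have "act h f = J * f \<or> act h f = (- J) * f" by (simp add: square_eq_iff)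
    then obtain J' where J': "act h f = J' * f" "J' * J' = - 1" "act h J' = J'"
    proof
      assume "act h f = J * f"
      then show thesis by (rule that) (use JJ h in \<open>simp_all add: J_def act_const\<close>)
    next
      assume "act h f = (- J) * f"
      then show thesis by (rule that) (use JJ h in \<open>simp_all add: J_def act_const act_uminus\<close>)
    qed
    have "f = act h (act h f)" using h by (simp add: act_act act_0)
    also have "\<dots> = J' * (J' * f)" using J' h by (simp add: act_mult)
    also have "\<dots> = (J' * J') * f" by (simp only: mult.assoc)
    finally have "f + f = 0" using J' by (simp add: eq_neg_iff_add_eq_0)
    then show False using mpoly_double_eq_0 assms f by blast
  qed
qed

end

section \<open>From leading parts to scalar matrices\<close>

lemma scalar_of_commutes:
  fixes A :: "nat \<Rightarrow> nat \<Rightarrow> 'r::comm_ring_1"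
  assumes "\<And>X. mm A X = mm X A" "h < n" "k < n"
  shows "A h k = scalm (A 0 0) h k"
proof -
  \<comment> \<open>Commutation is tested on the matrix unit with entry \<open>1\<close> in row
    \<open>i\<close> and column \<open>j\<close>.\<close>
  have e: "(\<Sum>l<n. A h l * of_bool (l = i \<and> t = j)) = (\<Sum>l<n. of_bool (h = i \<and> l = j) * A l t)"
    if "h < n" "t < n" for h t i j
    using fun_cong[OF fun_cong[OF assms(1)[of "\<lambda>l t. of_bool (l = i \<and> t = j)"]], of h t] that
    by (simp add: mm_def)
  have L: "(\<Sum>l<n. A h l * of_bool (l = i \<and> j = j)) = A h i" if "i < n" for h i and j :: nat
    using that by (simp add: of_bool_def if_distrib[of "(*) _"] cong: if_cong)
  have R: "(\<Sum>l<n. of_bool (h = i \<and> l = j) * A l t) = (if h = i then A j t else 0)" if "j < n" for h i j t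
    using that by (cases "h = i") (simp_all add: of_bool_def if_distrib[of "\<lambda>x. x * _"] cong: if_cong)
  have *: "A h i = (if h = i then A j j else 0)" if "h < n" "i < n" "j < n" for h i j
    using e[OF that(1,3), of i j] unfolding L[OF that(2)] R[OF that(3)] .
  show ?thesis using *[OF assms(2,3) n_pos] assms(2) by (simp add: scalm_def)
qed

lemma square_commutes:
  fixes Y X :: "nat \<Rightarrow> nat \<Rightarrow> 'a::field mpoly"
  assumes ch: "(2::'a) \<noteq> 0" "infinite (UNIV :: 'a set)"
    and Y: "twisted Y" "mm (mm Y Y) (mm Y Y) = scalm c"
  shows "mm (mm Y Y) X = mm X (mm Y Y)"
proof (rule ccontr)
  let ?Y2 = "mm Y Y"
  define C where "C = (\<lambda>h k. mm ?Y2 X h k - mm X ?Y2 h k)"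
  assume "mm ?Y2 X \<noteq> mm X ?Y2"
  then obtain h k where "mm ?Y2 X h k \<noteq> mm X ?Y2 h k" by (auto simp: fun_eq_iff)
  then have "h < n" "k < n" "C h k \<noteq> 0" by (auto simp: C_def mm_def split: if_splits)
  then obtain u h' k' where u: "wt_le C u" "h' < n" "k' < n" "top_part u C h' k' \<noteq> 0"
    using top_exists by metis
  have "\<exists>h<n. \<exists>k<n. Y h k \<noteq> 0"
  proof (rule ccontr)
    assume "\<not> ?thesis"
    then have "?Y2 = (\<lambda>h k. 0)" by (auto simp: mm_def fun_eq_iff)
    then have "mm ?Y2 X h k = 0" "mm X ?Y2 h k = 0" by (simp_all add: mm_def)
    then show False using \<open>mm ?Y2 X h k \<noteq> mm X ?Y2 h k\<close> by simp
  qed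
  then obtain w i j where w: "wt_le Y w" "i < n" "j < n" "top_part w Y i j \<noteq> 0"
    using top_exists by metis
  from top_part_mono[OF Y(1) w(2-4)] obtain g f where
    g: "g < n" and f: "f \<noteq> 0" "homogeneous f" "bdp f = from_to 0 g"
    and s: "\<And>i j. i < n \<Longrightarrow> j < n \<Longrightarrow> top_part w Y i j = mono_mat g f i j" by metis
  have Y2: "top_part (w + w) ?Y2 = mm (mono_mat g f) (mono_mat g f)"
    unfolding top_part_mm[OF w(1) w(1)] by (intro mm_cong s)
  have le2: "wt_le ?Y2 (w + w)" using w wt_le_mm by blast
  have sc: "mm (mm (mono_mat g f) (mono_mat g f)) (mm (mono_mat g f) (mono_mat g f)) =
    scalm (restrict_keys (\<lambda>m. wt m = (w + w) + (w + w)) c)"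
    using top_part_mm[OF le2 le2] by (simp add: Y Y2 top_part_scalm)
  define z where "z = f * act g f"
  have z0: "z \<noteq> 0" using f g by (simp add: z_def)
  \<comment> \<open>Invariance of the norm turns a diagonal of translates into a scalar
    matrix.\<close>
  have zs: "mono_mat 0 z = scalm z"
  proof (intro ext)
    fix h k
    show "mono_mat 0 z h k = scalm z h k"
      using norm_invariant[OF g f sc ch] by (cases "h < n") (simp_all add: mono_mat_def scalm_def z_def op_zero_right eq_commute)
  qed
  have Y2z: "top_part (w + w) ?Y2 = scalm z"
    unfolding Y2 mono_square[OF g] double_zero[OF g f sc] z_def[symmetric] by (rule zs)
  \<comment> \<open>The terms \<open>Y^2 X Y^2\<close> cancel, and the remaining ones do because the
    fourth power is scalar.\<close>
  have "mm ?Y2 C h k + mm C ?Y2 h k = 0" for h k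
  proof -
    have "mm ?Y2 (mm ?Y2 X) = mm X (scalm c)" unfolding mm_assoc[of ?Y2 ?Y2 X, symmetric] Y(2) by (rule mm_scalm_comm)
    moreover have "mm (mm X ?Y2) ?Y2 = mm X (scalm c)" unfolding mm_assoc[of X ?Y2 ?Y2] Y(2) ..
    ultimately show ?thesis
      unfolding C_def mm_diff_left mm_diff_right by (simp add: mm_assoc[of ?Y2 X])
  qed
  then have "restrict_keys (\<lambda>m. wt m = (w + w) + u) (mm ?Y2 C h' k' + mm C ?Y2 h' k') = 0" by simp
  then have "top_part ((w + w) + u) (mm ?Y2 C) h' k' + top_part (u + (w + w)) (mm C ?Y2) h' k' = 0"
    by (simp add: restrict_keys_add top_part_def add.commute)
  then have "z * top_part u C h' k' + z * top_part u C h' k' = 0"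
    unfolding top_part_mm[OF le2 u(1)] top_part_mm[OF u(1) le2] Y2z
    by (simp add: mm_scalm_left mm_scalm_right u)
  then have "z * top_part u C h' k' = 0" using mpoly_double_eq_0 ch by blast
  then show False using z0 u by simp
qed

text \<open>Induction on the number of weights: the leading part is a scalar matrix, and subtracting
  it removes a weight while the fourth power stays scalar, by \<open>mm_square_diff_scalm\<close>
  applied twice.\<close>

lemma char_2_scalar:
  fixes Y :: "nat \<Rightarrow> nat \<Rightarrow> 'a::field mpoly"
  assumes ch: "(2::'a) = 0" "\<not> lone_involution"
    and Y: "twisted Y" "mm (mm Y Y) (mm Y Y) = scalm c"
  shows "\<exists>d. \<forall>h<n. \<forall>k<n. Y h k = scalm d h k"
  using Y
proof (induction "card (wts Y)" arbitrary: Y c rule: less_induct)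
  case less
  show ?case
  proof (cases "\<exists>h<n. \<exists>k<n. Y h k \<noteq> 0")
    case False
    then show ?thesis by (intro exI[of _ 0]) (auto simp: scalm_def)
  next
    case True
    then obtain w i j where w: "wt_le Y w" "w \<in> wts Y" "i < n" "j < n" "top_part w Y i j \<noteq> 0"
      using top_exists by metis
    from top_part_mono[OF less(2) w(3-5)] obtain g f where
      g: "g < n" and f: "f \<noteq> 0" "homogeneous f" "bdp f = from_to 0 g"
      and s: "\<And>i j. i < n \<Longrightarrow> j < n \<Longrightarrow> top_part w Y i j = mono_mat g f i j" by metis
    have Y2: "top_part (w + w) (mm Y Y) = mm (mono_mat g f) (mono_mat g f)"
      unfolding top_part_mm[OF w(1) w(1)] by (intro mm_cong s)
    have le2: "wt_le (mm Y Y) (w + w)" using w wt_le_mm by blast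
    have sc: "mm (mm (mono_mat g f) (mono_mat g f)) (mm (mono_mat g f) (mono_mat g f)) =
      scalm (restrict_keys (\<lambda>m. wt m = (w + w) + (w + w)) c)"
      using top_part_mm[OF le2 le2] by (simp add: less(3) Y2 top_part_scalm)
    have inv: "g = 0" "\<And>a. a < n \<Longrightarrow> act a f = f" using char_2_invariant[OF g f sc ch] by blast+
    have s': "top_part w Y i j = scalm f i j" if "i < n" "j < n" for i j
      using s[OF that] inv that by (auto simp: mono_mat_def scalm_def op_zero_right)
    define Z where "Z = (\<lambda>h k. Y h k - top_part w Y h k)"
    have tZ: "twisted Z" unfolding Z_def using less(2) twisted_top_part twisted_diff by blast
    have "mm Z Z = mm (\<lambda>h k. Y h k - scalm f h k) (\<lambda>h k. Y h k - scalm f h k)"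
      by (intro mm_cong) (simp_all add: Z_def s')
    then have ZZ: "mm Z Z = (\<lambda>h k. mm Y Y h k - scalm (f * f) h k)" by (simp add: mm_square_diff_scalm[OF ch(1)])
    have "mm (mm Z Z) (mm Z Z) = scalm (c - (f * f) * (f * f))"
      unfolding ZZ mm_square_diff_scalm[OF ch(1)] less(3) by (auto simp: scalm_def fun_eq_iff)
    moreover have "wts Z \<subseteq> wts Y - {w}"
      by (fastforce simp: wts_def Z_def top_part_def in_keys_iff lookup_minus lookup_restrict_keys split: if_splits)
    then have "card (wts Z) < card (wts Y)"
      using w(2) finite_wts by (intro psubset_card_mono) auto
    ultimately obtain d where d: "\<forall>h<n. \<forall>k<n. Z h k = scalm d h k" using less(1) tZ by blast
    have "\<forall>h<n. \<forall>k<n. Y h k = scalm (d + f) h k"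
    proof (intro allI impI)
      fix h k assume hk: "h < n" "k < n"
      then have "Y h k = Z h k + scalm f h k" by (simp add: Z_def s')
      then show "Y h k = scalm (d + f) h k" using d hk by (simp add: scalm_def)
    qed
    then show ?thesis by blast
  qed
qed

text \<open>The square of the leading part of a nonzero twisted matrix has the entry
  \<open>f * act g f\<close>, a product of nonzero polynomials.\<close>

lemma twisted_reduced:
  fixes W :: "nat \<Rightarrow> nat \<Rightarrow> 'a::field mpoly"
  assumes W: "twisted W" "mm W W = scalm 0" and hk: "h < n" "k < n"
  shows "W h k = 0"
proof (rule ccontr)
  assume "W h k \<noteq> 0"
  then obtain w i j where w: "wt_le W w" "i < n" "j < n" "top_part w W i j \<noteq> 0"
    using top_exists hk by metis
  from top_part_mono[OF W(1) w(2-4)] obtain g f where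
    g: "g < n" and f: "f \<noteq> 0"
    and s: "\<And>i j. i < n \<Longrightarrow> j < n \<Longrightarrow> top_part w W i j = mono_mat g f i j" by metis
  have "mm (mono_mat g f) (mono_mat g f) = top_part (w + w) (mm W W)"
    unfolding top_part_mm[OF w(1) w(1)] by (intro mm_cong s[symmetric])
  then have "mono_mat (g +\<^sub>G g) (f * act g f) 0 (g +\<^sub>G g) = 0"
    by (simp add: W mono_square g top_part_scalm) (simp add: scalm_def)
  then show False using f g n_pos by (simp add: mono_mat_def op_zero op_less act_0)
qed

end

subsection \<open>Generic matrices\<close>

lemma eval_word_simps:
  "eval_word n A (NCWord []) = 1\<^sub>m n"
  "eval_word n A (NCWord (i # l)) = A i * eval_word n A (NCWord l)"
  by (simp_all add: eval_word_def)

lemma eval_word_carrier: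
  assumes A: "\<And>i. i < m \<Longrightarrow> A i \<in> carrier_mat n n" and l: "set l \<subseteq> {..<m}"
  shows "eval_word n A (NCWord l) \<in> carrier_mat n n"
  using l
proof (induction l)
  case (Cons i l)
  then show ?case using A[of i] by (auto simp: eval_word_simps)
qed (simp add: eval_word_simps)

text \<open>The bound on the letters ensures that only matrices of size \<open>n\<close> enter, as
  associativity of matrix multiplication requires.\<close>

lemma eval_word_append:
  assumes A: "\<And>i. i < m \<Longrightarrow> A i \<in> carrier_mat n n"
    and l: "set l \<subseteq> {..<m}" "set l' \<subseteq> {..<m}"
  shows "eval_word n A (NCWord (l @ l')) = eval_word n A (NCWord l) * eval_word n A (NCWord l')"
  using l(1)
proof (induction l)
  case Nil
  have "eval_word n A (NCWord l') \<in> carrier_mat n n" using A l(2) by (rule eval_word_carrier)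
  then show ?case by (simp add: eval_word_simps)
next
  case (Cons i l)
  have "A i \<in> carrier_mat n n" using A Cons(2) by simp
  moreover have "eval_word n A (NCWord l) \<in> carrier_mat n n" "eval_word n A (NCWord l') \<in> carrier_mat n n"
    using Cons(2) l(2) by (auto intro!: eval_word_carrier[of m A, OF A])
  ultimately show ?case using Cons by (simp add: eval_word_simps assoc_mult_mat)
qed

lemma free_algebra_mult:
  assumes "p \<in> free_algebra m" "q \<in> free_algebra m"
  shows "p * q \<in> free_algebra m"
  unfolding free_algebra_def
proof (intro CollectI ballI)
  fix w assume "w \<in> Poly_Mapping.keys (p * q)"
  then obtain u v where "u \<in> Poly_Mapping.keys p" "v \<in> Poly_Mapping.keys q" "w = u + v"
    using keys_mult[of p q] by blast
  then show "set (letters w) \<subseteq> {..<m}" using assms by (auto simp: free_algebra_def plus_ncword_def)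
qed

lemma eval_ncpoly_mult:
  fixes p q :: "'a::field ncpoly"
  assumes A: "\<And>i. i < m \<Longrightarrow> A i \<in> carrier_mat n n" and p: "p \<in> free_algebra m" and q: "q \<in> free_algebra m"
  shows "eval_ncpoly n A (p * q) = eval_ncpoly n A p * eval_ncpoly n A q"
proof (rule eq_matI)
  fix h k assume "h < dim_row (eval_ncpoly n A p * eval_ncpoly n A q)"
    "k < dim_col (eval_ncpoly n A p * eval_ncpoly n A q)"
  then have hk: "h < n" "k < n" by (simp_all add: eval_ncpoly_def)
  let ?L = "\<lambda>(p :: 'a ncpoly) h k. \<Sum>w\<in>Poly_Mapping.keys p. Poly_Mapping.lookup p w * eval_word n A w $$ (h, k)"
  have add: "?L (f + g) h k = ?L f h k + ?L g h k" for f g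
    by (rule setsum_keys_plus_distrib) (simp_all add: distrib_right)
  have sum: "?L (sum F I) h k = (\<Sum>i\<in>I. ?L (F i) h k)" for F :: "ncword \<Rightarrow> 'a ncpoly" and I
  proof (induction I rule: infinite_finite_induct)
    case (insert x I)
    then show ?case by (simp only: sum.insert add simp_thms)
  qed simp_all
  have single: "?L (Poly_Mapping.single w c) h k = c * eval_word n A w $$ (h, k)" for w c
    by simp
  have "p * q = (\<Sum>u\<in>Poly_Mapping.keys p. Poly_Mapping.single u (Poly_Mapping.lookup p u)) *
      (\<Sum>v\<in>Poly_Mapping.keys q. Poly_Mapping.single v (Poly_Mapping.lookup q v))"
    by (simp only: poly_mapping_sum_singles)
  then have pq: "p * q = (\<Sum>u\<in>Poly_Mapping.keys p. \<Sum>v\<in>Poly_Mapping.keys q.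
      Poly_Mapping.single (u + v) (Poly_Mapping.lookup p u * Poly_Mapping.lookup q v))"
    by (simp only: sum_product mult_single)
  have "?L (p * q) h k = (\<Sum>u\<in>Poly_Mapping.keys p. \<Sum>v\<in>Poly_Mapping.keys q.
      Poly_Mapping.lookup p u * Poly_Mapping.lookup q v * eval_word n A (u + v) $$ (h, k))"
    unfolding pq sum single ..
  also have "\<dots> = (\<Sum>u\<in>Poly_Mapping.keys p. \<Sum>v\<in>Poly_Mapping.keys q. \<Sum>l<n.
      (Poly_Mapping.lookup p u * eval_word n A u $$ (h, l)) * (Poly_Mapping.lookup q v * eval_word n A v $$ (l, k)))"
  proof (intro sum.cong refl)
    fix u v assume uv: "u \<in> Poly_Mapping.keys p" "v \<in> Poly_Mapping.keys q"
    have l: "set (letters u) \<subseteq> {..<m}" "set (letters v) \<subseteq> {..<m}" using p q uv by (auto simp: free_algebra_def)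
    have "eval_word n A (u + v) = eval_word n A u * eval_word n A v"
      using eval_word_append[of m A, OF A l] by (simp add: plus_ncword_def)
    moreover have "eval_word n A u \<in> carrier_mat n n" "eval_word n A v \<in> carrier_mat n n"
      using eval_word_carrier[of m A, OF A l(1)] eval_word_carrier[of m A, OF A l(2)] by simp_all
    ultimately show "Poly_Mapping.lookup p u * Poly_Mapping.lookup q v * eval_word n A (u + v) $$ (h, k) =
      (\<Sum>l<n. (Poly_Mapping.lookup p u * eval_word n A u $$ (h, l)) * (Poly_Mapping.lookup q v * eval_word n A v $$ (l, k)))"
      using hk by (auto simp: scalar_prod_def sum_distrib_left lessThan_atLeast0 mult_ac intro!: sum.cong)
  qed
  also have "\<dots> = (\<Sum>u\<in>Poly_Mapping.keys p. \<Sum>l<n. \<Sum>v\<in>Poly_Mapping.keys q.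
      (Poly_Mapping.lookup p u * eval_word n A u $$ (h, l)) * (Poly_Mapping.lookup q v * eval_word n A v $$ (l, k)))"
    by (intro sum.cong refl sum.swap)
  also have "\<dots> = (\<Sum>l<n. \<Sum>u\<in>Poly_Mapping.keys p. \<Sum>v\<in>Poly_Mapping.keys q.
      (Poly_Mapping.lookup p u * eval_word n A u $$ (h, l)) * (Poly_Mapping.lookup q v * eval_word n A v $$ (l, k)))"
    by (rule sum.swap)
  also have "\<dots> = (\<Sum>l<n. ?L p h l * ?L q l k)" by (simp only: sum_product)
  finally show "eval_ncpoly n A (p * q) $$ (h, k) = (eval_ncpoly n A p * eval_ncpoly n A q) $$ (h, k)"
    using hk by (simp add: eval_ncpoly_def scalar_prod_def lessThan_atLeast0)
qed (simp_all add: eval_ncpoly_def)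

context abelian_index
begin

lemma mm_eq_scalm:
  assumes "\<And>h k. h < n \<Longrightarrow> k < n \<Longrightarrow> mm A B h k = scalm c h k"
  shows "mm A B = scalm c"
proof (intro ext)
  fix h k
  show "mm A B h k = scalm c h k"
    using assms[of h k] by (cases "h < n \<and> k < n") (auto simp: mm_def scalm_def)
qed

lemma twisted_const_mult:
  assumes "twisted A"
  shows "twisted (\<lambda>h k. Poly_Mapping.single 0 c * A h k)"
  unfolding twisted_def
proof (intro allI impI conjI ballI)
  fix h k m assume hk: "h < n" "k < n" and m: "m \<in> Poly_Mapping.keys (Poly_Mapping.single 0 c * A h k)"
  then have "m \<in> Poly_Mapping.keys (A h k)"
    using keys_mult[of "Poly_Mapping.single 0 c" "A h k"] by (auto split: if_splits)
  then show "bd m = from_to h k" using assms hk twistedD by blast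
qed (use assms in \<open>auto simp: act_mult act_const twistedD\<close>)

lemma twisted_sum:
  assumes "\<And>i. i \<in> I \<Longrightarrow> twisted (F i)"
  shows "twisted (\<lambda>h k. \<Sum>i\<in>I. F i h k)"
  unfolding twisted_def
proof (intro allI impI conjI ballI)
  fix h k m assume hk: "h < n" "k < n" and m: "m \<in> Poly_Mapping.keys (\<Sum>i\<in>I. F i h k)"
  then obtain i where "i \<in> I" "m \<in> Poly_Mapping.keys (F i h k)"
    using keys_sum[of "\<lambda>i. F i h k" I] by blast
  then show "bd m = from_to h k" using assms hk twistedD by blast
qed (use assms in \<open>auto simp: act_sum twistedD intro!: sum.cong\<close>)

section \<open>Generic matrices and their specializations\<close>

definition generic :: "nat \<Rightarrow> nat \<Rightarrow> nat \<Rightarrow> 'a::comm_ring_1 mpoly" where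
  "generic i h k = Var (enc i h k)"

fun generic_word :: "nat list \<Rightarrow> nat \<Rightarrow> nat \<Rightarrow> 'a::comm_ring_1 mpoly" where
  "generic_word [] = scalm 1"
| "generic_word (i # is) = mm (generic i) (generic_word is)"

definition generic_value :: "'a::field ncpoly \<Rightarrow> nat \<Rightarrow> nat \<Rightarrow> 'a mpoly" where
  "generic_value p h k = (\<Sum>w\<in>Poly_Mapping.keys p. Poly_Mapping.single 0 (Poly_Mapping.lookup p w) * generic_word (letters w) h k)"

lemma twisted_generic: "twisted (generic i :: nat \<Rightarrow> nat \<Rightarrow> 'a::comm_ring_1 mpoly)"
  unfolding twisted_def
proof (intro allI impI conjI ballI)
  fix h k m assume hk: "h < n" "k < n" and m: "m \<in> Poly_Mapping.keys (generic i h k :: 'a mpoly)"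
  then have "m = Poly_Mapping.single (enc i h k) 1" by (simp add: generic_def Var_def)
  then show "bd m = from_to h k" using hk by (auto simp: bd_def from_to_def enc_simps)
qed (auto simp: generic_def act_Var shift_def enc_simps)

lemma twisted_generic_word: "twisted (generic_word l :: nat \<Rightarrow> nat \<Rightarrow> 'a::comm_ring_1 mpoly)"
proof (induction l)
  case Nil
  have "invariant (1 :: 'a mpoly)" by (auto simp: invariant_def bd_def)
  then show ?case by (simp add: twisted_scalm)
qed (auto intro: twisted_mm twisted_generic)

lemma twisted_generic_value: "twisted (generic_value p)"
  unfolding generic_value_def
  by (intro twisted_sum twisted_const_mult twisted_generic_word)

definition point :: "(nat \<Rightarrow> 'a mat) \<Rightarrow> nat \<Rightarrow> 'a" where
  "point A v = A (block v) $$ (src v, tgt v)"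

lemma eval_mm:
  assumes "\<And>h k. h < n \<Longrightarrow> k < n \<Longrightarrow> eval_mpoly x (M h k) = P $$ (h, k)"
    "\<And>h k. h < n \<Longrightarrow> k < n \<Longrightarrow> eval_mpoly x (M' h k) = P' $$ (h, k)"
    "P \<in> carrier_mat n n" "P' \<in> carrier_mat n n" "h < n" "k < n"
  shows "eval_mpoly x (mm M M' h k) = (P * P') $$ (h, k)"
  using assms by (auto simp: mm_def eval_mpoly_sum eval_mpoly_mult scalar_prod_def lessThan_atLeast0)

lemma eval_generic_word:
  assumes A: "\<And>i. i < m \<Longrightarrow> A i \<in> carrier_mat n n" and "set l \<subseteq> {..<m}" "h < n" "k < n"
  shows "eval_mpoly (point A) (generic_word l h k) = eval_word n A (NCWord l) $$ (h, k)"
  using assms(2-)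
proof (induction l arbitrary: h k)
  case Nil
  then show ?case by (simp add: scalm_def eval_word_def)
next
  case (Cons i l)
  have "eval_mpoly (point A) (mm (generic i) (generic_word l) h k) = (A i * eval_word n A (NCWord l)) $$ (h, k)"
  proof (rule eval_mm)
    show "eval_mpoly (point A) (generic i h k) = A i $$ (h, k)" if "h < n" "k < n" for h k
      using that by (simp add: generic_def point_def enc_simps)
    show "A i \<in> carrier_mat n n" using Cons(2) A by auto
    show "eval_word n A (NCWord l) \<in> carrier_mat n n" using Cons(2) by (auto intro!: eval_word_carrier[of m A, OF A])
  qed (use Cons in auto)
  then show ?case by (simp add: eval_word_def)
qed

lemma eval_generic_value:
  assumes A: "\<And>i. i < m \<Longrightarrow> A i \<in> carrier_mat n n" and p: "p \<in> free_algebra m" and "h < n" "k < n"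
  shows "eval_mpoly (point A) (generic_value p h k) = eval_ncpoly n A p $$ (h, k)"
proof -
  have "eval_mpoly (point A) (generic_word (letters w) h k) = eval_word n A w $$ (h, k)"
    if "w \<in> Poly_Mapping.keys p" for w
    using eval_generic_word[of m A "letters w" h k, OF A] p that assms by (cases w) (auto simp: free_algebra_def)
  then show ?thesis
    using assms by (simp add: generic_value_def eval_mpoly_sum eval_mpoly_mult eval_ncpoly_def)
qed

text \<open>Every variable is an entry of one generic matrix, so every assignment of values comes
  from matrices, and an identity tested on matrices is tested at all points.\<close>

lemma point_surj: "\<exists>A. (\<forall>i. A i \<in> carrier_mat n n) \<and> x = point A"
proof (intro exI conjI allI)
  let ?A = "\<lambda>i. mat n n (\<lambda>(h, k). x (enc i h k))"
  show "?A i \<in> carrier_mat n n" for i by simp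
  show "x = point ?A" by (auto simp: point_def src_less tgt_less enc_src_tgt)
qed

end

context index_group
begin

text \<open>Determinants give \<open>d ^ 4 = c ^ (2 r)\<close>, hence \<open>d ^ 2 = c ^ r\<close>
  in characteristic 2. With \<open>r = 2 j + 1\<close> the matrix \<open>c ^ j Y^2\<close> has the
  same square as the scalar \<open>d\<close>, so their difference is twisted with square
  zero.\<close>

lemma square_scalar_char_2_lone:
  fixes Y :: "nat \<Rightarrow> nat \<Rightarrow> 'a::field mpoly"
  assumes ch: "(2::'a) = 0" and n: "n = 2 * r" "odd r"
    and Y: "twisted Y" "mm (mm Y Y) (mm Y Y) = scalm c" and c: "c \<noteq> 0"
  shows "\<exists>e. mm Y Y = scalm e"
proof -
  define M where "M = mat n n (\<lambda>(h, k). Y h k)"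
  define d where "d = det M"
  have M: "M \<in> carrier_mat n n" by (simp add: M_def)
  have MM: "M * M = mat n n (\<lambda>(h, k). mm Y Y h k)"
    by (rule eq_matI) (auto simp: M_def mm_def scalar_prod_def lessThan_atLeast0)
  have "M * M * (M * M) = mat n n (\<lambda>(h, k). mm (mm Y Y) (mm Y Y) h k)"
    unfolding MM by (rule eq_matI) (auto simp: mm_def[of "mm Y Y"] scalar_prod_def lessThan_atLeast0)
  also have "\<dots> = c \<cdot>\<^sub>m 1\<^sub>m n" unfolding Y(2) by (rule eq_matI) (auto simp: scalm_def)
  finally have "det (M * M * (M * M)) = c ^ n" by (simp add: det_smult)
  then have "(d * d) * (d * d) = c ^ r * c ^ r"
    using M by (simp add: det_mult[of _ n] d_def n power_add mult_2)
  then have dd: "d * d = c ^ r" using mpoly_char_2(2)[OF ch] by (auto simp: square_eq_iff)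
  obtain j where j: "r = 2 * j + 1" using n by (elim oddE)
  have "twisted (scalm c)" using Y twisted_mm by metis
  then have inv: "invariant c" by (rule invariant_of_twisted_scalm)
  \<comment> \<open>Square roots are unique in characteristic 2, and a boundary whose double is zero
    is zero; so \<open>d\<close> inherits invariance from \<open>d * d\<close>.\<close>
  have "invariant d"
  proof (cases "d = 0")
    case True
    then show ?thesis by (simp add: invariant_def)
  next
    case False
    have invr: "invariant (d * d)" unfolding dd using inv by (rule invariant_power)
    have "act a d = d" if "a < n" for a
    proof -
      have "act a d * act a d = d * d" using invr that by (simp add: invariant_def act_mult)
      then show ?thesis using mpoly_char_2(2)[OF ch] by (auto simp: square_eq_iff)
    qed
    moreover have h2: "homogeneous (d * d)" using invr by (simp add: homogeneous_def invariant_def)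
    then have h: "homogeneous d" using homogeneous_factors False by auto
    obtain m where "m \<in> Poly_Mapping.keys (d * d)" using False by (metis all_not_in_conv keys_eq_empty mult_eq_0_iff)
    then have "bdp (d * d) = (\<lambda>_. 0)" using bdp_eq[OF h2] invr by (auto simp: invariant_def)
    then have "bdp d x = 0" for x using bdp_mult[OF h2, of x] False by simp
    then have "bd m = (\<lambda>_. 0)" if "m \<in> Poly_Mapping.keys d" for m using bdp_eq[OF h that] by auto
    ultimately show ?thesis by (simp add: invariant_def)
  qed
  define A where "A = mm (scalm (c ^ j)) (mm Y Y)"
  define W where "W = (\<lambda>h k. A h k - scalm d h k)"
  have "twisted A" unfolding A_def using Y inv by (intro twisted_mm twisted_scalm invariant_power)
  then have "twisted W" unfolding W_def using \<open>invariant d\<close> by (intro twisted_diff twisted_scalm)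
  moreover have "mm W W = scalm 0"
  proof -
    have "mm A A = mm (scalm (c ^ j)) (mm (mm (mm Y Y) (scalm (c ^ j))) (mm Y Y))"
      by (simp only: A_def mm_assoc)
    also have "\<dots> = mm (scalm (c ^ j)) (mm (scalm (c ^ j)) (mm (mm Y Y) (mm Y Y)))"
      by (simp only: mm_scalm_comm[symmetric] mm_assoc)
    also have "\<dots> = scalm (c ^ r)"
      unfolding Y(2) by (rule mm_eq_scalm) (simp add: mm_scalm_left scalm_def j power_add mult_2)
    finally have "mm A A = scalm (c ^ r)" .
    then show ?thesis unfolding W_def mm_square_diff_scalm[OF ch] dd by (auto simp: scalm_def fun_eq_iff)
  qed
  ultimately have W0: "W h k = 0" if "h < n" "k < n" for h k using twisted_reduced that by blast
  have *: "c ^ j * mm Y Y h k = scalm d h k" if "h < n" "k < n" for h k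
    using W0[OF that] that by (simp add: W_def A_def mm_scalm_left)
  have "mm Y Y h k = scalm (mm Y Y 0 0) h k" if hk: "h < n" "k < n" for h k
  proof -
    have "c ^ j * mm Y Y h k = c ^ j * scalm (mm Y Y 0 0) h k"
      unfolding *[OF hk] using *[OF n_pos n_pos] n_pos by (simp add: scalm_def)
    then show ?thesis using c by simp
  qed
  then have "mm Y Y = scalm (mm Y Y 0 0)" by (rule mm_eq_scalm)
  then show ?thesis by blast
qed

text \<open>Over an infinite field, \<open>p ^ 4\<close> being scalar at all matrices is a
  polynomial identity, so it holds for the generic value \<open>Y\<close>. Once
  \<open>mm Y Y\<close> is scalar, specialization makes \<open>p ^ 2\<close> central, against the
  minimality of 4.\<close>

theorem no_4_central:
  fixes p :: "'a::field ncpoly"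
  assumes inf: "infinite (UNIV :: 'a set)" and p: "p \<in> free_algebra m"
    and lone: "lone_involution \<Longrightarrow> \<exists>r. odd r \<and> n = 2 * r"
  shows "\<not> is_nu_central 4 m n p"
proof
  assume "is_nu_central 4 m n p"
  then have c4: "is_central m n (p ^ 4)" and c2: "\<not> is_central m n (p ^ 2)"
    by (auto simp: is_nu_central_def)
  let ?E = "\<lambda>A. eval_ncpoly n A p"
  have E: "?E A \<in> carrier_mat n n" for A by (simp add: eval_ncpoly_def)
  have p2: "eval_ncpoly n A (p ^ 2) = ?E A * ?E A" if "\<forall>i<m. A i \<in> carrier_mat n n" for A
    using that p eval_ncpoly_mult[of m A n p p] by (simp add: power2_eq_square)
  have p4: "eval_ncpoly n A (p ^ 4) = (?E A * ?E A) * (?E A * ?E A)" if "\<forall>i<m. A i \<in> carrier_mat n n" for A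
  proof -
    have "p ^ 4 = (p * p) * (p * p)" by (simp add: numeral_eq_Suc mult.assoc)
    then show ?thesis using that p eval_ncpoly_mult[of m A n p p] eval_ncpoly_mult[of m A n "p * p" "p * p"]
        free_algebra_mult[OF p p] by simp
  qed
  define Y where "Y = (generic_value p :: nat \<Rightarrow> nat \<Rightarrow> 'a mpoly)"
  have tw: "twisted Y" unfolding Y_def by (rule twisted_generic_value)
  have ev: "eval_mpoly (point A) (Y h k) = ?E A $$ (h, k)"
    if "\<forall>i<m. A i \<in> carrier_mat n n" "h < n" "k < n" for A h k
    unfolding Y_def using that p by (intro eval_generic_value) auto
  have ev2: "eval_mpoly (point A) (mm Y Y h k) = eval_ncpoly n A (p ^ 2) $$ (h, k)"
    if "\<forall>i<m. A i \<in> carrier_mat n n" "h < n" "k < n" for A h k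
    unfolding p2[OF that(1)] by (rule eval_mm[OF ev[OF that(1)] ev[OF that(1)] E E that(2,3)])
  have ev4: "eval_mpoly (point A) (mm (mm Y Y) (mm Y Y) h k) = eval_ncpoly n A (p ^ 4) $$ (h, k)"
    if "\<forall>i<m. A i \<in> carrier_mat n n" "h < n" "k < n" for A h k
    unfolding p4[OF that(1)] p2[OF that(1), symmetric]
    by (rule eval_mm[OF ev2[OF that(1)] ev2[OF that(1)] _ _ that(2,3)]) (simp_all add: eval_ncpoly_def)
  define c where "c = mm (mm Y Y) (mm Y Y) 0 0"
  have Y4: "mm (mm Y Y) (mm Y Y) = scalm c"
  proof (rule mm_eq_scalm, rule ccontr)
    fix h k assume hk: "h < n" "k < n" and "mm (mm Y Y) (mm Y Y) h k \<noteq> scalm c h k"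
    then obtain x where x: "eval_mpoly x (mm (mm Y Y) (mm Y Y) h k - scalm c h k) \<noteq> 0"
      using eval_mpoly_nonzero[OF inf, of "mm (mm Y Y) (mm Y Y) h k - scalm c h k"] by auto
    obtain A where A: "\<forall>i. A i \<in> carrier_mat n n" "x = point A" using point_surj by blast
    then have A': "\<forall>i<m. A i \<in> carrier_mat n n" by blast
    obtain b where b: "eval_ncpoly n A (p ^ 4) = b \<cdot>\<^sub>m 1\<^sub>m n" using c4 A' by (auto simp: is_central_def)
    have "eval_mpoly x (mm (mm Y Y) (mm Y Y) h k) = (if h = k then b else 0)"
      using ev4[OF A'] hk A(2) b by simp
    moreover have "eval_mpoly x c = b" using ev4[OF A' n_pos n_pos] A(2) b n_pos by (simp add: c_def)
    ultimately show False using x hk by (cases "h = k") (simp_all add: scalm_def eval_mpoly_diff)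
  qed
  obtain A1 where A1: "\<forall>i<m. A1 i \<in> carrier_mat n n" "eval_ncpoly n A1 (p ^ 4) \<noteq> 0\<^sub>m n n"
    using c4 by (auto simp: is_central_def)
  have c0: "c \<noteq> 0"
  proof
    assume "c = 0"
    then have "eval_ncpoly n A1 (p ^ 4) = 0\<^sub>m n n"
      using ev4[OF A1(1)] by (intro eq_matI) (auto simp: Y4 scalm_def eval_ncpoly_def)
    then show False using A1 by simp
  qed
  have "\<exists>e. mm Y Y = scalm e"
  proof (cases "(2::'a) = 0")
    case False
    have "mm (mm Y Y) X = mm X (mm Y Y)" for X
      using square_commutes[OF False inf tw Y4] .
    then have "mm Y Y h k = scalm (mm Y Y 0 0) h k" if "h < n" "k < n" for h k
      using scalar_of_commutes that by blast
    then have "mm Y Y = scalm (mm Y Y 0 0)" by (rule mm_eq_scalm)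
    then show ?thesis by blast
  next
    case ch: True
    show ?thesis
    proof (cases lone_involution)
      case True
      then show ?thesis using lone square_scalar_char_2_lone[OF ch _ _ tw Y4 c0] by blast
    next
      case False
      then obtain d where "\<forall>h<n. \<forall>k<n. Y h k = scalm d h k" using char_2_scalar[OF ch _ tw Y4] by blast
      then have "mm Y Y = mm (scalm d) (scalm d)" by (intro mm_cong) auto
      also have "\<dots> = scalm (d * d)"
        by (rule mm_eq_scalm) (simp add: mm_scalm_left, simp add: scalm_def)
      finally show ?thesis by blast
    qed
  qed
  then obtain e where e: "mm Y Y = scalm e" by blast
  have "is_central m n (p ^ 2)"
    unfolding is_central_def
  proof (intro conjI allI impI)
    fix A :: "nat \<Rightarrow> 'a mat" assume A: "\<forall>i<m. A i \<in> carrier_mat n n"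
    have "eval_ncpoly n A (p ^ 2) = eval_mpoly (point A) e \<cdot>\<^sub>m 1\<^sub>m n"
    proof (rule eq_matI)
      fix h k assume "h < dim_row (eval_mpoly (point A) e \<cdot>\<^sub>m 1\<^sub>m n)" "k < dim_col (eval_mpoly (point A) e \<cdot>\<^sub>m 1\<^sub>m n)"
      then show "eval_ncpoly n A (p ^ 2) $$ (h, k) = (eval_mpoly (point A) e \<cdot>\<^sub>m 1\<^sub>m n) $$ (h, k)"
        using ev2[OF A, of h k] by (cases "h = k") (simp_all add: e scalm_def)
    qed (simp_all add: eval_ncpoly_def)
    then show "\<exists>c. eval_ncpoly n A (p ^ 2) = c \<cdot>\<^sub>m 1\<^sub>m n" by blast
  next
    \<comment> \<open>If \<open>p ^ 2\<close> vanished at \<open>A1\<close>, so would its square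
      \<open>p ^ 4\<close>.\<close>
    have "eval_ncpoly n A1 (p ^ 2) \<noteq> 0\<^sub>m n n" using A1 p2 p4 by auto
    then show "\<exists>A. (\<forall>i<m. A i \<in> carrier_mat n n) \<and> eval_ncpoly n A (p ^ 2) \<noteq> 0\<^sub>m n n" using A1 by blast
  qed
  then show False using c2 by blast
qed

end

subsection \<open>The index group\<close>

text \<open>A number \<open>x < r 2\<^sup>a\<close> stands for the residue \<open>x mod r\<close> together with the bits of \<open>x div r\<close>.\<close>

locale cyclic_elementary =
  fixes r a :: nat
  assumes odd_r: "odd r"
begin

definition grp_order :: nat where "grp_order = r * 2 ^ a"

definition add :: "nat \<Rightarrow> nat \<Rightarrow> nat" where
  "add x y = (x mod r + y mod r) mod r + r * xor (x div r) (y div r)"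

text \<open>The bit part is its own inverse, so only the residue is negated; the outer reduction
  sends residue \<open>0\<close> to \<open>0\<close> instead of \<open>r\<close>.\<close>

definition opp :: "nat \<Rightarrow> nat" where
  "opp x = (r - x mod r) mod r + r * (x div r)"

lemma r_pos: "r > 0"
  using odd_r by (simp add: odd_pos)

lemma add_mod: "add x y mod r = (x mod r + y mod r) mod r"
  and add_div: "add x y div r = xor (x div r) (y div r)"
  using r_pos by (simp_all add: add_def)

lemma opp_mod: "opp x mod r = (r - x mod r) mod r" and opp_div: "opp x div r = x div r"
  using r_pos by (simp_all add: opp_def)

lemma eq_iff: "x = y \<longleftrightarrow> x mod r = y mod r \<and> x div r = y div r"
  by (metis mult_div_mod_eq)

lemma less_size_iff: "x < grp_order \<longleftrightarrow> x div r < 2 ^ a"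
  using r_pos by (simp add: grp_order_def div_less_iff_less_mult mult.commute)

lemma xor_less: "u < 2 ^ a \<Longrightarrow> v < 2 ^ a \<Longrightarrow> xor u v < (2 ^ a :: nat)"
  by (metis take_bit_nat_eq_self_iff take_bit_xor)

lemma mod_double_eq_0: "(u + u) mod r = 0 \<longleftrightarrow> u mod r = 0"
  using odd_r by (metis coprime_dvd_mult_right_iff coprime_right_2_iff_odd dvd_eq_mod_eq_0 mult_2)

text \<open>The bits always cancel, and 2 is invertible modulo the odd number
  \<open>r\<close>.\<close>

lemma add_self_eq_0_iff: "add x x = 0 \<longleftrightarrow> x mod r = 0"
  by (subst eq_iff) (simp add: add_mod add_div mod_double_eq_0)

sublocale abelian_index grp_order add opp
proof
  show "0 < grp_order" using r_pos by (simp add: grp_order_def)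
  fix x y z assume x: "x < grp_order"
  show "opp x < grp_order" using x by (simp add: less_size_iff opp_div)
  show "add 0 x = x" by (subst eq_iff) (simp add: add_mod add_div)
  show "add (opp x) x = 0"
  proof (subst eq_iff, intro conjI)
    have "x mod r < r" using r_pos by simp
    then have "r - x mod r + x mod r = r" by simp
    then show "add (opp x) x mod r = 0 mod r"
      unfolding add_mod opp_mod by (metis mod_add_left_eq mod_mod_trivial mod_self mod_0)
    show "add (opp x) x div r = 0 div r" by (simp add: add_div opp_div)
  qed
  assume y: "y < grp_order"
  show "add x y < grp_order" using x y by (simp add: less_size_iff add_div xor_less)
  show "add x y = add y x" by (subst eq_iff) (simp add: add_mod add_div add.commute xor.commute)
  assume z: "z < grp_order"
  show "add (add x y) z = add x (add y z)"
    by (subst eq_iff) (simp add: add_mod add_div mod_simps xor.assoc add.assoc)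
qed

lemma is_char_mod: "is_char (\<lambda>x. int (x mod r)) (int r)"
  unfolding is_char_def cong_def by (simp add: add_mod zmod_int mod_simps)

lemma is_char_bit: "is_char (\<lambda>x. of_bool (bit (x div r) j)) 2"
  unfolding is_char_def cong_def by (auto simp: add_div bit_xor_iff)

sublocale separated_index grp_order add opp
proof
  fix x y assume "x < grp_order" "y < grp_order" "x \<noteq> y"
  \<comment> \<open>The residue modulo \<open>r\<close> and the single bits are the separating
    characters.\<close>
  then consider "x mod r \<noteq> y mod r" | "x div r \<noteq> y div r" by (metis eq_iff)
  then show "\<exists>c N. is_char c N \<and> [c x \<noteq> c y] (mod N)"
  proof cases
    case 1
    then show ?thesis using is_char_mod by (intro exI[of _ "\<lambda>x. int (x mod r)"] exI[of _ "int r"])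
        (auto simp: cong_def zmod_int[symmetric])
  next
    case 2
    then obtain j where "bit (x div r) j \<noteq> bit (y div r) j" by (metis bit_eqI)
    then show ?thesis using is_char_bit by (intro exI[of _ "\<lambda>x. of_bool (bit (x div r) j)"] exI[of _ 2])
        (auto simp: cong_def)
  qed
qed

lemma multiple_mod: "((add x ^^ k) 0) mod r = (k * x) mod r"
  by (induction k) (simp_all add: add_mod mod_simps)

lemma involution_bit:
  assumes "g < grp_order" "g \<noteq> 0" "add g g = 0"
  shows "g mod r = 0" "\<exists>j<a. bit (g div r) j"
proof -
  show 0: "g mod r = 0" using assms add_self_eq_0_iff by simp
  then have "g div r \<noteq> 0" using assms(2) eq_iff[of g 0] by simp
  then obtain j where j: "bit (g div r) j" by (metis bit_0_eq bit_eqI bot_apply bot_bool_def)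
  have "j < a"
  proof (rule ccontr)
    assume "\<not> j < a"
    then have "2 ^ a \<le> (2 ^ j :: nat)" by simp
    then have "g div r < 2 ^ j" using assms(1) less_size_iff order.strict_trans2 by blast
    then show False using j by (simp add: bit_iff_odd)
  qed
  then show "\<exists>j<a. bit (g div r) j" using j by blast
qed

lemma involution_of_bit:
  assumes "j < a"
  shows "r * 2 ^ j < grp_order" "add (r * 2 ^ j) (r * 2 ^ j) = 0" "r * 2 ^ j \<noteq> 0"
  using assms r_pos by (simp_all add: grp_order_def add_self_eq_0_iff)

sublocale index_group grp_order add opp
proof
  fix x assume x: "x < grp_order"
  show "add x x = 0" if "add (add x x) (add x x) = 0"
    using that unfolding add_self_eq_0_iff by (simp add: add_mod mod_simps mod_double_eq_0)
  show "\<exists>k. odd k \<and> (let y = (add x ^^ k) 0 in add y y = 0)"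
    \<comment> \<open>The multiple by \<open>r\<close> kills the residue.\<close>
    using odd_r by (intro exI[of _ r]) (simp add: Let_def add_self_eq_0_iff multiple_mod)
next
  show "(\<forall>g<grp_order. g \<noteq> 0 \<longrightarrow> add g g = 0 \<longrightarrow> (\<exists>h<grp_order. \<exists>c :: nat \<Rightarrow> int. add h h = 0 \<and> h \<noteq> 0 \<and>
        (\<forall>x<grp_order. c (add g x) = 1 - c x) \<and> (\<forall>x<grp_order. c (add h x) = c x))) \<or>
      (\<forall>g<grp_order. \<forall>h<grp_order. g \<noteq> 0 \<longrightarrow> h \<noteq> 0 \<longrightarrow> add g g = 0 \<longrightarrow> add h h = 0 \<longrightarrow> g = h)"
  proof (cases "a \<ge> 2")
    case True
    have "\<exists>h<grp_order. \<exists>c :: nat \<Rightarrow> int. add h h = 0 \<and> h \<noteq> 0 \<and>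
        (\<forall>x<grp_order. c (add g x) = 1 - c x) \<and> (\<forall>x<grp_order. c (add h x) = c x)"
      if g: "g < grp_order" "g \<noteq> 0" "add g g = 0" for g
    proof -
      obtain j where j: "bit (g div r) j" using involution_bit[OF g] by blast
      \<comment> \<open>A bit position other than \<open>j\<close>: the involution \<open>h\<close>
        flips it and leaves bit \<open>j\<close>, on which \<open>c\<close> depends,
        unchanged.\<close>
      define j' where "j' = (if j = 0 then 1 else 0 :: nat)"
      have j': "j' < a" "j' \<noteq> j" using True by (auto simp: j'_def)
      define c where "c x = (of_bool (bit (x div r) j) :: int)" for x
      have "c (add g x) = 1 - c x" "c (add (r * 2 ^ j') x) = c x" for x
        using j j' r_pos by (auto simp: c_def add_div bit_xor_iff bit_exp_iff)
      then show ?thesis using involution_of_bit[OF j'(1)] by blast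
    qed
    then show ?thesis by blast
  next
    case False
    \<comment> \<open>With at most one bit, an involution has residue zero and that bit set, which
      is the number \<open>r\<close>.\<close>
    have "g = r" if g: "g < grp_order" "g \<noteq> 0" "add g g = 0" for g
    proof -
      have "g mod r = 0" "\<exists>j<a. bit (g div r) j" using involution_bit[OF g] .
      moreover from this False have "a = 1" by auto
      then have "g div r < 2" using g(1) unfolding less_size_iff by simp
      moreover have "g div r \<noteq> 0" using calculation(2) by (metis bit_0_eq bot_apply bot_bool_def)
      ultimately have "g div r = 1" by simp
      then show ?thesis using \<open>g mod r = 0\<close> mult_div_mod_eq[of r g] by simp
    qed
    then show ?thesis by blast
  qed
qed

text \<open>Two bits would provide the distinct involutions \<open>r\<close> and \<open>2 r\<close>,
  and without bits there is none; so there is exactly one bit.\<close>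

lemma lone_involution_size:
  assumes lone_involution
  shows "grp_order = 2 * r"
proof -
  obtain g where g: "g < grp_order" "g \<noteq> 0" "add g g = 0"
    and u: "\<forall>h<grp_order. h \<noteq> 0 \<longrightarrow> add h h = 0 \<longrightarrow> h = g"
    using assms unfolding lone_involution_def by blast
  have "a > 0" using involution_bit(2)[OF g] by auto
  moreover have "\<not> a \<ge> 2"
  proof
    assume "a \<ge> 2"
    then have j: "0 < a" "1 < a" by auto
    have "r * 2 ^ 0 = g" "r * 2 ^ 1 = g"
      using u involution_of_bit[OF j(1)] involution_of_bit[OF j(2)] by blast+
    then show False using r_pos by simp
  qed
  ultimately have "a = 1" by simp
  then show ?thesis unfolding grp_order_def by simp
qed

end

lemma odd_part_exists:
  fixes n :: nat
  assumes "n > 0"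
  obtains r a where "odd r" "n = r * 2 ^ a"
proof -
  have "\<exists>r a. odd r \<and> n = r * 2 ^ a" using assms
  proof (induction n rule: less_induct)
    case (less n)
    show ?case
    proof (cases "odd n")
      case True
      then show ?thesis by (intro exI[of _ n] exI[of _ 0]) simp
    next
      case False
      then obtain k where k: "n = 2 * k" by blast
      then have "k < n" "k > 0" using less(2) by auto
      then obtain r a where "odd r" "k = r * 2 ^ a" using less(1) by blast
      then show ?thesis using k by (intro exI[of _ r] exI[of _ "Suc a"]) simp
    qed
  qed
  then show ?thesis using that by blast
qed

theorem theorem1:
  fixes n :: nat
  assumes "infinite (UNIV :: 'a::field set)" and "n \<ge> 1"
  shows "\<not> (\<exists>m. \<exists>p \<in> (free_algebra m :: 'a ncpoly set). is_nu_central 4 m n p)"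
proof -
  obtain r a where ra: "odd r" "n = r * 2 ^ a" using odd_part_exists assms(2) by (metis less_eq_Suc_le One_nat_def)
  \<comment> \<open>The odd part of \<open>n\<close> gives the cyclic factor, the power of 2 the
    elementary abelian one.\<close>
  interpret cyclic_elementary r a by standard (rule ra(1))
  have n: "n = grp_order" using ra by (simp add: grp_order_def)
  have "\<not> is_nu_central 4 m grp_order p" if "p \<in> free_algebra m" for m and p :: "'a ncpoly"
    using no_4_central[OF assms(1) that] lone_involution_size ra(1) by blast
  then show ?thesis unfolding n by blast
qed

end
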